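(* Let $(X_i,d_i,\mu_i)$, $i=1,2$, be spaces of homogeneous type with upper dimensions $\omega_i$ and wavelet bases of Hölder exponents $\eta_i$. Let $\max\{\frac{\omega_1}{\omega_1+\eta_1},\frac{\omega_2}{\omega_2+\eta_2}\}<p_2\le1$. Suppose $p_2<p<p_1<\infty$, $\alpha>0$, and $f\in H^p(X_1\times X_2)$. Then we may write $$f=g+b,$$ where $g\in H^{p_1}(X_1\times X_2)$ and $b\in H^{p_2}(X_1\times X_2)$ are such that $$\|g\|_{H^{p_1}(X_1\times X_2)}^{p_1}\le C\alpha^{p_1-p}\|f\|_{H^p(X_1\times X_2)}^p\quad\text{and}\quad\|b\|_{H^{p_2}(X_1\times X_2)}^{p_2}\le C\alpha^{p_2-p}\|f\|_{H^p(X_1\times X_2)}^p.$$ Here $C$ is an absolute constant (in particular independent of $f$ and $\alpha$).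
   Context: For $i=1,2$: $(X_i,d_i,\mu_i)$ is a space of homogeneous type, i.e. $d_i$ is a quasi-metric (symmetric, nonnegative, zero exactly on the diagonal, $d_i(x,y)\le A_0^{(i)}[d_i(x,z)+d_i(z,y)]$ with $A_0^{(i)}\ge1$) and $\mu_i$ is a nonzero measure with $\mu_i(B(x,2r))\le C_{\mu_i}\mu_i(B(x,r))<\infty$ for all $x,r$, $B(x,r)=\{y:d_i(x,y)<r\}$. Standing assumptions: $\mu_i(X_i)=\infty$, $\mu_i(B(x,r))>0$ always. An upper dimension of $\mu_i$ is $\omega_i>0$ with $\mu_i(B(x,\lambda r))\le C\lambda^{\omega_i}\mu_i(B(x,r))$ for all $x$, $\lambda\ge1$, $r>0$. Write $V_r(x)=\mu_i(B(x,r))$, $V(x,y)=\mu_i(B(x,d_i(x,y)))$. $X_1\times X_2$ carries $\mu=\mu_1\times\mu_2$. On each $X_i$ (suppressing $i$): fix a small $\delta\in(0,1)$ (e.g. $\delta\le10^{-3}A_0^{-10}$); $\mathscr{X}^0$ is a maximal $1$-separated subset and inductively $\mathscr{X}^k\supseteq\mathscr{X}^{k-1}$, $\mathscr{X}^{-k}\subseteq\mathscr{X}^{-(k-1)}$ are maximal $\delta^{k}$- and $\delta^{-k}$-separated collections (in $X$ and in $\mathscr{X}^{-(k-1)}$ respectively), $k\ge1$; $\mathscr{Y}^k=\mathscr{X}^{k+1}\setminus\mathscr{X}^k=\{y_\alpha^k\}_\alpha$ (indices identified with points). Half-open dyadic cubes (Hytönen--Kairema) $Q_\alpha^k$, $\alpha\in\mathscr{X}^k$,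 with center $x_\alpha^k$: for each $k$ they partition $X$, they are nested ($\ell\ge k$ implies $Q_\beta^\ell\subseteq Q_\alpha^k$ or disjoint), and $B(x_\alpha^k,c_1\delta^k)\subseteq Q_\alpha^k\subseteq B(x_\alpha^k,C_1\delta^k)$, $c_1=(3A_0^2)^{-1}$, $C_1=4A_0^2$. For $\alpha\in\mathscr{Y}^k$, $Q_\alpha^k$ denotes the dyadic cube centered at $y_\alpha^k\in\mathscr{X}^{k+1}$ (of generation $k+1$). $\{\psi_\alpha^k\}_{k\in\mathbb{Z},\alpha\in\mathscr{Y}^k}$ is the Auscher--Hytönen orthonormal basis of $L^2(X)$, satisfying, with $a=(1+2\log_2A_0)^{-1}$ and $C<\infty,\nu>0,\eta\in(0,1]$ independent of $k,\alpha$ and points: $|\psi_\alpha^k(x)|\le C\mu(B(y_\alpha^k,\delta^k))^{-1/2}\exp(-\nu(d(y_\alpha^k,x)/\delta^k)^a)$; $|\psi_\alpha^k(x)-\psi_\alpha^k(y)|\le C\mu(B(y_\alpha^k,\delta^k))^{-1/2}(d(x,y)/\delta^k)^\eta\exp(-\nu(d(y_\alpha^k,x)/\delta^k)^a)$ for $d(x,y)\le\delta^k$; $\int\psi_\alpha^k\,d\mu=0$. The exponent for $X_i$ is $\eta_i$. $\psi_{\alpha_1}^{k_1}\psi_{\alpha_2}^{k_2}$ is the tensor product, $\psi_{\alpha_i}^{k_i}$ acting in the $X_i$ variable. One-parameter test functions on $X$ ($x_0\in X$, $r>0$, $\beta\in(0,\eta]$, $\gamma>0$): $G(x_0,r,\beta,\gamma)$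 is the set of $f$ for which there is $C>0$ with (i) $|f(x)|\le C\frac{1}{V_r(x_0)+V(x,x_0)}\big(\frac{r}{r+d(x,x_0)}\big)^\gamma$ for all $x$; (ii) $|f(x)-f(y)|\le C\big(\frac{d(x,y)}{r+d(x,x_0)}\big)^\beta\frac{1}{V_r(x_0)+V(x,x_0)}\big(\frac{r}{r+d(x,x_0)}\big)^\gamma$ if $d(x,y)<(2A_0)^{-1}(r+d(x,x_0))$; (iii) $\int f\,d\mu=0$; norm = infimum of such $C$. Product test functions: for $(x_0,y_0)\in X_1\times X_2$, $r=(r_1,r_2)$, $r_i>0$, $\beta_i\in(0,\eta_i]$, $\gamma_i>0$, $G(x_0,y_0;r;\beta;\gamma)$ is the set of $f$ on $X_1\times X_2$ such that $f(\cdot,y)\in G(x_0,r_1,\beta_1,\gamma_1)$ for each $y$, $f(x,\cdot)\in G(y_0,r_2,\beta_2,\gamma_2)$ for each $x$, and for some $C$: (i) $\|f(\cdot,y)\|_{G(x_0,r_1,\beta_1,\gamma_1)}\le C\frac{1}{V_{r_2}(y_0)+V(y,y_0)}\big(\frac{r_2}{r_2+d_2(y,y_0)}\big)^{\gamma_2}$ for all $y$; (ii) $\|f(\cdot,y)-f(\cdot,y')\|_{G(x_0,r_1,\beta_1,\gamma_1)}\le C\big(\frac{d_2(y,y')}{r_2+d_2(y,y_0)}\big)^{\beta_2}\frac{1}{V_{r_2}(y_0)+V(y_0,y)}\big(\frac{r_2}{r_2+d_2(y,y_0)}\big)^{\gamma_2}$ if $d_2(y,y')\le(2A_0^{(2)})^{-1}(r_2+d_2(y,y_0))$;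 (iii) (i),(ii) hold with the roles of the two variables interchanged; (iv) $\int f(x,y)\,d\mu_1(x)=0$ for all $y$ and $\int f(x,y)\,d\mu_2(y)=0$ for all $x$. Norm = infimum of $C$ in (i)--(iii). Fix $(x_0,y_0)$ and set $G(\beta_1,\beta_2;\gamma_1,\gamma_2)=G(x_0,y_0;1,1;\beta;\gamma)$. $\mathring{G}(\beta_1,\beta_2;\gamma_1,\gamma_2)$ is the completion of $G(\eta_1,\eta_2;\gamma_1,\gamma_2)$ in the norm of $G(\beta_1,\beta_2;\gamma_1,\gamma_2)$, with that norm. Fix $\beta_i\in(0,\eta_i)$ and $\gamma_i>0$, $i=1,2$, and write $\mathring{G}=\mathring{G}(\beta_1,\beta_2;\gamma_1,\gamma_2)$, and $(\mathring{G})'$ for the space of bounded linear functionals on it (distributions), $\langle\cdot,\cdot\rangle$ the pairing. Hardy spaces: $\widetilde S(f)(x_1,x_2)=\big\{\sum_{k_1}\sum_{\alpha_1\in\mathscr{Y}^{k_1}}\sum_{k_2}\sum_{\alpha_2\in\mathscr{Y}^{k_2}}|\langle\psi_{\alpha_1}^{k_1}\psi_{\alpha_2}^{k_2},f\rangle\widetilde\chi_{Q_{\alpha_1}^{k_1}}(x_1)\widetilde\chi_{Q_{\alpha_2}^{k_2}}(x_2)|^2\big\}^{1/2}$, $\widetilde\chi_Q=\chi_Q\,\mu_i(Q)^{-1/2}$. For $\max\{\frac{\omega_1}{\omega_1+\eta_1},\frac{\omega_2}{\omega_2+\eta_2}\}<q<\infty$, $H^q(X_1\times X_2)=\{f\in(\mathring{G})':\widetilde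 S(f)\in L^q(X_1\times X_2)\}$ with $\|f\|_{H^q}=\|\widetilde S(f)\|_{L^q}$; for $1<q<\infty$, $H^q(X_1\times X_2)=L^q(X_1\times X_2)$. *)

theory Defs
  imports "HOL-Analysis.Analysis"
begin

section \<open>Spaces of homogeneous type\<close>

text \<open>The underlying set of a space is the whole type \<open>'a\<close>.\<close>

record 'a homog =
  meas :: "'a measure"
  qd :: "'a \<Rightarrow> 'a \<Rightarrow> real"
  qconst :: real

definition qball :: "('a, 'z) homog_scheme \<Rightarrow> 'a \<Rightarrow> real \<Rightarrow> 'a set" where
  "qball S x r = {y. qd S x y < r}"

definition vol :: "('a, 'z) homog_scheme \<Rightarrow> 'a \<Rightarrow> real \<Rightarrow> real" where
  "vol S x r = measure (meas S) (qball S x r)"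

definition vol2 :: "('a, 'z) homog_scheme \<Rightarrow> 'a \<Rightarrow> 'a \<Rightarrow> real" where
  "vol2 S x y = vol S x (qd S x y)"

definition quasi_metric :: "('a \<Rightarrow> 'a \<Rightarrow> real) \<Rightarrow> real \<Rightarrow> bool" where
  "quasi_metric d A \<longleftrightarrow> A \<ge> 1 \<and>
     (\<forall>x y. d x y \<ge> 0 \<and> d x y = d y x \<and> (d x y = 0 \<longleftrightarrow> x = y)) \<and>
     (\<forall>x y z. d x y \<le> A * (d x z + d z y))"

text \<open>The measure is defined on a sigma-algebra containing the balls, so that \<open>\<mu>(B(x,r))\<close> makes
  sense. Positivity of balls and infinite total mass are standing assumptions; they make the
  measure nonzero.\<close>

definition homogeneous_space :: "('a, 'z) homog_scheme \<Rightarrow> bool" where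
  "homogeneous_space S \<longleftrightarrow>
     quasi_metric (qd S) (qconst S) \<and>
     space (meas S) = UNIV \<and>
     (\<forall>x r. qball S x r \<in> sets (meas S)) \<and>
     (\<exists>C::real. \<forall>x. \<forall>r>0.
        emeasure (meas S) (qball S x (2 * r)) \<le> ennreal C * emeasure (meas S) (qball S x r)) \<and>
     (\<forall>x. \<forall>r>0. 0 < emeasure (meas S) (qball S x r) \<and> emeasure (meas S) (qball S x r) < \<infinity>) \<and>
     emeasure (meas S) UNIV = \<infinity>"

definition upper_dimension :: "('a, 'z) homog_scheme \<Rightarrow> real \<Rightarrow> bool" where
  "upper_dimension S \<omega> \<longleftrightarrow> \<omega> > 0 \<and>
     (\<exists>C. \<forall>x. \<forall>l\<ge>1. \<forall>r>0. vol S x (l * r) \<le> C * l powr \<omega> * vol S x r)"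


section \<open>Dyadic cubes and wavelets\<close>

text \<open>\<open>nodes T k\<close> is the set of reference points of generation \<open>k\<close>. Indices are identified with
  points: \<open>cube T k x\<close> is the cube with centre \<open>x \<in> nodes T k\<close>, and \<open>wav T k y\<close> is the wavelet
  attached to \<open>y \<in> wnodes T k\<close>. \<open>hexp T\<close> is the Hoelder exponent of the wavelets.\<close>

record 'a whomog = "'a homog" +
  mesh :: real
  nodes :: "int \<Rightarrow> 'a set"
  cube :: "int \<Rightarrow> 'a \<Rightarrow> 'a set"
  wav :: "int \<Rightarrow> 'a \<Rightarrow> 'a \<Rightarrow> complex"
  hexp :: real

definition wnodes :: "('a, 'z) whomog_scheme \<Rightarrow> int \<Rightarrow> 'a set" where
  "wnodes T k = nodes T (k + 1) - nodes T k"

definition separated :: "('a \<Rightarrow> 'a \<Rightarrow> real) \<Rightarrow> real \<Rightarrow> 'a set \<Rightarrow> bool" where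
  "separated d e P \<longleftrightarrow> (\<forall>x\<in>P. \<forall>y\<in>P. x \<noteq> y \<longrightarrow> d x y \<ge> e)"

definition maximal_separated :: "('a \<Rightarrow> 'a \<Rightarrow> real) \<Rightarrow> real \<Rightarrow> 'a set \<Rightarrow> 'a set \<Rightarrow> bool" where
  "maximal_separated d e A P \<longleftrightarrow> P \<subseteq> A \<and> separated d e P \<and>
     (\<forall>P'. P \<subseteq> P' \<and> P' \<subseteq> A \<and> separated d e P' \<longrightarrow> P' = P)"

text \<open>No numerical smallness of the mesh is imposed: existence of the cubes and of the wavelets
  is part of the hypotheses.\<close>

definition dyadic_points :: "('a, 'z) whomog_scheme \<Rightarrow> bool" where
  "dyadic_points T \<longleftrightarrow> 0 < mesh T \<and> mesh T < 1 \<and>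
     maximal_separated (qd T) 1 UNIV (nodes T 0) \<and>
     (\<forall>k\<ge>1. nodes T (k - 1) \<subseteq> nodes T k \<and>
        maximal_separated (qd T) (mesh T powi k) UNIV (nodes T k)) \<and>
     (\<forall>k\<ge>1. maximal_separated (qd T) (mesh T powi (- k)) (nodes T (- (k - 1))) (nodes T (- k)))"

definition dyadic_cubes :: "('a, 'z) whomog_scheme \<Rightarrow> bool" where
  "dyadic_cubes T \<longleftrightarrow>
     (\<forall>k. (\<Union>x\<in>nodes T k. cube T k x) = UNIV \<and> disjoint_family_on (cube T k) (nodes T k)) \<and>
     (\<forall>k l. \<forall>x\<in>nodes T k. \<forall>y\<in>nodes T l. k \<le> l \<longrightarrow>
        cube T l y \<subseteq> cube T k x \<or> cube T l y \<inter> cube T k x = {}) \<and>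
     (\<forall>k. \<forall>x\<in>nodes T k. cube T k x \<in> sets (meas T) \<and>
        qball T x (1 / (3 * (qconst T)\<^sup>2) * mesh T powi k) \<subseteq> cube T k x \<and>
        cube T k x \<subseteq> qball T x (4 * (qconst T)\<^sup>2 * mesh T powi k))"

definition square_integrable :: "'a measure \<Rightarrow> ('a \<Rightarrow> complex) \<Rightarrow> bool" where
  "square_integrable M f \<longleftrightarrow> f \<in> borel_measurable M \<and> integrable M (\<lambda>x. (norm (f x))\<^sup>2)"

definition orthonormal_basis_L2 :: "'a measure \<Rightarrow> 'i set \<Rightarrow> ('i \<Rightarrow> 'a \<Rightarrow> complex) \<Rightarrow> bool" where
  "orthonormal_basis_L2 M J e \<longleftrightarrow>
     (\<forall>i\<in>J. square_integrable M (e i)) \<and>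
     (\<forall>i\<in>J. \<forall>j\<in>J. (\<integral>x. e i x * cnj (e j x) \<partial>M) = (if i = j then 1 else 0)) \<and>
     (\<forall>f. square_integrable M f \<longrightarrow> (\<forall>\<epsilon>>0. \<exists>F c. finite F \<and> F \<subseteq> J \<and>
        (\<integral>x. (norm (f x - (\<Sum>i\<in>F. c i * e i x)))\<^sup>2 \<partial>M) < \<epsilon>))"

definition wavelet_envelope :: "('a, 'z) whomog_scheme \<Rightarrow> real \<Rightarrow> int \<Rightarrow> 'a \<Rightarrow> 'a \<Rightarrow> real" where
  "wavelet_envelope T \<nu> k y x =
     vol T y (mesh T powi k) powr (- 1 / 2) *
     exp (- \<nu> * (qd T y x / mesh T powi k) powr (1 / (1 + 2 * log 2 (qconst T))))"

definition wavelet_basis :: "('a, 'z) whomog_scheme \<Rightarrow> bool" where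
  "wavelet_basis T \<longleftrightarrow> 0 < hexp T \<and> hexp T \<le> 1 \<and>
     orthonormal_basis_L2 (meas T) {(k, y). y \<in> wnodes T k} (\<lambda>(k, y). wav T k y) \<and>
     (\<exists>C. \<exists>\<nu>>0. \<forall>k. \<forall>y\<in>wnodes T k.
        (\<forall>x. norm (wav T k y x) \<le> C * wavelet_envelope T \<nu> k y x) \<and>
        (\<forall>x x'. qd T x x' \<le> mesh T powi k \<longrightarrow>
           norm (wav T k y x - wav T k y x')
             \<le> C * (qd T x x' / mesh T powi k) powr hexp T * wavelet_envelope T \<nu> k y x)) \<and>
     (\<forall>k. \<forall>y\<in>wnodes T k. has_bochner_integral (meas T) (wav T k y) 0)"

definition wavelet_space :: "('a, 'z) whomog_scheme \<Rightarrow> bool" where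
  "wavelet_space T \<longleftrightarrow>
     homogeneous_space T \<and> dyadic_points T \<and> dyadic_cubes T \<and> wavelet_basis T"


section \<open>One-parameter test functions\<close>

definition bump :: "real \<Rightarrow> real \<Rightarrow> real \<Rightarrow> real \<Rightarrow> real" where
  "bump v r \<gamma> t = 1 / v * (r / (r + t)) powr \<gamma>"

definition test_bound ::
    "('a, 'z) homog_scheme \<Rightarrow> 'a \<Rightarrow> real \<Rightarrow> real \<Rightarrow> real \<Rightarrow> ('a \<Rightarrow> complex) \<Rightarrow> real \<Rightarrow> bool" where
  "test_bound S x0 r \<beta> \<gamma> f C \<longleftrightarrow>
     (\<forall>x. norm (f x) \<le> C * bump (vol S x0 r + vol2 S x x0) r \<gamma> (qd S x x0)) \<and>
     (\<forall>x y. qd S x y < 1 / (2 * qconst S) * (r + qd S x x0) \<longrightarrow>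
        norm (f x - f y) \<le> C * (qd S x y / (r + qd S x x0)) powr \<beta> *
          bump (vol S x0 r + vol2 S x x0) r \<gamma> (qd S x x0))"

definition test_functions ::
    "('a, 'z) homog_scheme \<Rightarrow> 'a \<Rightarrow> real \<Rightarrow> real \<Rightarrow> real \<Rightarrow> ('a \<Rightarrow> complex) set" where
  "test_functions S x0 r \<beta> \<gamma> =
     {f. (\<exists>C>0. test_bound S x0 r \<beta> \<gamma> f C) \<and> has_bochner_integral (meas S) f 0}"

definition test_norm ::
    "('a, 'z) homog_scheme \<Rightarrow> 'a \<Rightarrow> real \<Rightarrow> real \<Rightarrow> real \<Rightarrow> ('a \<Rightarrow> complex) \<Rightarrow> real" where
  "test_norm S x0 r \<beta> \<gamma> f = Inf {C. C > 0 \<and> test_bound S x0 r \<beta> \<gamma> f C}"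


section \<open>Product test functions and distributions\<close>

text \<open>Conditions on a family \<open>u\<close> of one-parameter test functions on \<open>S\<close>, indexed by the points of
  \<open>S'\<close>. For a function \<open>f\<close> of two variables they are used for \<open>y \<mapsto> f(\<cdot>,y)\<close> and, with the roles
  of the variables interchanged, for \<open>x \<mapsto> f(x,\<cdot>)\<close>.\<close>

definition slice_bound ::
    "('a, 'z) homog_scheme \<Rightarrow> 'a \<Rightarrow> real \<Rightarrow> real \<Rightarrow> real \<Rightarrow>
     ('b, 'w) homog_scheme \<Rightarrow> 'b \<Rightarrow> real \<Rightarrow> real \<Rightarrow> real \<Rightarrow>
     ('b \<Rightarrow> 'a \<Rightarrow> complex) \<Rightarrow> real \<Rightarrow> bool" where
  "slice_bound S x0 r \<beta> \<gamma> S' y0 r' \<beta>' \<gamma>' u C \<longleftrightarrow>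
     (\<forall>y. test_norm S x0 r \<beta> \<gamma> (u y)
        \<le> C * bump (vol S' y0 r' + vol2 S' y y0) r' \<gamma>' (qd S' y y0)) \<and>
     (\<forall>y y'. qd S' y y' \<le> 1 / (2 * qconst S') * (r' + qd S' y y0) \<longrightarrow>
        test_norm S x0 r \<beta> \<gamma> (\<lambda>x. u y x - u y' x)
        \<le> C * (qd S' y y' / (r' + qd S' y y0)) powr \<beta>' *
            bump (vol S' y0 r' + vol2 S' y0 y) r' \<gamma>' (qd S' y y0))"

definition prod_test_bound ::
    "('a, 'z) homog_scheme \<Rightarrow> ('b, 'w) homog_scheme \<Rightarrow> 'a \<times> 'b \<Rightarrow> real \<times> real \<Rightarrow>
     real \<times> real \<Rightarrow> real \<times> real \<Rightarrow> ('a \<times> 'b \<Rightarrow> complex) \<Rightarrow> real \<Rightarrow> bool" where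
  "prod_test_bound S1 S2 z0 r \<beta> \<gamma> f C \<longleftrightarrow>
     slice_bound S1 (fst z0) (fst r) (fst \<beta>) (fst \<gamma>)
       S2 (snd z0) (snd r) (snd \<beta>) (snd \<gamma>) (\<lambda>y x. f (x, y)) C \<and>
     slice_bound S2 (snd z0) (snd r) (snd \<beta>) (snd \<gamma>)
       S1 (fst z0) (fst r) (fst \<beta>) (fst \<gamma>) (\<lambda>x y. f (x, y)) C"

text \<open>The vanishing of the two partial integrals is contained in the membership of the slices in
  the one-parameter spaces.\<close>

definition prod_test_functions ::
    "('a, 'z) homog_scheme \<Rightarrow> ('b, 'w) homog_scheme \<Rightarrow> 'a \<times> 'b \<Rightarrow> real \<times> real \<Rightarrow>
     real \<times> real \<Rightarrow> real \<times> real \<Rightarrow> ('a \<times> 'b \<Rightarrow> complex) set" where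
  "prod_test_functions S1 S2 z0 r \<beta> \<gamma> =
     {f. (\<forall>y. (\<lambda>x. f (x, y)) \<in> test_functions S1 (fst z0) (fst r) (fst \<beta>) (fst \<gamma>)) \<and>
         (\<forall>x. (\<lambda>y. f (x, y)) \<in> test_functions S2 (snd z0) (snd r) (snd \<beta>) (snd \<gamma>)) \<and>
         (\<exists>C. prod_test_bound S1 S2 z0 r \<beta> \<gamma> f C)}"

definition prod_test_norm ::
    "('a, 'z) homog_scheme \<Rightarrow> ('b, 'w) homog_scheme \<Rightarrow> 'a \<times> 'b \<Rightarrow> real \<times> real \<Rightarrow>
     real \<times> real \<Rightarrow> real \<times> real \<Rightarrow> ('a \<times> 'b \<Rightarrow> complex) \<Rightarrow> real" where
  "prod_test_norm S1 S2 z0 r \<beta> \<gamma> f = Inf {C. prod_test_bound S1 S2 z0 r \<beta> \<gamma> f C}"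

text \<open>The space \<open>G(\<beta>;\<gamma>)\<close> is complete and contains \<open>G(\<eta>;\<gamma>)\<close>, so the completion of \<open>G(\<eta>;\<gamma>)\<close> in
  the norm of \<open>G(\<beta>;\<gamma>)\<close> is its closure in \<open>G(\<beta>;\<gamma>)\<close>.\<close>

definition test_completion ::
    "('a, 'z) whomog_scheme \<Rightarrow> ('b, 'w) whomog_scheme \<Rightarrow> 'a \<times> 'b \<Rightarrow>
     real \<times> real \<Rightarrow> real \<times> real \<Rightarrow> ('a \<times> 'b \<Rightarrow> complex) set" where
  "test_completion T1 T2 z0 \<beta> \<gamma> =
     {\<phi> \<in> prod_test_functions T1 T2 z0 (1, 1) \<beta> \<gamma>.
        \<forall>\<epsilon>>0. \<exists>h \<in> prod_test_functions T1 T2 z0 (1, 1) (hexp T1, hexp T2) \<gamma>.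
          prod_test_norm T1 T2 z0 (1, 1) \<beta> \<gamma> (\<lambda>z. \<phi> z - h z) < \<epsilon>}"

text \<open>Only the values of a distribution on \<open>test_completion\<close> are meaningful; accordingly,
  equality of distributions is equality on \<open>test_completion\<close>.\<close>

definition distributions ::
    "('a, 'z) whomog_scheme \<Rightarrow> ('b, 'w) whomog_scheme \<Rightarrow> 'a \<times> 'b \<Rightarrow>
     real \<times> real \<Rightarrow> real \<times> real \<Rightarrow> (('a \<times> 'b \<Rightarrow> complex) \<Rightarrow> complex) set" where
  "distributions T1 T2 z0 \<beta> \<gamma> =
     {f. (\<forall>\<phi>\<in>test_completion T1 T2 z0 \<beta> \<gamma>. \<forall>\<phi>'\<in>test_completion T1 T2 z0 \<beta> \<gamma>.
            f (\<lambda>z. \<phi> z + \<phi>' z) = f \<phi> + f \<phi>') \<and>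
         (\<forall>c. \<forall>\<phi>\<in>test_completion T1 T2 z0 \<beta> \<gamma>. f (\<lambda>z. c * \<phi> z) = c * f \<phi>) \<and>
         (\<exists>K. \<forall>\<phi>\<in>test_completion T1 T2 z0 \<beta> \<gamma>.
            norm (f \<phi>) \<le> K * prod_test_norm T1 T2 z0 (1, 1) \<beta> \<gamma> \<phi>)}"


section \<open>Product Hardy spaces\<close>

text \<open>Real powers \<open>t\<^sup>q\<close> with \<open>q > 0\<close> of \<open>t \<in> [0,\<infinity>]\<close>.\<close>

definition ennpowr :: "ennreal \<Rightarrow> real \<Rightarrow> ennreal" where
  "ennpowr t q = (if t = \<infinity> then \<infinity> else ennreal (enn2real t powr q))"

definition Lq_norm :: "'a measure \<Rightarrow> real \<Rightarrow> ('a \<Rightarrow> ennreal) \<Rightarrow> ennreal" where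
  "Lq_norm M q F = ennpowr (\<integral>\<^sup>+x. ennpowr (F x) q \<partial>M) (1 / q)"

definition normalized_indicator :: "'a measure \<Rightarrow> 'a set \<Rightarrow> 'a \<Rightarrow> real" where
  "normalized_indicator M A x = indicator A x * measure M A powr (- 1 / 2)"

definition tensor_wav ::
    "('a, 'z) whomog_scheme \<Rightarrow> ('b, 'w) whomog_scheme \<Rightarrow> int \<Rightarrow> 'a \<Rightarrow> int \<Rightarrow> 'b \<Rightarrow>
     'a \<times> 'b \<Rightarrow> complex" where
  "tensor_wav T1 T2 k1 y1 k2 y2 = (\<lambda>(x1, x2). wav T1 k1 y1 x1 * wav T2 k2 y2 x2)"

text \<open>The cube indexed by \<open>y \<in> wnodes T k\<close> is the one of generation \<open>k + 1\<close> centred at \<open>y\<close>. The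
  sum of nonnegative terms may be infinite.\<close>

definition square_function ::
    "('a, 'z) whomog_scheme \<Rightarrow> ('b, 'w) whomog_scheme \<Rightarrow>
     (('a \<times> 'b \<Rightarrow> complex) \<Rightarrow> complex) \<Rightarrow> 'a \<times> 'b \<Rightarrow> ennreal" where
  "square_function T1 T2 f = (\<lambda>(x1, x2).
     ennpowr
       (\<Sum>\<^sub>\<infinity>(k1, y1, k2, y2) \<in> {(k1, y1, k2, y2). y1 \<in> wnodes T1 k1 \<and> y2 \<in> wnodes T2 k2}.
          ennreal ((norm (f (tensor_wav T1 T2 k1 y1 k2 y2)) *
            normalized_indicator (meas T1) (cube T1 (k1 + 1) y1) x1 *
            normalized_indicator (meas T2) (cube T2 (k2 + 1) y2) x2)\<^sup>2))
       (1 / 2))"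

definition hardy_space ::
    "('a, 'z) whomog_scheme \<Rightarrow> ('b, 'w) whomog_scheme \<Rightarrow> 'a \<times> 'b \<Rightarrow>
     real \<times> real \<Rightarrow> real \<times> real \<Rightarrow> real \<Rightarrow> (('a \<times> 'b \<Rightarrow> complex) \<Rightarrow> complex) set" where
  "hardy_space T1 T2 z0 \<beta> \<gamma> q =
     {f \<in> distributions T1 T2 z0 \<beta> \<gamma>.
        square_function T1 T2 f \<in> borel_measurable (meas T1 \<Otimes>\<^sub>M meas T2) \<and>
        Lq_norm (meas T1 \<Otimes>\<^sub>M meas T2) q (square_function T1 T2 f) < \<infinity>}"

definition hardy_norm ::
    "('a, 'z) whomog_scheme \<Rightarrow> ('b, 'w) whomog_scheme \<Rightarrow> real \<Rightarrow>
     (('a \<times> 'b \<Rightarrow> complex) \<Rightarrow> complex) \<Rightarrow> real" where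
  "hardy_norm T1 T2 q f =
     enn2real (Lq_norm (meas T1 \<Otimes>\<^sub>M meas T2) q (square_function T1 T2 f))"

end

theory Submission
  imports Defs
begin

text \<open>
  The square function of \<open>f\<close> depends on \<open>f\<close> only through the coefficients \<open>c\<^sub>R\<close>, the values of \<open>f\<close>
  on the tensor wavelets, indexed by dyadic rectangles \<open>R\<close>. Its square, the energy, is
  \<open>T = \<Sum>\<^sub>R |c\<^sub>R|\<^sup>2 \<chi>\<^sub>R / |R|\<close>, so keeping only the rectangles of a family \<open>A\<close> replaces \<open>T\<close> by the partial
  sum \<open>T\<^sub>A\<close>. The decomposition is obtained from \<open>\<Omega> = {T > \<alpha>\<^sup>2}\<close>: a rectangle is good if at least half
  of it lies outside \<open>\<Omega>\<close>, and otherwise at least half of it lies inside \<open>\<Omega>\<close> and it is bad. The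
  function \<open>g\<close> carries the good coefficients, \<open>b\<close> the bad ones.

  Bad part. The union \<open>U\<close> of finitely many bad rectangles satisfies \<open>|U| \<le> 16 |\<Omega>|\<close>
  (\<open>emeasure_dense_rectangles_Union_le\<close>), a weak form of the strong maximal theorem which follows by
  applying a covering argument for nested cubes in one variable after the other. Their part of the
  energy is at most \<open>T\<close> on \<open>\<Omega>\<close>, at most \<open>\<alpha>\<^sup>2\<close> on \<open>U - \<Omega>\<close> and zero elsewhere. With Chebyshev's inequality for
  \<open>\<Omega>\<close> and monotone convergence this gives the bound in \<open>H\<^bsup>p2\<^esup>\<close>.

  Good part. If every rectangle of a family has half of its mass in \<open>E\<close>, then for every natural
  number \<open>s \<ge> 1\<close> the integral of the \<open>s\<close>-th power of the energy of this family over the whole space is at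
  most a constant times its integral over \<open>E\<close> (\<open>nn_integral_dense_rectangles_le\<close>). In one variable this
  is elementary, without maximal functions: adding the cubes from the largest to the smallest, the
  energy is constant on the cube that is being added, and the mass of the cube can be exchanged for
  the mass of its large subset. The case of rectangles follows by treating the variables in turn.
  Outside \<open>\<Omega>\<close> the energy is at most \<open>\<alpha>\<^sup>2\<close>; this controls \<open>g\<close> in \<open>H\<^bsup>2s\<^esup>\<close> for a large \<open>s\<close>. As the energy of \<open>g\<close> is
  at most \<open>T\<close>, interpolation between \<open>p\<close> and \<open>2 s\<close> gives all exponents in between
  (\<open>ennpowr_interpolate\<close>), in particular \<open>p1\<close>.

  Distributions. For \<open>p1 \<le> 1\<close> a sequence of coefficients whose square function is in \<open>L\<^bsup>p1\<^esup>\<close> need not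
  define a bounded functional on test functions of small Hoelder exponent, so the convergence of the
  two partial sums is not automatic. However one of them always has its energy in \<open>L\<^sup>1\<close>: the good one
  if \<open>p \<le> 2\<close>, because \<open>p \<le> 2 \<le> 2 s\<close>, and the bad one if \<open>p > 2\<close>, because \<open>p2 \<le> 1 < 2 < p\<close>. Its coefficients are then
  square summable, and as test functions embed in \<open>L\<^sup>2\<close>, Bessel's inequality shows that the wavelet
  series is a distribution (\<open>wavelet_series_distribution\<close>). The other part is defined as the difference
  from \<open>f\<close>, and a difference of distributions is a distribution.
\<close>

section \<open>Real powers on the extended half-line\<close>

lemma ennpowr_0 [simp]: "ennpowr 0 q = 0"
  by (simp add: ennpowr_def)

lemma ennpowr_top [simp]: "ennpowr top q = top"
  by (simp add: ennpowr_def)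

lemma ennpowr_ennreal: "0 \<le> t \<Longrightarrow> ennpowr (ennreal t) q = ennreal (t powr q)"
  by (simp add: ennpowr_def)

lemma ennpowr_mono: "s \<le> t \<Longrightarrow> 0 \<le> q \<Longrightarrow> ennpowr s q \<le> ennpowr t q"
  by (cases s; cases t) (auto simp: ennpowr_ennreal powr_mono2 top_unique)

lemma ennpowr_ennpowr: "ennpowr (ennpowr t q) r = ennpowr t (q * r)"
  by (cases t) (auto simp: ennpowr_ennreal powr_powr)

lemma ennpowr_one [simp]: "ennpowr t 1 = t"
  by (cases t) (auto simp: ennpowr_ennreal)

lemma ennpowr_Suc: "ennpowr t (real (Suc m)) = t ^ Suc m"
proof (cases t)
  case (real x)
  have "x powr real (Suc m) = x ^ Suc m"
    using real by (cases "x = 0") (simp_all add: powr_realpow del: of_nat_Suc)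
  then show ?thesis using real by (simp add: ennpowr_ennreal ennreal_power del: of_nat_Suc power_Suc)
qed (simp add: top_power_ennreal del: of_nat_Suc)

text \<open>A Galois connection: it turns every inequality for powers into one for the arguments, and makes
  the commutation of powers with suprema formal.\<close>

lemma ennpowr_le_iff:
  assumes "0 < q"
  shows "ennpowr t q \<le> B \<longleftrightarrow> t \<le> ennpowr B (1 / q)"
proof
  assume "ennpowr t q \<le> B"
  then show "t \<le> ennpowr B (1 / q)"
    using ennpowr_mono[of "ennpowr t q" B "1 / q"] assms by (simp add: ennpowr_ennpowr)
next
  assume "t \<le> ennpowr B (1 / q)"
  then show "ennpowr t q \<le> B"
    using ennpowr_mono[of t "ennpowr B (1 / q)" q] assms by (simp add: ennpowr_ennpowr)
qed

lemma ennpowr_SUP: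
  assumes "0 < q"
  shows "ennpowr (SUP n. X n) q = (SUP n. ennpowr (X n) q)"
proof (rule antisym)
  show "ennpowr (SUP n. X n) q \<le> (SUP n. ennpowr (X n) q)"
    unfolding ennpowr_le_iff[OF assms]
    by (intro SUP_least) (auto simp: ennpowr_le_iff[OF assms, symmetric] intro: SUP_upper)
  show "(SUP n. ennpowr (X n) q) \<le> ennpowr (SUP n. X n) q"
    using assms by (intro SUP_least ennpowr_mono SUP_upper) auto
qed

lemma measurable_ennpowr [measurable]: "(\<lambda>t. ennpowr t q) \<in> borel_measurable borel"
  unfolding ennpowr_def by measurable

lemma ennpowr_le_below:
  assumes "t \<le> ennreal c" "0 < c" "q \<le> r"
  shows "ennpowr t r \<le> ennreal (c powr (r - q)) * ennpowr t q"
proof -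
  obtain x where x: "t = ennreal x" "0 \<le> x" "x \<le> c"
    using assms by (cases t) (auto simp: top_unique)
  have "x powr r = x powr (r - q) * x powr q" by (simp add: powr_add[symmetric])
  also have "\<dots> \<le> c powr (r - q) * x powr q"
    using x assms by (intro mult_right_mono powr_mono2) auto
  finally show ?thesis using x by (simp add: ennpowr_ennreal ennreal_mult[symmetric] ennreal_leI)
qed

lemma ennpowr_le_above:
  assumes "ennreal c \<le> t" "0 < c" "q \<le> r"
  shows "ennpowr t q \<le> ennreal (c powr (q - r)) * ennpowr t r"
proof (cases t)
  case (real x)
  have x: "c \<le> x" using assms real by simp
  have "x powr q = x powr (q - r) * x powr r" by (simp add: powr_add[symmetric])
  also have "\<dots> \<le> c powr (q - r) * x powr r"
    using x assms by (intro mult_right_mono powr_mono2') auto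
  finally show ?thesis using real by (simp add: ennpowr_ennreal ennreal_mult[symmetric] ennreal_leI)
qed (use assms in \<open>simp add: ennreal_mult_top\<close>)

text \<open>The first summand dominates where \<open>t \<le> c\<close>, the second one where \<open>t \<ge> c\<close>.\<close>

lemma ennpowr_interpolate:
  assumes "0 < c" "p \<le> q" "q \<le> r"
  shows "ennpowr t q \<le> ennreal (c powr (q - p)) * ennpowr t p + ennreal (c powr (q - r)) * ennpowr t r"
  using ennpowr_le_below[of t c p q] ennpowr_le_above[of c t q r] assms
  by (cases "t \<le> ennreal c") (auto intro: add_increasing add_increasing2)

lemma nn_integral_ennpowr_interpolate:
  assumes "0 < c" "p \<le> q" "q \<le> r" and [measurable]: "T \<in> borel_measurable M"
  shows "(\<integral>\<^sup>+z. ennpowr (T z) q \<partial>M)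
    \<le> ennreal (c powr (q - p)) * (\<integral>\<^sup>+z. ennpowr (T z) p \<partial>M)
      + ennreal (c powr (q - r)) * (\<integral>\<^sup>+z. ennpowr (T z) r \<partial>M)"
proof -
  have "(\<integral>\<^sup>+z. ennpowr (T z) q \<partial>M)
      \<le> (\<integral>\<^sup>+z. ennreal (c powr (q - p)) * ennpowr (T z) p + ennreal (c powr (q - r)) * ennpowr (T z) r \<partial>M)"
    by (intro nn_integral_mono ennpowr_interpolate assms)
  also have "\<dots> = ennreal (c powr (q - p)) * (\<integral>\<^sup>+z. ennpowr (T z) p \<partial>M)
      + ennreal (c powr (q - r)) * (\<integral>\<^sup>+z. ennpowr (T z) r \<partial>M)"
    by (subst nn_integral_add) (auto simp: nn_integral_cmult)
  finally show ?thesis .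
qed

section \<open>Laminar families of sets\<close>

text \<open>The dyadic cubes of one space, of any generations, form such a family. The generation \<open>gen\<close> is
  kept separate from the sets, since a set may occur in several generations.\<close>

definition laminar :: "'i set \<Rightarrow> ('i \<Rightarrow> int) \<Rightarrow> ('i \<Rightarrow> 'a set) \<Rightarrow> bool" where
  "laminar I gen Q \<longleftrightarrow>
     (\<forall>i\<in>I. \<forall>j\<in>I. gen i \<le> gen j \<longrightarrow> Q j \<subseteq> Q i \<or> Q j \<inter> Q i = {})"

lemma laminar_subset: "laminar I gen Q \<Longrightarrow> J \<subseteq> I \<Longrightarrow> laminar J gen Q"
  unfolding laminar_def by blast

text \<open>Going from coarse to fine generations, a new set is either contained in the union of the previous
  ones or disjoint from it; the union is therefore a disjoint union of members of the family, for
  each of which the estimate holds. With \<open>K\<close> the reciprocal of a density, this is the weak type (1,1)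
  estimate of the dyadic maximal function for indicator functions.\<close>

lemma emeasure_laminar_Union_le:
  fixes K :: ennreal
  assumes "finite I" "laminar I gen Q"
    and Q: "\<And>i. i \<in> I \<Longrightarrow> Q i \<in> sets M" and A: "A \<in> sets M"
    and K: "\<And>i. i \<in> I \<Longrightarrow> emeasure M (Q i) \<le> K * emeasure M (Q i \<inter> A)"
  shows "emeasure M (\<Union>i\<in>I. Q i) \<le> K * emeasure M ((\<Union>i\<in>I. Q i) \<inter> A)"
  using assms(1,2) Q K
proof (induction I rule: finite_ranking_induct[where f = gen])
  case empty
  then show ?case by simp
next
  case (insert i I)
  let ?U = "\<Union>j\<in>I. Q j"
  have U: "?U \<in> sets M" and Qi: "Q i \<in> sets M"
    using insert by auto
  have IH: "emeasure M ?U \<le> K * emeasure M (?U \<inter> A)"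
    using insert laminar_subset[OF insert.prems(1), of I] by auto
  show ?case
  proof (cases "Q i \<inter> ?U = {}")
    case True
    have "emeasure M (\<Union>j\<in>insert i I. Q j) = emeasure M (Q i) + emeasure M ?U"
      using plus_emeasure[OF Qi U True] by simp
    also have "\<dots> \<le> K * emeasure M (Q i \<inter> A) + K * emeasure M (?U \<inter> A)"
      using insert IH by (intro add_mono) auto
    also have "\<dots> = K * emeasure M ((Q i \<inter> A) \<union> (?U \<inter> A))"
      using plus_emeasure[of "Q i \<inter> A" M "?U \<inter> A"] True U Qi A
      by (subst distrib_left[symmetric]) (auto simp: disjoint_iff)
    also have "(Q i \<inter> A) \<union> (?U \<inter> A) = (\<Union>j\<in>insert i I. Q j) \<inter> A" by auto
    finally show ?thesis .
  next
    case False
    then obtain j where "j \<in> I" "Q i \<inter> Q j \<noteq> {}" by auto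
    then have "Q i \<subseteq> Q j"
      using insert.prems(1) insert.hyps(2)[of j] unfolding laminar_def by blast
    then have "(\<Union>j\<in>insert i I. Q j) = ?U" using \<open>j \<in> I\<close> by auto
    then show ?thesis using IH by simp
  qed
qed

lemma power_Suc_add_le:
  fixes x a :: ennreal
  shows "(x + a) ^ Suc m \<le> x ^ Suc m + of_nat (Suc m) * (a * (x + a) ^ m)"
proof (induction m)
  case 0
  then show ?case by simp
next
  case (Suc m)
  have "(x + a) ^ Suc (Suc m) = x * (x + a) ^ Suc m + a * (x + a) ^ Suc m"
    by (simp add: distrib_right)
  also have "\<dots> \<le> x * (x ^ Suc m + of_nat (Suc m) * (a * (x + a) ^ m)) + a * (x + a) ^ Suc m"
    using Suc by (intro add_mono mult_left_mono) auto
  also have "\<dots> = x ^ Suc (Suc m) + of_nat (Suc m) * (a * (x * (x + a) ^ m)) + a * (x + a) ^ Suc m"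
    by (simp add: algebra_simps)
  also have "\<dots> \<le> x ^ Suc (Suc m) + of_nat (Suc m) * (a * ((x + a) * (x + a) ^ m)) + a * (x + a) ^ Suc m"
    by (intro add_mono mult_left_mono mult_right_mono order_refl) auto
  also have "\<dots> = x ^ Suc (Suc m) + of_nat (Suc (Suc m)) * (a * (x + a) ^ Suc m)"
    by (simp add: algebra_simps)
  finally show ?case .
qed

text \<open>This replaces the duality argument with the maximal function by a telescoping sum. When the sets
  are added from coarse to fine, the increment of the \<open>Suc m\<close>-th power caused by the set \<open>Q i\<close> is at
  most \<open>Suc m\<close> times \<open>a i\<close> times the \<open>m\<close>-th power of the new sum, and the new sum is constant on \<open>Q i\<close>. So
  the integral of the increment only depends on the mass of \<open>Q i\<close>, which can be replaced by the mass
  of \<open>E i\<close>.\<close>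

lemma nn_integral_laminar_power_le:
  fixes K :: ennreal and a :: "'i \<Rightarrow> ennreal"
  assumes "finite I" "laminar I gen Q"
    and Q: "\<And>i. i \<in> I \<Longrightarrow> Q i \<in> sets M" and E: "\<And>i. i \<in> I \<Longrightarrow> E i \<in> sets M"
    and EQ: "\<And>i. i \<in> I \<Longrightarrow> E i \<subseteq> Q i"
    and K: "\<And>i. i \<in> I \<Longrightarrow> emeasure M (Q i) \<le> K * emeasure M (E i)"
  shows "(\<integral>\<^sup>+x. (\<Sum>i\<in>I. a i * indicator (Q i) x) ^ Suc m \<partial>M)
    \<le> of_nat (Suc m) * K *
       (\<integral>\<^sup>+x. (\<Sum>i\<in>I. a i * indicator (E i) x) * (\<Sum>i\<in>I. a i * indicator (Q i) x) ^ m \<partial>M)"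
  using assms(1,2) Q E EQ K
proof (induction I rule: finite_ranking_induct[where f = gen])
  case empty
  then show ?case by simp
next
  case (insert i I)
  show ?case
  proof (cases "i \<in> I")
    case True
    then show ?thesis
      using insert.IH insert.prems by (simp add: insert_absorb)
  next
    case False
    define F where "F x = (\<Sum>i\<in>I. a i * indicator (Q i) x)" for x
    define G where "G x = (\<Sum>i\<in>I. a i * indicator (E i) x)" for x
    define A where "A = a i + (\<Sum>j\<in>{j\<in>I. Q i \<subseteq> Q j}. a j)"
    let ?F = "\<lambda>x. F x + a i * indicator (Q i) x"
    have [measurable]: "F \<in> borel_measurable M" "G \<in> borel_measurable M" "Q i \<in> sets M" "E i \<in> sets M"
      using insert.prems unfolding F_def G_def by (auto intro!: borel_measurable_sum)
    have IH: "(\<integral>\<^sup>+x. F x ^ Suc m \<partial>M) \<le> of_nat (Suc m) * K * (\<integral>\<^sup>+x. G x * F x ^ m \<partial>M)"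
      using insert.IH insert.prems laminar_subset[OF insert.prems(1), of I] unfolding F_def G_def by auto
    \<comment> \<open>the sets already added are coarser, so each of them contains \<open>Q i\<close> or misses it\<close>
    have const: "?F x = A" if "x \<in> Q i" for x
    proof -
      have "F x = (\<Sum>j\<in>I. if Q i \<subseteq> Q j then a j else 0)"
        unfolding F_def
      proof (intro sum.cong refl)
        fix j assume "j \<in> I"
        then show "a j * indicator (Q j) x = (if Q i \<subseteq> Q j then a j else 0)"
          using insert.prems(1) insert.hyps(2)[of j] that unfolding laminar_def
          by (auto simp: indicator_def)
      qed
      also have "\<dots> = (\<Sum>j\<in>{j\<in>I. Q i \<subseteq> Q j}. a j)"
        using insert.hyps(1) by (simp add: sum.inter_filter)
      finally show ?thesis using that unfolding A_def by (simp add: add.commute)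
    qed
    have "(\<integral>\<^sup>+x. ?F x ^ Suc m \<partial>M)
        \<le> (\<integral>\<^sup>+x. F x ^ Suc m + of_nat (Suc m) * (a i * A ^ m * indicator (Q i) x) \<partial>M)"
    proof (intro nn_integral_mono)
      fix x
      have "?F x ^ Suc m \<le> F x ^ Suc m + of_nat (Suc m) * (a i * indicator (Q i) x * ?F x ^ m)"
        by (rule power_Suc_add_le)
      also have "a i * indicator (Q i) x * ?F x ^ m = a i * A ^ m * indicator (Q i) x"
        using const[of x] by (cases "x \<in> Q i") auto
      finally show "?F x ^ Suc m \<le> F x ^ Suc m + of_nat (Suc m) * (a i * A ^ m * indicator (Q i) x)" .
    qed
    also have "\<dots> = (\<integral>\<^sup>+x. F x ^ Suc m \<partial>M) + of_nat (Suc m) * (a i * A ^ m * emeasure M (Q i))"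
      by (subst nn_integral_add) (auto simp: nn_integral_cmult mult.assoc)
    also have "\<dots> \<le> of_nat (Suc m) * K * (\<integral>\<^sup>+x. G x * F x ^ m \<partial>M)
        + of_nat (Suc m) * (a i * A ^ m * (K * emeasure M (E i)))"
      using insert.prems by (intro add_mono IH mult_left_mono) auto
    also have "\<dots> = of_nat (Suc m) * K * ((\<integral>\<^sup>+x. G x * F x ^ m \<partial>M) + a i * A ^ m * emeasure M (E i))"
      by (simp add: algebra_simps)
    also have "a i * A ^ m * emeasure M (E i) = (\<integral>\<^sup>+x. a i * indicator (E i) x * ?F x ^ m \<partial>M)"
    proof -
      have "a i * A ^ m * emeasure M (E i) = (\<integral>\<^sup>+x. a i * A ^ m * indicator (E i) x \<partial>M)"
        by (simp add: nn_integral_cmult)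
      also have "\<dots> = (\<integral>\<^sup>+x. a i * indicator (E i) x * ?F x ^ m \<partial>M)"
      proof (intro nn_integral_cong)
        fix x
        show "a i * A ^ m * indicator (E i) x = a i * indicator (E i) x * ?F x ^ m"
        proof (cases "x \<in> E i")
          case True
          then have "?F x = A" using insert.prems(4)[of i] const[of x] by auto
          then show ?thesis by (simp only:) (simp add: ac_simps)
        qed simp
      qed
      finally show ?thesis .
    qed
    also have "(\<integral>\<^sup>+x. G x * F x ^ m \<partial>M) + (\<integral>\<^sup>+x. a i * indicator (E i) x * ?F x ^ m \<partial>M)
        = (\<integral>\<^sup>+x. G x * F x ^ m + a i * indicator (E i) x * ?F x ^ m \<partial>M)"
      by (subst nn_integral_add) auto
    also have "of_nat (Suc m) * K * \<dots> \<le> of_nat (Suc m) * K *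
        (\<integral>\<^sup>+x. (G x + a i * indicator (E i) x) * ?F x ^ m \<partial>M)"
      unfolding distrib_right
      by (intro mult_left_mono nn_integral_mono add_mono power_mono order_refl) auto
    finally have "(\<integral>\<^sup>+x. ?F x ^ Suc m \<partial>M) \<le> of_nat (Suc m) * K *
        (\<integral>\<^sup>+x. (G x + a i * indicator (E i) x) * ?F x ^ m \<partial>M)" .
    then show ?thesis
      unfolding F_def G_def sum.insert[OF insert.hyps(1) False] by (simp only: add.commute)
  qed
qed

text \<open>With \<open>F\<close> and \<open>G\<close> the sums over the \<open>Q i\<close> and the \<open>E i\<close>, and \<open>L\<close> the base of the constant, the preceding
  lemma bounds twice the integral of \<open>F ^ Suc m\<close> by the integral of \<open>L * G * F ^ m\<close>, which is at most
  \<open>F ^ Suc m + (L * G) ^ Suc m\<close>. One copy of the integral of \<open>F ^ Suc m\<close> is absorbed; this is where the finiteness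
  assumptions enter.\<close>

lemma nn_integral_laminar_sum_power_le:
  fixes K :: ennreal and a :: "'i \<Rightarrow> ennreal"
  assumes I: "finite I" "laminar I gen Q"
    and Q: "\<And>i. i \<in> I \<Longrightarrow> Q i \<in> sets M" and E: "\<And>i. i \<in> I \<Longrightarrow> E i \<in> sets M"
    and EQ: "\<And>i. i \<in> I \<Longrightarrow> E i \<subseteq> Q i"
    and K: "\<And>i. i \<in> I \<Longrightarrow> emeasure M (Q i) \<le> K * emeasure M (E i)"
    and a: "\<And>i. i \<in> I \<Longrightarrow> a i < \<infinity>" and fin: "\<And>i. i \<in> I \<Longrightarrow> emeasure M (Q i) < \<infinity>"
  shows "(\<integral>\<^sup>+x. (\<Sum>i\<in>I. a i * indicator (Q i) x) ^ Suc m \<partial>M)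
    \<le> (2 * of_nat (Suc m) * K) ^ Suc m * (\<integral>\<^sup>+x. (\<Sum>i\<in>I. a i * indicator (E i) x) ^ Suc m \<partial>M)"
proof -
  define F where "F x = (\<Sum>i\<in>I. a i * indicator (Q i) x)" for x
  define G where "G x = (\<Sum>i\<in>I. a i * indicator (E i) x)" for x
  define L where "L = 2 * of_nat (Suc m) * K"
  have [measurable]: "F \<in> borel_measurable M" "G \<in> borel_measurable M"
    using Q E unfolding F_def G_def by (auto intro!: borel_measurable_sum)
  let ?X = "\<integral>\<^sup>+x. F x ^ Suc m \<partial>M"
  have U: "(\<Union>i\<in>I. Q i) \<in> sets M" using I Q by auto
  have "?X \<le> (\<integral>\<^sup>+x. (\<Sum>i\<in>I. a i) ^ Suc m * indicator (\<Union>i\<in>I. Q i) x \<partial>M)"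
  proof (intro nn_integral_mono)
    fix x
    show "F x ^ Suc m \<le> (\<Sum>i\<in>I. a i) ^ Suc m * indicator (\<Union>i\<in>I. Q i) x"
    proof (cases "x \<in> (\<Union>i\<in>I. Q i)")
      case True
      have "F x \<le> (\<Sum>i\<in>I. a i)" unfolding F_def
        by (intro sum_mono) (auto simp: indicator_def)
      then have "F x ^ Suc m \<le> (\<Sum>i\<in>I. a i) ^ Suc m" by (intro power_mono) auto
      then show ?thesis using True by auto
    next
      case False
      then have "F x = 0" unfolding F_def by auto
      then show ?thesis by simp
    qed
  qed
  also have "\<dots> = (\<Sum>i\<in>I. a i) ^ Suc m * emeasure M (\<Union>i\<in>I. Q i)"
    using U by (simp add: nn_integral_cmult_indicator)
  also have "\<dots> < \<infinity>"
  proof -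
    have "(\<Sum>i\<in>I. a i) < \<infinity>" using I a by (simp add: less_top[symmetric])
    then have "(\<Sum>i\<in>I. a i) ^ Suc m < \<infinity>"
      using power_less_top_ennreal[of "\<Sum>i\<in>I. a i" "Suc m"] by simp
    moreover have "emeasure M (\<Union>i\<in>I. Q i) \<le> (\<Sum>i\<in>I. emeasure M (Q i))"
      using I Q by (intro emeasure_subadditive_finite) auto
    moreover have "(\<Sum>i\<in>I. emeasure M (Q i)) < \<infinity>" using I fin by (simp add: less_top[symmetric])
    ultimately show ?thesis
      by (auto simp: ennreal_mult_less_top simp del: power_Suc)
  qed
  finally have X: "?X < \<infinity>" .
  have "?X + ?X = 2 * ?X" by (simp add: mult_2)
  also have "\<dots> \<le> 2 * (of_nat (Suc m) * K * (\<integral>\<^sup>+x. G x * F x ^ m \<partial>M))"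
    using nn_integral_laminar_power_le[OF I Q E EQ K, where a = a and m = m] unfolding F_def G_def
    by (intro mult_left_mono) auto
  also have "\<dots> = (\<integral>\<^sup>+x. L * G x * F x ^ m \<partial>M)"
    unfolding L_def by (simp add: nn_integral_cmult mult.assoc del: of_nat_Suc)
  also have "\<dots> \<le> (\<integral>\<^sup>+x. F x ^ Suc m + (L * G x) ^ Suc m \<partial>M)"
  proof (intro nn_integral_mono)
    fix x
    let ?u = "L * G x"
    have "?u * F x ^ m \<le> max ?u (F x) ^ Suc m"
      unfolding power_Suc by (intro mult_mono power_mono) auto
    also have "\<dots> \<le> F x ^ Suc m + ?u ^ Suc m" by (auto simp: max_def)
    finally show "?u * F x ^ m \<le> F x ^ Suc m + ?u ^ Suc m" .
  qed
  also have "\<dots> = ?X + L ^ Suc m * (\<integral>\<^sup>+x. G x ^ Suc m \<partial>M)"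
    unfolding power_mult_distrib by (subst nn_integral_add) (auto simp: nn_integral_cmult simp del: power_Suc)
  finally have "?X \<le> L ^ Suc m * (\<integral>\<^sup>+x. G x ^ Suc m \<partial>M)"
    using X by (auto simp: ennreal_add_left_cancel_le simp del: power_Suc)
  then show ?thesis unfolding F_def G_def L_def .
qed

section \<open>Families of rectangles that meet a set in a large proportion\<close>

context pair_sigma_finite
begin

text \<open>The points \<open>y\<close> for which \<open>E\<close> fills a quarter of \<open>Q\<close> in the fibre over \<open>y\<close>.\<close>

definition dense_fibres :: "('a \<times> 'b) set \<Rightarrow> 'a set \<Rightarrow> 'b set" where
  "dense_fibres E Q = {y \<in> space M2. emeasure M1 Q \<le> 4 * emeasure M1 (Q \<inter> (\<lambda>x. (x, y)) -` E)}"

lemma measurable_fibre: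
  assumes "E \<in> sets (M1 \<Otimes>\<^sub>M M2)" "Q \<in> sets M1"
  shows "Q \<inter> (\<lambda>x. (x, y)) -` E \<in> sets M1"
  using assms by (intro sets.Int sets_Pair2)

lemma measurable_emeasure_fibre:
  assumes E: "E \<in> sets (M1 \<Otimes>\<^sub>M M2)" and Q: "Q \<in> sets M1"
  shows "(\<lambda>y. emeasure M1 (Q \<inter> (\<lambda>x. (x, y)) -` E)) \<in> borel_measurable M2"
proof -
  have "(Q \<times> space M2) \<inter> E \<in> sets (M1 \<Otimes>\<^sub>M M2)" using E Q by auto
  from measurable_emeasure_Pair2[OF this]
  show ?thesis by (rule measurable_cong[THEN iffD1, rotated]) (auto intro!: arg_cong[where f = "emeasure M1"])
qed

lemma sets_dense_fibres:
  assumes "E \<in> sets (M1 \<Otimes>\<^sub>M M2)" "Q \<in> sets M1"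
  shows "dense_fibres E Q \<in> sets M2"
  unfolding dense_fibres_def using measurable_emeasure_fibre[OF assms] by measurable

text \<open>If \<open>E\<close> fills half of a rectangle, then the fibres in which it fills a quarter of the first side
  make up a quarter of the second side: the other fibres contribute at most a quarter of the
  rectangle.\<close>

lemma emeasure_dense_fibres:
  assumes E: "E \<in> sets (M1 \<Otimes>\<^sub>M M2)" and Q1: "Q1 \<in> sets M1" and Q2: "Q2 \<in> sets M2"
    and pos: "0 < emeasure M1 Q1" and fin: "emeasure M1 Q1 < \<infinity>" "emeasure M2 Q2 < \<infinity>"
    and dense: "emeasure (M1 \<Otimes>\<^sub>M M2) (Q1 \<times> Q2) \<le> 2 * emeasure (M1 \<Otimes>\<^sub>M M2) (Q1 \<times> Q2 \<inter> E)"
  shows "emeasure M2 Q2 \<le> 4 * emeasure M2 (Q2 \<inter> dense_fibres E Q1)"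
proof -
  let ?m = "emeasure M1 Q1" and ?n = "emeasure M2 Q2"
  let ?D = "dense_fibres E Q1" and ?f = "\<lambda>y. emeasure M1 (Q1 \<inter> (\<lambda>x. (x, y)) -` E)"
  note [measurable] = sets_dense_fibres[OF E Q1] Q2 measurable_emeasure_fibre[OF E Q1]
  have RE: "Q1 \<times> Q2 \<inter> E \<in> sets (M1 \<Otimes>\<^sub>M M2)" using E Q1 Q2 by auto
  have "emeasure (M1 \<Otimes>\<^sub>M M2) (Q1 \<times> Q2 \<inter> E) = (\<integral>\<^sup>+y. ?f y * indicator Q2 y \<partial>M2)"
    unfolding emeasure_pair_measure_alt2[OF RE]
    by (intro nn_integral_cong) (auto simp: indicator_def intro!: arg_cong[where f = "emeasure M1"])
  then have "2 * emeasure (M1 \<Otimes>\<^sub>M M2) (Q1 \<times> Q2)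
      \<le> 2 * (2 * (\<integral>\<^sup>+y. ?f y * indicator Q2 y \<partial>M2))"
    using dense by (intro mult_left_mono) auto
  also have "\<dots> = (\<integral>\<^sup>+y. 4 * ?f y * indicator Q2 y \<partial>M2)"
    by (simp add: nn_integral_cmult mult.assoc[symmetric])
       (simp add: nn_integral_cmult mult.assoc)
  also have "\<dots> \<le> (\<integral>\<^sup>+y. 4 * ?m * indicator (Q2 \<inter> ?D) y + ?m * indicator Q2 y \<partial>M2)"
  proof (intro nn_integral_mono)
    fix y assume "y \<in> space M2"
    have "?f y \<le> ?m" using Q1 by (intro emeasure_mono) auto
    moreover have "4 * ?f y \<le> ?m" if "y \<notin> ?D"
      using that \<open>y \<in> space M2\<close> unfolding dense_fibres_def by auto
    ultimately show "4 * ?f y * indicator Q2 y \<le> 4 * ?m * indicator (Q2 \<inter> ?D) y + ?m * indicator Q2 y"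
      by (auto simp: indicator_def intro!: add_increasing2 mult_left_mono)
  qed
  also have "\<dots> = 4 * ?m * emeasure M2 (Q2 \<inter> ?D) + ?m * ?n"
    by (subst nn_integral_add) (auto simp: nn_integral_cmult_indicator)
  also have "4 * ?m * emeasure M2 (Q2 \<inter> ?D) = ?m * (4 * emeasure M2 (Q2 \<inter> ?D))"
    by (simp add: mult_ac)
  finally have "?m * ?n + ?m * ?n \<le> ?m * ?n + ?m * (4 * emeasure M2 (Q2 \<inter> ?D))"
    using Q1 Q2 by (simp add: M2.emeasure_pair_measure_Times mult_2 add.commute)
  moreover have "?m * ?n \<noteq> \<infinity>" using fin ennreal_mult_less_top[of ?m ?n] by auto
  ultimately have "?m * ?n \<le> ?m * (4 * emeasure M2 (Q2 \<inter> ?D))"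
    unfolding ennreal_add_left_cancel_le by blast
  then show ?thesis
    using pos fin by (simp add: ennreal_mult_le_mult_iff)
qed

text \<open>The one-parameter estimate is applied twice. For fixed \<open>x\<close> the second sides \<open>Q2 i\<close> are shrunk to
  the parts \<open>Q2 i \<inter> D i\<close> over which the fibres of \<open>E\<close> are dense. For fixed \<open>y\<close> only rectangles with \<open>y \<in> D i\<close>
  are left, and their first sides can be shrunk to the fibre of \<open>E\<close> over \<open>y\<close>. What remains of the sum is
  supported in \<open>E\<close>.\<close>

lemma nn_integral_dense_rectangles_le:
  fixes a :: "'i \<Rightarrow> ennreal"
  assumes J: "finite J" "laminar J gen1 Q1" "laminar J gen2 Q2"
    and Q1: "\<And>i. i \<in> J \<Longrightarrow> Q1 i \<in> sets M1" and Q2: "\<And>i. i \<in> J \<Longrightarrow> Q2 i \<in> sets M2"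
    and pos1: "\<And>i. i \<in> J \<Longrightarrow> 0 < emeasure M1 (Q1 i)"
    and fin1: "\<And>i. i \<in> J \<Longrightarrow> emeasure M1 (Q1 i) < \<infinity>"
    and fin2: "\<And>i. i \<in> J \<Longrightarrow> emeasure M2 (Q2 i) < \<infinity>"
    and a: "\<And>i. i \<in> J \<Longrightarrow> a i < \<infinity>"
    and E: "E \<in> sets (M1 \<Otimes>\<^sub>M M2)"
    and dense: "\<And>i. i \<in> J \<Longrightarrow> emeasure (M1 \<Otimes>\<^sub>M M2) (Q1 i \<times> Q2 i)
                   \<le> 2 * emeasure (M1 \<Otimes>\<^sub>M M2) (Q1 i \<times> Q2 i \<inter> E)"
  shows "(\<integral>\<^sup>+z. (\<Sum>i\<in>J. a i * indicator (Q1 i \<times> Q2 i) z) ^ Suc m \<partial>(M1 \<Otimes>\<^sub>M M2))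
    \<le> ((2 * of_nat (Suc m) * 4) ^ Suc m) ^ 2 *
       (\<integral>\<^sup>+z. (\<Sum>i\<in>J. a i * indicator (Q1 i \<times> Q2 i) z) ^ Suc m * indicator E z \<partial>(M1 \<Otimes>\<^sub>M M2))"
proof -
  let ?C = "(2 * of_nat (Suc m) * 4) ^ Suc m :: ennreal"
  define D where "D i = dense_fibres E (Q1 i)" for i
  define F where "F z = (\<Sum>i\<in>J. a i * indicator (Q1 i \<times> Q2 i) z)" for z
  define H where "H z = (\<Sum>i\<in>J. a i * indicator (Q1 i \<times> (Q2 i \<inter> D i)) z)" for z
  have D: "D i \<in> sets M2" if "i \<in> J" for i
    unfolding D_def by (intro sets_dense_fibres E Q1 that)
  have [measurable]: "F \<in> borel_measurable (M1 \<Otimes>\<^sub>M M2)" "H \<in> borel_measurable (M1 \<Otimes>\<^sub>M M2)"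
      "E \<in> sets (M1 \<Otimes>\<^sub>M M2)"
    using Q1 Q2 D E unfolding F_def H_def by (auto intro!: borel_measurable_sum)
  have "(\<integral>\<^sup>+z. F z ^ Suc m \<partial>(M1 \<Otimes>\<^sub>M M2)) = (\<integral>\<^sup>+x. \<integral>\<^sup>+y. F (x, y) ^ Suc m \<partial>M2 \<partial>M1)"
    by (rule M2.nn_integral_fst[symmetric]) (measurable)
  also have "\<dots> \<le> (\<integral>\<^sup>+x. ?C * (\<integral>\<^sup>+y. H (x, y) ^ Suc m \<partial>M2) \<partial>M1)"
  proof (intro nn_integral_mono)
    fix x
    have "(\<integral>\<^sup>+y. (\<Sum>i\<in>J. (a i * indicator (Q1 i) x) * indicator (Q2 i) y) ^ Suc m \<partial>M2)
      \<le> ?C * (\<integral>\<^sup>+y. (\<Sum>i\<in>J. (a i * indicator (Q1 i) x) * indicator (Q2 i \<inter> D i) y) ^ Suc m \<partial>M2)"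
    proof (rule nn_integral_laminar_sum_power_le[OF J(1,3)])
      fix i assume i: "i \<in> J"
      show "emeasure M2 (Q2 i) \<le> 4 * emeasure M2 (Q2 i \<inter> D i)"
        unfolding D_def using i by (intro emeasure_dense_fibres E Q1 Q2 pos1 fin1 fin2 dense)
      show "a i * indicator (Q1 i) x < \<infinity>" using a[OF i] by (auto simp: indicator_def)
    qed (use Q2 D fin2 in auto)
    then show "(\<integral>\<^sup>+y. F (x, y) ^ Suc m \<partial>M2) \<le> ?C * (\<integral>\<^sup>+y. H (x, y) ^ Suc m \<partial>M2)"
      unfolding F_def H_def by (simp only: indicator_times fst_conv snd_conv mult.assoc)
  qed
  also have "\<dots> = ?C * (\<integral>\<^sup>+x. \<integral>\<^sup>+y. H (x, y) ^ Suc m \<partial>M2 \<partial>M1)"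
    by (rule nn_integral_cmult) measurable
  finally have 1: "(\<integral>\<^sup>+z. F z ^ Suc m \<partial>(M1 \<Otimes>\<^sub>M M2)) \<le> \<dots>" .
  have "(\<integral>\<^sup>+x. \<integral>\<^sup>+y. H (x, y) ^ Suc m \<partial>M2 \<partial>M1) = (\<integral>\<^sup>+y. \<integral>\<^sup>+x. H (x, y) ^ Suc m \<partial>M1 \<partial>M2)"
    using Fubini'[of "\<lambda>x y. H (x, y) ^ Suc m"] by simp
  also have "\<dots> \<le> (\<integral>\<^sup>+y. ?C * (\<integral>\<^sup>+x. F (x, y) ^ Suc m * indicator E (x, y) \<partial>M1) \<partial>M2)"
  proof (intro nn_integral_mono)
    fix y assume y: "y \<in> space M2"
    \<comment> \<open>rectangles with \<open>y \<notin> D i\<close> do not contribute to \<open>H (x, y)\<close>, and the others have dense fibres\<close>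
    let ?J = "{i \<in> J. y \<in> D i}" and ?b = "\<lambda>i. a i * indicator (Q2 i) y"
      and ?E = "\<lambda>i. Q1 i \<inter> (\<lambda>x. (x, y)) -` E"
    have "(\<integral>\<^sup>+x. H (x, y) ^ Suc m \<partial>M1)
        = (\<integral>\<^sup>+x. (\<Sum>i\<in>?J. ?b i * indicator (Q1 i) x) ^ Suc m \<partial>M1)"
      unfolding H_def
      by (intro nn_integral_cong arg_cong[where f = "\<lambda>t. t ^ Suc m"] sum.mono_neutral_cong_right J)
         (auto simp: indicator_def)
    also have "\<dots> \<le> ?C * (\<integral>\<^sup>+x. (\<Sum>i\<in>?J. ?b i * indicator (?E i) x) ^ Suc m \<partial>M1)"
    proof (rule nn_integral_laminar_sum_power_le)
      show "laminar ?J gen1 Q1" using J(2) by (rule laminar_subset) auto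
      fix i assume i: "i \<in> ?J"
      show "?E i \<in> sets M1" using i y by (auto intro: measurable_fibre E Q1)
      show "emeasure M1 (Q1 i) \<le> 4 * emeasure M1 (?E i)"
        using i unfolding D_def dense_fibres_def by auto
      show "?b i < \<infinity>" using i a[of i] by (auto simp: indicator_def)
    qed (use J Q1 fin1 in auto)
    also have "\<dots> \<le> ?C * (\<integral>\<^sup>+x. F (x, y) ^ Suc m * indicator E (x, y) \<partial>M1)"
    proof (intro mult_left_mono nn_integral_mono)
      fix x
      show "(\<Sum>i\<in>?J. ?b i * indicator (?E i) x) ^ Suc m \<le> F (x, y) ^ Suc m * indicator E (x, y)"
      proof (cases "(x, y) \<in> E")
        case True
        have "(\<Sum>i\<in>?J. ?b i * indicator (?E i) x) \<le> (\<Sum>i\<in>J. ?b i * indicator (?E i) x)"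
          using J(1) by (intro sum_mono2) auto
        also have "\<dots> \<le> F (x, y)"
          unfolding F_def by (intro sum_mono) (auto simp: indicator_def)
        finally show ?thesis using True by (simp add: power_mono del: power_Suc)
      qed (simp add: indicator_def)
    qed simp
    finally show "(\<integral>\<^sup>+x. H (x, y) ^ Suc m \<partial>M1)
        \<le> ?C * (\<integral>\<^sup>+x. F (x, y) ^ Suc m * indicator E (x, y) \<partial>M1)" .
  qed
  also have "\<dots> = ?C * (\<integral>\<^sup>+y. \<integral>\<^sup>+x. F (x, y) ^ Suc m * indicator E (x, y) \<partial>M1 \<partial>M2)"
    by (rule nn_integral_cmult) measurable
  also have "(\<integral>\<^sup>+y. \<integral>\<^sup>+x. F (x, y) ^ Suc m * indicator E (x, y) \<partial>M1 \<partial>M2)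
      = (\<integral>\<^sup>+z. F z ^ Suc m * indicator E z \<partial>(M1 \<Otimes>\<^sub>M M2))"
    by (rule nn_integral_snd) measurable
  finally have "(\<integral>\<^sup>+x. \<integral>\<^sup>+y. H (x, y) ^ Suc m \<partial>M2 \<partial>M1) \<le> ?C * \<dots>" .
  then have "?C * (\<integral>\<^sup>+x. \<integral>\<^sup>+y. H (x, y) ^ Suc m \<partial>M2 \<partial>M1)
      \<le> ?C * (?C * (\<integral>\<^sup>+z. F z ^ Suc m * indicator E z \<partial>(M1 \<Otimes>\<^sub>M M2)))"
    by (rule mult_left_mono) simp
  with 1 show ?thesis
    unfolding F_def by (simp only: power2_eq_square mult.assoc)
qed

text \<open>The same two steps for measures of unions. In the intermediate set \<open>V\<close> every rectangle keeps its first side,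
  while its second side is shrunk to the part over which the fibres of \<open>E\<close> are dense. Then \<open>V\<close> is compared
  with \<open>E\<close> in the first variable and the union of rectangles with \<open>V\<close> in the second one, each time at
  the cost of a factor 4.\<close>

lemma emeasure_dense_rectangles_Union_le:
  assumes J: "finite J" "laminar J gen1 Q1" "laminar J gen2 Q2"
    and Q1: "\<And>i. i \<in> J \<Longrightarrow> Q1 i \<in> sets M1" and Q2: "\<And>i. i \<in> J \<Longrightarrow> Q2 i \<in> sets M2"
    and pos1: "\<And>i. i \<in> J \<Longrightarrow> 0 < emeasure M1 (Q1 i)"
    and fin1: "\<And>i. i \<in> J \<Longrightarrow> emeasure M1 (Q1 i) < \<infinity>"
    and fin2: "\<And>i. i \<in> J \<Longrightarrow> emeasure M2 (Q2 i) < \<infinity>"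
    and E: "E \<in> sets (M1 \<Otimes>\<^sub>M M2)"
    and dense: "\<And>i. i \<in> J \<Longrightarrow> emeasure (M1 \<Otimes>\<^sub>M M2) (Q1 i \<times> Q2 i)
                   \<le> 2 * emeasure (M1 \<Otimes>\<^sub>M M2) (Q1 i \<times> Q2 i \<inter> E)"
  shows "emeasure (M1 \<Otimes>\<^sub>M M2) (\<Union>i\<in>J. Q1 i \<times> Q2 i) \<le> 16 * emeasure (M1 \<Otimes>\<^sub>M M2) E"
proof -
  define D where "D i = dense_fibres E (Q1 i)" for i
  define V where "V = (\<Union>i\<in>J. Q1 i \<times> D i)"
  let ?U = "\<Union>i\<in>J. Q1 i \<times> Q2 i"
  have D: "D i \<in> sets M2" if "i \<in> J" for i
    unfolding D_def by (intro sets_dense_fibres E Q1 that)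
  have V: "V \<in> sets (M1 \<Otimes>\<^sub>M M2)" and U: "?U \<in> sets (M1 \<Otimes>\<^sub>M M2)"
    using J Q1 Q2 D unfolding V_def by auto
  have "emeasure (M1 \<Otimes>\<^sub>M M2) V \<le> (\<integral>\<^sup>+y. 4 * emeasure M1 ((\<lambda>x. (x, y)) -` E) \<partial>M2)"
    unfolding emeasure_pair_measure_alt2[OF V]
  proof (intro nn_integral_mono)
    fix y assume y: "y \<in> space M2"
    let ?J = "{i \<in> J. y \<in> D i}" and ?A = "space M1 \<inter> (\<lambda>x. (x, y)) -` E"
    have A: "?A \<in> sets M1" by (rule measurable_fibre[OF E]) auto
    have V_fibre: "(\<lambda>x. (x, y)) -` V = (\<Union>i\<in>?J. Q1 i)" unfolding V_def by auto
    have "emeasure M1 (\<Union>i\<in>?J. Q1 i) \<le> 4 * emeasure M1 ((\<Union>i\<in>?J. Q1 i) \<inter> ?A)"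
    proof (rule emeasure_laminar_Union_le)
      show "laminar ?J gen1 Q1" using J(2) by (rule laminar_subset) auto
      fix i assume i: "i \<in> ?J"
      have "Q1 i \<inter> (\<lambda>x. (x, y)) -` E = Q1 i \<inter> ?A" using Q1 i sets.sets_into_space by blast
      then show "emeasure M1 (Q1 i) \<le> 4 * emeasure M1 (Q1 i \<inter> ?A)"
        using i unfolding D_def dense_fibres_def by auto
    qed (use J Q1 A in auto)
    also have "\<dots> \<le> 4 * emeasure M1 ((\<lambda>x. (x, y)) -` E)"
      by (intro mult_left_mono emeasure_mono sets_Pair2[OF E]) auto
    finally show "emeasure M1 ((\<lambda>x. (x, y)) -` V) \<le> 4 * emeasure M1 ((\<lambda>x. (x, y)) -` E)"
      unfolding V_fibre .
  qed
  also have "\<dots> = 4 * emeasure (M1 \<Otimes>\<^sub>M M2) E"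
    unfolding emeasure_pair_measure_alt2[OF E]
    by (rule nn_integral_cmult) (rule measurable_emeasure_Pair2[OF E])
  finally have *: "emeasure (M1 \<Otimes>\<^sub>M M2) V \<le> 4 * emeasure (M1 \<Otimes>\<^sub>M M2) E" .
  have "emeasure (M1 \<Otimes>\<^sub>M M2) ?U \<le> (\<integral>\<^sup>+x. 4 * emeasure M2 (Pair x -` V) \<partial>M1)"
    unfolding M2.emeasure_pair_measure_alt[OF U]
  proof (intro nn_integral_mono)
    fix x
    let ?J = "{i \<in> J. x \<in> Q1 i}" and ?A = "Pair x -` V"
    have A: "?A \<in> sets M2" by (rule sets_Pair1[OF V])
    have U_fibre: "Pair x -` ?U = (\<Union>i\<in>?J. Q2 i)" by auto
    have "emeasure M2 (\<Union>i\<in>?J. Q2 i) \<le> 4 * emeasure M2 ((\<Union>i\<in>?J. Q2 i) \<inter> ?A)"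
    proof (rule emeasure_laminar_Union_le)
      show "laminar ?J gen2 Q2" using J(3) by (rule laminar_subset) auto
      fix i assume i: "i \<in> ?J"
      have "emeasure M2 (Q2 i) \<le> 4 * emeasure M2 (Q2 i \<inter> D i)"
        unfolding D_def using i by (intro emeasure_dense_fibres E Q1 Q2 pos1 fin1 fin2 dense) auto
      also have "\<dots> \<le> 4 * emeasure M2 (Q2 i \<inter> ?A)"
        using i A Q2 unfolding V_def by (intro mult_left_mono emeasure_mono) auto
      finally show "emeasure M2 (Q2 i) \<le> 4 * emeasure M2 (Q2 i \<inter> ?A)" .
    qed (use J Q2 A in auto)
    also have "\<dots> \<le> 4 * emeasure M2 ?A"
      using A by (intro mult_left_mono emeasure_mono) auto
    finally show "emeasure M2 (Pair x -` ?U) \<le> 4 * emeasure M2 ?A"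
      unfolding U_fibre .
  qed
  also have "\<dots> = 4 * emeasure (M1 \<Otimes>\<^sub>M M2) V"
    unfolding M2.emeasure_pair_measure_alt[OF V]
    by (rule nn_integral_cmult) (rule M2.measurable_emeasure_Pair[OF V])
  also have "\<dots> \<le> 4 * (4 * emeasure (M1 \<Otimes>\<^sub>M M2) E)" by (intro mult_left_mono *) auto
  finally show ?thesis by (simp add: mult.assoc[symmetric])
qed

end

section \<open>Splitting a square function at a level\<close>

text \<open>Reduces integrals of sums over countable families to integrals of finite sums by monotone
  convergence.\<close>

lemma countable_exhaustion:
  assumes "countable A"
  obtains J :: "nat \<Rightarrow> 'i set" where "incseq J" "\<And>n. finite (J n)" "\<And>n. J n \<subseteq> A"
    "\<And>f :: 'i \<Rightarrow> ennreal. infsum f A = (SUP n. sum f (J n))"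
proof
  let ?J = "\<lambda>n. {i \<in> A. to_nat_on A i < n}"
  show "incseq ?J" by (auto simp: incseq_def)
  show fin: "finite (?J n)" for n
  proof (rule inj_on_finite[where B = "{..<n}"])
    show "inj_on (to_nat_on A) (?J n)"
      using inj_on_to_nat_on[OF assms] by (rule inj_on_subset) auto
  qed auto
  show "?J n \<subseteq> A" for n by auto
  fix f :: "'i \<Rightarrow> ennreal"
  have "infsum f A = (SUP F\<in>{F. finite F \<and> F \<subseteq> A}. sum f F)"
    by (rule nonneg_infsum_complete) simp
  also have "\<dots> = (SUP n. sum f (?J n))"
  proof (rule SUP_eq)
    fix F assume "F \<in> {F. finite F \<and> F \<subseteq> A}"
    then have F: "finite F" "F \<subseteq> A" by auto
    let ?n = "Suc (Max (insert 0 (to_nat_on A ` F)))"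
    have "F \<subseteq> ?J ?n" using F by (auto simp: less_Suc_eq_le intro!: Max_ge)
    then show "\<exists>n\<in>UNIV. sum f F \<le> sum f (?J n)"
      by (intro bexI[of _ ?n] sum_mono2 fin) auto
  next
    fix n show "\<exists>F\<in>{F. finite F \<and> F \<subseteq> A}. sum f (?J n) \<le> sum f F"
      using fin[of n] by (intro bexI[of _ "?J n"]) auto
  qed
  finally show "infsum f A = (SUP n. sum f (?J n))" .
qed

lemma ennreal_infsum_mono_set:
  fixes f :: "'i \<Rightarrow> ennreal"
  assumes "A \<subseteq> B"
  shows "infsum f A \<le> infsum f B"
  using assms by (subst (1 2) nonneg_infsum_complete) (auto intro!: SUP_subset_mono)

lemma sum_le_ennreal_infsum:
  fixes f :: "'i \<Rightarrow> ennreal"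
  assumes "finite F" "F \<subseteq> A"
  shows "sum f F \<le> infsum f A"
  using assms by (subst nonneg_infsum_complete) (auto intro!: SUP_upper)

lemma borel_measurable_infsum_ennreal:
  fixes f :: "'i \<Rightarrow> 'a \<Rightarrow> ennreal"
  assumes "countable A" "\<And>i. i \<in> A \<Longrightarrow> f i \<in> borel_measurable M"
  shows "(\<lambda>z. \<Sum>\<^sub>\<infinity>i\<in>A. f i z) \<in> borel_measurable M"
proof -
  obtain J :: "nat \<Rightarrow> 'i set" where J: "incseq J" "\<And>n. finite (J n)" "\<And>n. J n \<subseteq> A"
    "\<And>f :: 'i \<Rightarrow> ennreal. infsum f A = (SUP n. sum f (J n))"
    by (rule countable_exhaustion[OF assms(1)]) (rule that)
  show ?thesis unfolding J(4)
    using J(3) assms(2) by (intro borel_measurable_SUP borel_measurable_sum) blast+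
qed

lemma nn_integral_ennpowr_infsum_le:
  fixes f :: "'i \<Rightarrow> 'a \<Rightarrow> ennreal"
  assumes "countable A" "\<And>i. i \<in> A \<Longrightarrow> f i \<in> borel_measurable M" and q: "0 < q"
    and le: "\<And>J. finite J \<Longrightarrow> J \<subseteq> A \<Longrightarrow> (\<integral>\<^sup>+z. ennpowr (\<Sum>i\<in>J. f i z) q \<partial>M) \<le> B"
  shows "(\<integral>\<^sup>+z. ennpowr (\<Sum>\<^sub>\<infinity>i\<in>A. f i z) q \<partial>M) \<le> B"
proof -
  obtain J :: "nat \<Rightarrow> 'i set" where J: "incseq J" "\<And>n. finite (J n)" "\<And>n. J n \<subseteq> A"
    "\<And>f :: 'i \<Rightarrow> ennreal. infsum f A = (SUP n. sum f (J n))"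
    by (rule countable_exhaustion[OF assms(1)]) (rule that)
  have "(\<integral>\<^sup>+z. ennpowr (\<Sum>\<^sub>\<infinity>i\<in>A. f i z) q \<partial>M)
      = (\<integral>\<^sup>+z. (SUP n. ennpowr (\<Sum>i\<in>J n. f i z) q) \<partial>M)"
    unfolding J(4) ennpowr_SUP[OF q] ..
  also have "\<dots> = (SUP n. \<integral>\<^sup>+z. ennpowr (\<Sum>i\<in>J n. f i z) q \<partial>M)"
  proof (rule nn_integral_monotone_convergence_SUP)
    show "incseq (\<lambda>n z. ennpowr (\<Sum>i\<in>J n. f i z) q)"
      using q J(1,2) by (auto simp: incseq_def le_fun_def intro!: ennpowr_mono sum_mono2)
    fix n
    have [measurable]: "(\<lambda>z. \<Sum>i\<in>J n. f i z) \<in> borel_measurable M"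
      using J(3) assms(2) by (intro borel_measurable_sum) auto
    show "(\<lambda>z. ennpowr (\<Sum>i\<in>J n. f i z) q) \<in> borel_measurable M" by measurable
  qed
  also have "\<dots> \<le> B" using J by (intro SUP_least le)
  finally show ?thesis .
qed

context pair_sigma_finite
begin

text \<open>Here \<open>T A\<close> stands for the square of a square function, so that the exponents \<open>p\<close>, \<open>q\<close> and \<open>Suc m\<close> are half
  of the Lebesgue exponents, and \<open>c\<close> for the square of the level. A rectangle belongs to \<open>A\<close> if at least
  half of it lies in \<open>{T I \<le> c}\<close>; otherwise at least half of it lies in \<open>\<Omega> = {T I > c}\<close>. The factor 17
  is 1 for the integral over \<open>\<Omega>\<close> plus 16 for the union of the rectangles outside \<open>A\<close>.\<close>

lemma rectangle_square_function_split:
  fixes a :: "'i \<Rightarrow> ennreal" and c p q :: real and m :: nat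
  assumes I: "countable I" "laminar I gen1 Q1" "laminar I gen2 Q2"
    and Q1: "\<And>i. i \<in> I \<Longrightarrow> Q1 i \<in> sets M1" and Q2: "\<And>i. i \<in> I \<Longrightarrow> Q2 i \<in> sets M2"
    and pos1: "\<And>i. i \<in> I \<Longrightarrow> 0 < emeasure M1 (Q1 i)"
    and fin1: "\<And>i. i \<in> I \<Longrightarrow> emeasure M1 (Q1 i) < \<infinity>"
    and fin2: "\<And>i. i \<in> I \<Longrightarrow> emeasure M2 (Q2 i) < \<infinity>"
    and a: "\<And>i. i \<in> I \<Longrightarrow> a i < \<infinity>"
    and c: "0 < c" and q: "0 < q" "q \<le> p" "p \<le> real (Suc m)"
  defines "T \<equiv> \<lambda>A z. \<Sum>\<^sub>\<infinity>i\<in>A. a i * indicator (Q1 i \<times> Q2 i) z"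
  defines "P \<equiv> \<integral>\<^sup>+z. ennpowr (T I z) p \<partial>(M1 \<Otimes>\<^sub>M M2)"
  obtains A where "A \<subseteq> I"
    "(\<integral>\<^sup>+z. T A z ^ Suc m \<partial>(M1 \<Otimes>\<^sub>M M2))
       \<le> ((2 * of_nat (Suc m) * 4) ^ Suc m) ^ 2 * (ennreal (c powr (real (Suc m) - p)) * P)"
    "(\<integral>\<^sup>+z. ennpowr (T (I - A) z) q \<partial>(M1 \<Otimes>\<^sub>M M2)) \<le> 17 * (ennreal (c powr (q - p)) * P)"
proof
  let ?M = "M1 \<Otimes>\<^sub>M M2" and ?C = "((2 * of_nat (Suc m) * 4) ^ Suc m) ^ 2 :: ennreal"
  let ?R = "\<lambda>i. Q1 i \<times> Q2 i"
  define \<Omega> where "\<Omega> = {z \<in> space ?M. ennreal c < T I z}"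
  let ?E = "space ?M - \<Omega>"
  define A where "A = {i \<in> I. emeasure ?M (?R i) \<le> 2 * emeasure ?M (?R i \<inter> ?E)}"
  show "A \<subseteq> I" unfolding A_def by auto
  have R: "?R i \<in> sets ?M" if "i \<in> I" for i using Q1[OF that] Q2[OF that] by auto
  have meas: "(\<lambda>z. a i * indicator (?R i) z) \<in> borel_measurable ?M" if "i \<in> I" for i
    using R[OF that] by measurable
  have [measurable]: "T I \<in> borel_measurable ?M"
    unfolding T_def by (intro borel_measurable_infsum_ennreal I meas)
  have \<Omega> [measurable]: "\<Omega> \<in> sets ?M" unfolding \<Omega>_def by measurable
  have partial_le: "(\<Sum>i\<in>J. a i * indicator (?R i) z) \<le> T I z" if "finite J" "J \<subseteq> I" for J z
    unfolding T_def using that by (rule sum_le_ennreal_infsum)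
  have "(\<integral>\<^sup>+z. ennpowr (T A z) (real (Suc m)) \<partial>?M)
      \<le> ?C * (ennreal (c powr (real (Suc m) - p)) * P)"
    unfolding T_def
  proof (rule nn_integral_ennpowr_infsum_le)
    show "countable A" using I(1) by (rule countable_subset[rotated]) (auto simp: A_def)
    fix J assume J: "finite J" "J \<subseteq> A"
    then have JI: "J \<subseteq> I" unfolding A_def by auto
    let ?F = "\<lambda>z. \<Sum>i\<in>J. a i * indicator (?R i) z"
    have "(\<integral>\<^sup>+z. ?F z ^ Suc m \<partial>?M) \<le> ?C * (\<integral>\<^sup>+z. ?F z ^ Suc m * indicator ?E z \<partial>?M)"
    proof (rule nn_integral_dense_rectangles_le[OF J(1)])
      show "laminar J gen1 Q1" "laminar J gen2 Q2" using I JI by (auto intro: laminar_subset)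
      show "?E \<in> sets ?M" using \<Omega> by auto
      fix i assume "i \<in> J"
      then show "emeasure ?M (?R i) \<le> 2 * emeasure ?M (?R i \<inter> ?E)" using J(2) unfolding A_def by auto
    qed (use JI Q1 Q2 pos1 fin1 fin2 a in auto)
    also have "\<dots> \<le> ?C * (\<integral>\<^sup>+z. ennreal (c powr (real (Suc m) - p)) * ennpowr (T I z) p \<partial>?M)"
    proof (intro mult_left_mono nn_integral_mono)
      fix z assume z: "z \<in> space ?M"
      show "?F z ^ Suc m * indicator ?E z \<le> ennreal (c powr (real (Suc m) - p)) * ennpowr (T I z) p"
      proof (cases "z \<in> ?E")
        case True
        then have "T I z \<le> ennreal c" using z unfolding \<Omega>_def by auto
        have "?F z ^ Suc m \<le> T I z ^ Suc m"
          using partial_le[OF J(1) JI] by (intro power_mono) auto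
        also have "\<dots> = ennpowr (T I z) (real (Suc m))" unfolding ennpowr_Suc ..
        also have "\<dots> \<le> ennreal (c powr (real (Suc m) - p)) * ennpowr (T I z) p"
          using \<open>T I z \<le> ennreal c\<close> c q by (intro ennpowr_le_below) auto
        finally show ?thesis using True by simp
      qed simp
    qed simp
    also have "\<dots> = ?C * (ennreal (c powr (real (Suc m) - p)) * P)"
      unfolding P_def by (subst nn_integral_cmult) auto
    finally show "(\<integral>\<^sup>+z. ennpowr (?F z) (real (Suc m)) \<partial>?M)
        \<le> ?C * (ennreal (c powr (real (Suc m) - p)) * P)"
      unfolding ennpowr_Suc .
  qed (use meas in \<open>auto simp: A_def\<close>)
  then show "(\<integral>\<^sup>+z. T A z ^ Suc m \<partial>?M) \<le> ?C * (ennreal (c powr (real (Suc m) - p)) * P)"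
    unfolding ennpowr_Suc .
  show "(\<integral>\<^sup>+z. ennpowr (T (I - A) z) q \<partial>?M) \<le> 17 * (ennreal (c powr (q - p)) * P)"
    unfolding T_def
  proof (rule nn_integral_ennpowr_infsum_le[OF _ _ q(1)])
    show "countable (I - A)" using I(1) by auto
    fix J assume J: "finite J" "J \<subseteq> I - A"
    then have JI: "J \<subseteq> I" by auto
    let ?F = "\<lambda>z. \<Sum>i\<in>J. a i * indicator (?R i) z" and ?U = "\<Union>i\<in>J. ?R i"
    have U [measurable]: "?U \<in> sets ?M" using J(1) JI R by auto
    have U_le: "emeasure ?M ?U \<le> 16 * emeasure ?M \<Omega>"
    proof (rule emeasure_dense_rectangles_Union_le[OF J(1)])
      show "laminar J gen1 Q1" "laminar J gen2 Q2" using I JI by (auto intro: laminar_subset)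
      fix i assume i: "i \<in> J"
      have fin: "emeasure ?M (?R i) < \<infinity>"
        using i JI Q1 Q2 fin1[of i] fin2[of i]
        by (auto simp: M2.emeasure_pair_measure_Times ennreal_mult_less_top)
      have split: "emeasure ?M (?R i) = emeasure ?M (?R i \<inter> \<Omega>) + emeasure ?M (?R i \<inter> ?E)"
      proof -
        have "?R i = (?R i \<inter> \<Omega>) \<union> (?R i \<inter> ?E)" using sets.sets_into_space[OF R[of i]] i JI by auto
        then show ?thesis using R[of i] i JI \<Omega>
          by (subst plus_emeasure) auto
      qed
      have "2 * emeasure ?M (?R i \<inter> ?E) < emeasure ?M (?R i)" using i J(2) unfolding A_def by auto
      then show "emeasure ?M (?R i) \<le> 2 * emeasure ?M (?R i \<inter> \<Omega>)"
        using fin unfolding split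
        by (cases "emeasure ?M (?R i \<inter> \<Omega>)"; cases "emeasure ?M (?R i \<inter> ?E)")
           (auto simp: ennreal_plus[symmetric] ennreal_mult''[symmetric] ennreal_numeral[symmetric]
              ennreal_less_iff simp del: ennreal_plus ennreal_numeral)
    qed (use JI Q1 Q2 pos1 fin1 fin2 \<Omega> in auto)
    have \<Omega>_le: "ennreal (c powr q) * emeasure ?M \<Omega> \<le> ennreal (c powr (q - p)) * P"
    proof -
      have "ennreal (c powr q) * emeasure ?M \<Omega> = (\<integral>\<^sup>+z. ennreal (c powr q) * indicator \<Omega> z \<partial>?M)"
        by (simp add: nn_integral_cmult_indicator)
      also have "\<dots> \<le> (\<integral>\<^sup>+z. ennreal (c powr (q - p)) * ennpowr (T I z) p \<partial>?M)"
      proof (intro nn_integral_mono)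
        fix z
        show "ennreal (c powr q) * indicator \<Omega> z \<le> ennreal (c powr (q - p)) * ennpowr (T I z) p"
        proof (cases "z \<in> \<Omega>")
          case True
          then have "ennreal c \<le> T I z" unfolding \<Omega>_def by auto
          then have "ennreal (c powr p) \<le> ennpowr (T I z) p"
            using ennpowr_mono[of "ennreal c" "T I z" p] q c by (simp add: ennpowr_ennreal)
          then have "ennreal (c powr (q - p)) * ennreal (c powr p)
              \<le> ennreal (c powr (q - p)) * ennpowr (T I z) p" by (intro mult_left_mono) auto
          then show ?thesis using True by (simp add: ennreal_mult[symmetric] powr_add[symmetric])
        qed simp
      qed
      also have "\<dots> = ennreal (c powr (q - p)) * P"
        unfolding P_def by (subst nn_integral_cmult) auto
      finally show ?thesis .
    qed
    have "(\<integral>\<^sup>+z. ennpowr (?F z) q \<partial>?M)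
        \<le> (\<integral>\<^sup>+z. ennreal (c powr (q - p)) * ennpowr (T I z) p + ennreal (c powr q) * indicator ?U z \<partial>?M)"
    proof (intro nn_integral_mono)
      fix z assume z: "z \<in> space ?M"
      have F_le: "ennpowr (?F z) q \<le> ennpowr (T I z) q"
        using partial_le[OF J(1) JI] q by (intro ennpowr_mono) auto
      show "ennpowr (?F z) q
          \<le> ennreal (c powr (q - p)) * ennpowr (T I z) p + ennreal (c powr q) * indicator ?U z"
      proof (cases "z \<in> \<Omega>")
        case True
        then have "ennpowr (T I z) q \<le> ennreal (c powr (q - p)) * ennpowr (T I z) p"
          using c q unfolding \<Omega>_def by (intro ennpowr_le_above) auto
        with F_le show ?thesis by (intro add_increasing2) auto
      next
        case False
        then have "T I z \<le> ennreal c" using z unfolding \<Omega>_def by auto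
        then have "ennpowr (T I z) q \<le> ennreal (c powr q)"
          using ennpowr_mono[of "T I z" "ennreal c" q] c q by (simp add: ennpowr_ennreal)
        with F_le have *: "ennpowr (?F z) q \<le> ennreal (c powr q)" by (rule order_trans)
        show ?thesis
        proof (cases "z \<in> ?U")
          case True
          with * show ?thesis by (intro add_increasing) auto
        next
          case False
          then have "?F z = 0" by (intro sum.neutral) auto
          then show ?thesis by simp
        qed
      qed
    qed
    also have "\<dots> = ennreal (c powr (q - p)) * P + ennreal (c powr q) * emeasure ?M ?U"
      unfolding P_def by (subst nn_integral_add) (auto simp: nn_integral_cmult nn_integral_cmult_indicator)
    also have "\<dots> \<le> ennreal (c powr (q - p)) * P + ennreal (c powr q) * (16 * emeasure ?M \<Omega>)"
      using U_le by (intro add_mono mult_left_mono) auto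
    also have "\<dots> = ennreal (c powr (q - p)) * P + 16 * (ennreal (c powr q) * emeasure ?M \<Omega>)"
      by (simp add: mult_ac)
    also have "\<dots> \<le> ennreal (c powr (q - p)) * P + 16 * (ennreal (c powr (q - p)) * P)"
      using \<Omega>_le by (intro add_mono mult_left_mono) auto
    also have "\<dots> = (1 + 16) * (ennreal (c powr (q - p)) * P)" by (simp only: distrib_right mult_1)
    finally show "(\<integral>\<^sup>+z. ennpowr (?F z) q \<partial>?M) \<le> 17 * (ennreal (c powr (q - p)) * P)"
      by simp
  qed (use meas in auto)
qed

end

section \<open>Spaces of homogeneous type with dyadic cubes\<close>

text \<open>The axioms of a space of homogeneous type are unpacked in this lemma and the next one; a ball of
  nonpositive radius is empty, so finiteness holds for all radii.\<close>

lemma qd_homogeneous: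
  assumes "homogeneous_space S"
  shows "1 \<le> qconst S" "0 \<le> qd S x y" "qd S x y = qd S y x" "qd S x y = 0 \<longleftrightarrow> x = y"
    "qd S x y \<le> qconst S * (qd S x z + qd S z y)"
  using assms unfolding homogeneous_space_def quasi_metric_def by auto

lemma meas_homogeneous:
  assumes "homogeneous_space S"
  shows "space (meas S) = UNIV" "qball S x r \<in> sets (meas S)"
    "0 < r \<Longrightarrow> 0 < emeasure (meas S) (qball S x r)"
    "emeasure (meas S) (qball S x r) < \<infinity>"
proof -
  show "space (meas S) = UNIV" "qball S x r \<in> sets (meas S)"
    "0 < r \<Longrightarrow> 0 < emeasure (meas S) (qball S x r)"
    using assms unfolding homogeneous_space_def by auto
  show "emeasure (meas S) (qball S x r) < \<infinity>"
  proof (cases "0 < r")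
    case True
    then show ?thesis using assms unfolding homogeneous_space_def by auto
  next
    case False
    then have "\<not> qd S x y < r" for y
      using qd_homogeneous(2)[OF assms, of x y] by linarith
    then have "qball S x r = {}" unfolding qball_def by auto
    then show ?thesis by simp
  qed
qed

lemma emeasure_qball:
  assumes "homogeneous_space S"
  shows "emeasure (meas S) (qball S x r) = ennreal (vol S x r)"
  unfolding vol_def using meas_homogeneous(4)[OF assms, of x r]
  by (intro emeasure_eq_ennreal_measure) auto

lemma vol_pos:
  assumes "homogeneous_space S" "0 < r"
  shows "0 < vol S x r"
  using meas_homogeneous(3)[OF assms, of x] emeasure_qball[OF assms(1), of x r] by simp

lemma vol_mono:
  assumes "homogeneous_space S" "qball S x r \<subseteq> qball S y s"
  shows "vol S x r \<le> vol S y s"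
  using emeasure_mono[OF assms(2) meas_homogeneous(2)[OF assms(1)]]
  unfolding emeasure_qball[OF assms(1)] by (subst (asm) ennreal_le_iff) (auto simp: vol_def)

lemma vol_doubling:
  assumes "homogeneous_space S"
  obtains C where "0 < C" "\<And>x r m. 0 < r \<Longrightarrow> vol S x (2 ^ m * r) \<le> C ^ m * vol S x r"
proof -
  obtain C :: real where C: "\<And>x r. 0 < r \<Longrightarrow>
      emeasure (meas S) (qball S x (2 * r)) \<le> ennreal C * emeasure (meas S) (qball S x r)"
    using assms unfolding homogeneous_space_def by blast
  define D where "D = max 1 C"
  have D: "vol S x (2 * r) \<le> D * vol S x r" if "0 < r" for x r
  proof -
    have "ennreal (vol S x (2 * r)) \<le> ennreal C * ennreal (vol S x r)"
      using C[OF that, of x] unfolding emeasure_qball[OF assms] .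
    also have "\<dots> \<le> ennreal (D * vol S x r)"
      unfolding D_def by (subst ennreal_mult) (auto simp: vol_def intro!: mult_right_mono ennreal_leI)
    finally show ?thesis by (subst (asm) ennreal_le_iff) (auto simp: D_def vol_def)
  qed
  have "vol S x (2 ^ m * r) \<le> D ^ m * vol S x r" if "0 < r" for x r m
  proof (induction m)
    case (Suc m)
    have "vol S x (2 ^ Suc m * r) \<le> D * vol S x (2 ^ m * r)"
      using D[of "2 ^ m * r" x] that by (simp add: mult.assoc)
    also have "\<dots> \<le> D * (D ^ m * vol S x r)" using Suc by (intro mult_left_mono) (auto simp: D_def)
    finally show ?case by (simp add: mult.assoc)
  qed simp
  with that[of D] show ?thesis by (auto simp: D_def)
qed

lemma sigma_finite_homogeneous:
  assumes "homogeneous_space S"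
  shows "sigma_finite_measure (meas S)"
proof
  let ?A = "range (\<lambda>n. qball S undefined (real n))"
  have "\<exists>n. x \<in> qball S undefined (real n)" for x
    using reals_Archimedean2[of "qd S undefined x"] unfolding qball_def by auto
  then show "\<exists>A. countable A \<and> A \<subseteq> sets (meas S) \<and> \<Union> A = space (meas S) \<and>
      (\<forall>a\<in>A. emeasure (meas S) a \<noteq> \<infinity>)"
    using meas_homogeneous[OF assms] by (intro exI[of _ ?A]) (auto simp: less_top)
qed

text \<open>The bump itself involves the measure of a ball whose radius depends on the point, and is therefore
  not obviously measurable. The majorant is a multiple of \<open>\<Sum>\<^sub>j \<rho>\<^sup>j \<chi>\<^bsub>B(x0, 2\<^sup>j)\<^esub> / |B(x0, 2\<^sup>j)|\<close> with
  \<open>\<rho> = 2\<^bsup>- \<gamma>\<^esup> < 1\<close>, which is bounded and integrable because \<open>\<Sum>\<^sub>j \<rho>\<^sup>j\<close> converges. By doubling, the bump at a point at distance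
  about \<open>2\<^sup>j\<close> from \<open>x0\<close> is dominated by the term of index \<open>j + 1\<close>.\<close>

lemma bump_majorant:
  fixes S :: "('a, 'z) homog_scheme"
  assumes S: "homogeneous_space S" and \<gamma>: "0 < \<gamma>"
  obtains B :: "'a \<Rightarrow> real" and K :: real
  where "B \<in> borel_measurable (meas S)" "integrable (meas S) (\<lambda>x. (B x)\<^sup>2)"
    "\<And>x. 0 \<le> B x" "\<And>x. B x \<le> K"
    "\<And>x. bump (vol S x0 1 + vol2 S x x0) 1 \<gamma> (qd S x x0) \<le> B x"
proof -
  define \<rho> where "\<rho> = (2::real) powr (- \<gamma>)"
  have \<rho>: "0 < \<rho>" "\<rho> < 1" unfolding \<rho>_def using \<gamma> powr_less_mono[of "- \<gamma>" 0 2] by auto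
  obtain D where D: "0 < D" "\<And>x r m. 0 < r \<Longrightarrow> vol S x (2 ^ m * r) \<le> D ^ m * vol S x r"
    by (rule vol_doubling[OF S]) (rule that)
  obtain m where m: "3 * qconst S \<le> 2 ^ m"
    using real_arch_pow[of 2 "3 * qconst S"] by (auto intro: less_imp_le)
  define L where "L = D ^ m / \<rho>"
  define f where "f j x = \<rho> ^ j / vol S x0 (2 ^ j) * indicator (qball S x0 (2 ^ j)) x" for j :: nat and x
  have V: "0 < vol S x r" if "0 < r" for x r using vol_pos[OF S that] .
  have V1: "vol S x0 1 \<le> vol S x0 (2 ^ j)" for j
    by (rule vol_mono[OF S]) (auto simp: qball_def intro: less_le_trans)
  have f_nonneg: "0 \<le> f j x" for j x
    unfolding f_def using V[of "2 ^ j" x0] \<rho> by (auto simp: indicator_def)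
  have f_le: "f j x \<le> \<rho> ^ j / vol S x0 1" for j x
    unfolding f_def using V[of "2 ^ j" x0] V[of 1 x0] V1[of j] \<rho>
    by (auto simp: indicator_def intro: divide_left_mono)
  have geo: "summable (\<lambda>j. \<rho> ^ j / vol S x0 1)" using \<rho> by (intro summable_divide summable_geometric) auto
  have f_sum: "summable (\<lambda>j. f j x)" for x
    using f_nonneg f_le by (intro summable_comparison_test'[OF geo, of 0]) auto
  have f_integral: "integrable (meas S) (f j)" "(\<integral>x. norm (f j x) \<partial>meas S) = \<rho> ^ j" for j
  proof -
    have "has_bochner_integral (meas S) (f j) (\<rho> ^ j / vol S x0 (2 ^ j) * vol S x0 (2 ^ j))"
      unfolding f_def vol_def using meas_homogeneous[OF S]
      by (intro has_bochner_integral_mult_right has_bochner_integral_real_indicator) auto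
    then have "has_bochner_integral (meas S) (f j) (\<rho> ^ j)" using V[of "2 ^ j" x0] by simp
    then show "integrable (meas S) (f j)" "(\<integral>x. norm (f j x) \<partial>meas S) = \<rho> ^ j"
      using f_nonneg by (auto simp: has_bochner_integral_iff)
  qed
  define F where "F x = (\<Sum>j. f j x)" for x
  have F_int: "integrable (meas S) F"
    unfolding F_def
    by (intro integrable_suminf f_integral) (use f_nonneg f_sum \<rho> f_integral(2) in \<open>auto intro: summable_geometric\<close>)
  have F_nonneg: "0 \<le> F x" for x unfolding F_def by (intro suminf_nonneg f_sum f_nonneg)
  have F_le: "F x \<le> (\<Sum>j. \<rho> ^ j / vol S x0 1)" for x
    unfolding F_def by (intro suminf_le f_le f_sum geo)
  have f_le_F: "f j x \<le> F x" for j x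
    unfolding F_def using sum_le_suminf[OF f_sum, of "{j}" x] f_nonneg by auto
  \<comment> \<open>the factor \<open>L\<close> serves points at distance at least 1 from \<open>x0\<close>, the factor 1 the others\<close>
  define M where "M = max 1 L"
  let ?B = "\<lambda>x. M * F x" and ?K = "M * (\<Sum>j. \<rho> ^ j / vol S x0 1)"
  have M: "1 \<le> M" "L \<le> M" unfolding M_def by auto
  show ?thesis
  proof (rule that[of ?B ?K])
    show meas: "?B \<in> borel_measurable (meas S)" using F_int by auto
    show nonneg: "0 \<le> ?B x" for x using M F_nonneg by auto
    show le: "?B x \<le> ?K" for x using M F_le[of x] by (intro mult_left_mono) auto
    have sq_le: "(?B x)\<^sup>2 \<le> ?K * ?B x" for x
      unfolding power2_eq_square using le[of x] nonneg[of x] by (rule mult_right_mono)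
    show "integrable (meas S) (\<lambda>x. (?B x)\<^sup>2)"
    proof (rule Bochner_Integration.integrable_bound)
      show "integrable (meas S) (\<lambda>x. ?K * ?B x)" using F_int by (intro integrable_mult_right)
      show "(\<lambda>x. (?B x)\<^sup>2) \<in> borel_measurable (meas S)" using meas by (rule borel_measurable_power)
      have "norm ((?B x)\<^sup>2) \<le> norm (?K * ?B x)" for x
        using order_trans[OF sq_le[of x] abs_ge_self] by (simp only: real_norm_def abs_power2)
      then show "AE x in meas S. norm ((?B x)\<^sup>2) \<le> norm (?K * ?B x)" by simp
    qed
    fix x
    let ?t = "qd S x x0"
    have t: "0 \<le> ?t" using qd_homogeneous[OF S] by auto
    have vol2: "0 \<le> vol2 S x x0" unfolding vol2_def vol_def by simp
    have sym: "qd S x0 x = ?t" using qd_homogeneous(3)[OF S] .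
    show "bump (vol S x0 1 + vol2 S x x0) 1 \<gamma> ?t \<le> ?B x"
    proof (cases "?t < 1")
      case True
      have "bump (vol S x0 1 + vol2 S x x0) 1 \<gamma> ?t \<le> 1 / vol S x0 1 * 1"
        unfolding bump_def using V[of 1 x0] vol2 t \<gamma>
        by (intro mult_mono divide_left_mono powr_le1) auto
      also have "\<dots> = f 0 x" unfolding f_def qball_def using True sym by simp
      also have "\<dots> \<le> 1 * F x" using f_le_F by simp
      also have "\<dots> \<le> ?B x" using M F_nonneg[of x] by (intro mult_right_mono) auto
      finally show ?thesis .
    next
      case False
      define j where "j = nat \<lfloor>log 2 ?t\<rfloor>"
      have j: "2 ^ j \<le> ?t" "?t < 2 ^ Suc j"
      proof -
        have "0 \<le> \<lfloor>log 2 ?t\<rfloor>" using False by simp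
        then have "real j \<le> log 2 ?t" "log 2 ?t < real (Suc j)" unfolding j_def by linarith+
        then have "2 powr real j \<le> ?t" "?t < 2 powr real (Suc j)"
          using False powr_le_cancel_iff[of 2 "real j" "log 2 ?t"] powr_less_cancel_iff[of 2 "log 2 ?t" "real (Suc j)"]
          by (simp_all del: of_nat_Suc)
        then show "2 ^ j \<le> ?t" "?t < 2 ^ Suc j" by (auto simp: powr_realpow simp del: of_nat_Suc)
      qed
      have "qball S x0 (2 ^ Suc j) \<subseteq> qball S x (2 ^ m * ?t)"
      proof
        fix y assume "y \<in> qball S x0 (2 ^ Suc j)"
        then have "qd S x0 y < 2 * ?t" using j unfolding qball_def by auto
        then have "qd S x y < qconst S * (?t + 2 * ?t)"
          using qd_homogeneous(1)[OF S] qd_homogeneous(5)[OF S, of x y x0]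
          by (smt (verit) mult_strict_left_mono)
        also have "\<dots> \<le> 2 ^ m * ?t" using m t mult_right_mono[of "3 * qconst S" "2 ^ m" ?t] by (simp add: mult_ac)
        finally show "y \<in> qball S x (2 ^ m * ?t)" unfolding qball_def by simp
      qed
      then have "vol S x0 (2 ^ Suc j) \<le> vol S x (2 ^ m * ?t)" by (rule vol_mono[OF S])
      also have "\<dots> \<le> D ^ m * vol2 S x x0" unfolding vol2_def using D(2)[of ?t x m] False by auto
      finally have v: "vol S x0 (2 ^ Suc j) \<le> D ^ m * vol2 S x x0" .
      have v2: "0 < vol2 S x x0" unfolding vol2_def using False by (intro V) auto
      have "bump (vol S x0 1 + vol2 S x x0) 1 \<gamma> ?t \<le> 1 / vol2 S x x0 * \<rho> ^ j"
        unfolding bump_def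
      proof (intro mult_mono)
        show "1 / (vol S x0 1 + vol2 S x x0) \<le> 1 / vol2 S x x0"
          using v2 V[of 1 x0] by (intro divide_left_mono) auto
        have "(1 / (1 + ?t)) powr \<gamma> \<le> (1 / 2 ^ j) powr \<gamma>"
          using j t \<gamma> by (intro powr_mono2 divide_left_mono) auto
        also have "\<dots> = (2 powr (- real j)) powr \<gamma>"
          by (simp add: powr_minus powr_realpow divide_inverse)
        also have "\<dots> = (2 powr (- \<gamma>)) powr real j" by (simp add: powr_powr mult.commute)
        also have "\<dots> = \<rho> ^ j" unfolding \<rho>_def by (subst powr_realpow) auto
        finally show "(1 / (1 + ?t)) powr \<gamma> \<le> \<rho> ^ j" .
      qed (use v2 in auto)
      also have "\<dots> \<le> D ^ m / vol S x0 (2 ^ Suc j) * \<rho> ^ j"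
        using v v2 V[of "2 ^ Suc j" x0] \<rho>(1)
        by (intro mult_right_mono) (auto simp: divide_simps mult_ac)
      also have "\<dots> = L * f (Suc j) x"
        unfolding L_def f_def qball_def using j sym \<rho> by (simp add: field_simps)
      also have "\<dots> \<le> M * F x" using M f_le_F[of "Suc j" x] f_nonneg by (intro mult_mono) auto
      finally show ?thesis .
    qed
  qed
qed

lemma wavelet_space_homogeneous: "wavelet_space T \<Longrightarrow> homogeneous_space T"
  unfolding wavelet_space_def by auto

lemma cube_props:
  assumes "wavelet_space T" "x \<in> nodes T k"
  shows "cube T k x \<in> sets (meas T)"
    "cube T k x \<subseteq> qball T x (4 * (qconst T)\<^sup>2 * mesh T powi k)"
    "0 < emeasure (meas T) (cube T k x)" "emeasure (meas T) (cube T k x) < \<infinity>"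
proof -
  have T: "homogeneous_space T" "dyadic_cubes T" "0 < mesh T"
    using assms(1) unfolding wavelet_space_def dyadic_points_def by auto
  let ?b = "qball T x (1 / (3 * (qconst T)\<^sup>2) * mesh T powi k)"
  have c: "cube T k x \<in> sets (meas T)" "?b \<subseteq> cube T k x"
    "cube T k x \<subseteq> qball T x (4 * (qconst T)\<^sup>2 * mesh T powi k)"
    using T(2) assms(2) unfolding dyadic_cubes_def by auto
  show "cube T k x \<in> sets (meas T)"
    "cube T k x \<subseteq> qball T x (4 * (qconst T)\<^sup>2 * mesh T powi k)" by fact+
  have "0 < 1 / (3 * (qconst T)\<^sup>2) * mesh T powi k"
    using qd_homogeneous(1)[OF T(1)] T(3) by auto
  then show "0 < emeasure (meas T) (cube T k x)"
    using meas_homogeneous(3)[OF T(1), of _ x] emeasure_mono[OF c(2,1)] by (metis less_le_trans)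
  show "emeasure (meas T) (cube T k x) < \<infinity>"
    using emeasure_mono[OF c(3) meas_homogeneous(2)[OF T(1)]] meas_homogeneous(4)[OF T(1)]
    by (metis le_less_trans)
qed

lemma laminar_cubes:
  assumes "wavelet_space T" "\<And>i. i \<in> I \<Longrightarrow> x i \<in> nodes T (k i)"
  shows "laminar I k (\<lambda>i. cube T (k i) (x i))"
  using assms unfolding laminar_def wavelet_space_def dyadic_cubes_def by blast

text \<open>The cubes with centres in a fixed ball are disjoint, have positive measure and are contained in
  a common set of finite measure.\<close>

lemma countable_nodes:
  assumes T: "wavelet_space T"
  shows "countable (nodes T k)"
proof -
  note S = wavelet_space_homogeneous[OF T]
  define N where "N n = {x \<in> nodes T k. qd T undefined x < real n}" for n :: nat
  have "countable (N n)" for n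
  proof -
    let ?r = "4 * (qconst T)\<^sup>2 * mesh T powi k"
    define b where "b = qball T undefined (qconst T * (real n + ?r))"
    have b: "b \<in> sets (meas T)" "emeasure (meas T) b < \<infinity>"
      unfolding b_def using meas_homogeneous[OF S] by auto
    have sub: "cube T k x \<subseteq> b" if "x \<in> N n" for x
    proof
      fix y assume y: "y \<in> cube T k x"
      have "qd T x y < ?r" using cube_props(2)[OF T, of x k] that y unfolding N_def qball_def by auto
      moreover have "qd T undefined x < real n" using that unfolding N_def by auto
      ultimately show "y \<in> b" unfolding b_def qball_def
        using qd_homogeneous(1)[OF S] qd_homogeneous(5)[OF S, of undefined y x]
        by (smt (verit) mem_Collect_eq mult_strict_left_mono)
    qed
    have "(\<lambda>x. measure (meas T) (cube T k x)) summable_on N n"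
    proof (rule nonneg_bdd_above_summable_on)
      show "bdd_above (sum (\<lambda>x. measure (meas T) (cube T k x)) ` {F. F \<subseteq> N n \<and> finite F})"
      proof (rule bdd_aboveI2)
        fix F assume F: "F \<in> {F. F \<subseteq> N n \<and> finite F}"
        then have F': "F \<subseteq> nodes T k" unfolding N_def by auto
        have "disjoint_family_on (cube T k) F"
          using T F' unfolding wavelet_space_def dyadic_cubes_def
          by (auto intro: disjoint_family_on_mono)
        then have "(\<Sum>x\<in>F. measure (meas T) (cube T k x)) = measure (meas T) (\<Union>x\<in>F. cube T k x)"
          using F F' cube_props[OF T] by (intro measure_finite_Union[symmetric]) fastforce+
        also have "\<dots> \<le> measure (meas T) b"
        proof (rule measure_mono_fmeasurable)
          show "(\<Union>x\<in>F. cube T k x) \<subseteq> b" using F sub by blast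
          show "(\<Union>x\<in>F. cube T k x) \<in> sets (meas T)"
            using F F' cube_props(1)[OF T] by (intro sets.finite_UN) auto
          show "b \<in> fmeasurable (meas T)" using b by (auto simp: fmeasurable_def)
        qed
        finally show "(\<Sum>x\<in>F. measure (meas T) (cube T k x)) \<le> measure (meas T) b" .
      qed
    qed auto
    from summable_countable_real[OF this]
    have "countable {x \<in> N n. measure (meas T) (cube T k x) \<noteq> 0}" .
    also have "{x \<in> N n. measure (meas T) (cube T k x) \<noteq> 0} = N n"
      using cube_props[OF T] unfolding N_def measure_def by (fastforce simp: enn2real_eq_0_iff)
    finally show ?thesis .
  qed
  moreover have "nodes T k = (\<Union>n. N n)"
    unfolding N_def using reals_Archimedean2 by auto
  ultimately show ?thesis by auto
qed

text \<open>The sigma-algebra is only known to contain the balls, so continuity is not by itself a reason for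
  measurability. But \<open>u\<close> is the pointwise limit of the functions whose value on each cube of generation
  \<open>n\<close> is the value of \<open>u\<close> at the centre, and these are measurable as there are countably many cubes.\<close>

lemma borel_measurable_sequentially_continuous:
  fixes u :: "'a \<Rightarrow> 'c :: metric_space" and T :: "('a, 'z) whomog_scheme"
  assumes T: "wavelet_space T"
    and cont: "\<And>y s. (\<lambda>n. qd T y (s n)) \<longlonglongrightarrow> 0 \<Longrightarrow> (\<lambda>n. u (s n)) \<longlonglongrightarrow> u y"
  shows "u \<in> borel_measurable (meas T)"
proof -
  note S = wavelet_space_homogeneous[OF T]
  define cen where "cen n y = (SOME x. x \<in> nodes T (int n) \<and> y \<in> cube T (int n) x)" for n y
  have cubes: "(\<Union>x\<in>nodes T k. cube T k x) = UNIV" "disjoint_family_on (cube T k) (nodes T k)" for k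
    using T unfolding wavelet_space_def dyadic_cubes_def by auto
  have cen: "cen n y \<in> nodes T (int n)" "y \<in> cube T (int n) (cen n y)" for n y
    using someI_ex[of "\<lambda>x. x \<in> nodes T (int n) \<and> y \<in> cube T (int n) x"] cubes(1)[of "int n"]
    unfolding cen_def by auto
  show ?thesis
  proof (rule borel_measurable_LIMSEQ_metric)
    fix n
    have cen_eq: "cen n y = x" if "x \<in> nodes T (int n)" "y \<in> cube T (int n) x" for x y
      using disjoint_family_onD[OF cubes(2) cen(1)[of n y] that(1)] cen(2)[of y n] that(2) by blast
    have "cen n -` {x} \<inter> space (meas T) = cube T (int n) x" if "x \<in> nodes T (int n)" for x
      using cen(2) cen_eq[OF that] meas_homogeneous(1)[OF S] by auto
    then have "cen n \<in> measurable (meas T) (count_space (nodes T (int n)))"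
      using cen countable_nodes[OF T] cube_props(1)[OF T]
      by (subst measurable_count_space_eq_countable) auto
    then show "(\<lambda>y. u (cen n y)) \<in> borel_measurable (meas T)"
      by (rule measurable_compose) auto
  next
    fix y
    have \<delta>: "0 < mesh T" "mesh T < 1" using T unfolding wavelet_space_def dyadic_points_def by auto
    have lim: "(\<lambda>n. 4 * (qconst T)\<^sup>2 * mesh T ^ n) \<longlonglongrightarrow> 0"
      using \<delta> by (intro tendsto_mult_right_zero LIMSEQ_realpow_zero) auto
    have le: "norm (qd T y (cen n y)) \<le> 4 * (qconst T)\<^sup>2 * mesh T ^ n" for n
    proof -
      have "y \<in> qball T (cen n y) (4 * (qconst T)\<^sup>2 * mesh T powi int n)"
        using cube_props(2)[OF T cen(1)[of n y]] cen(2)[of y n] by blast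
      then have "qd T (cen n y) y < 4 * (qconst T)\<^sup>2 * mesh T ^ n"
        unfolding qball_def by simp
      then show ?thesis
        using qd_homogeneous(2)[OF S, of y "cen n y"] qd_homogeneous(3)[OF S, of y "cen n y"] by simp
    qed
    have "(\<lambda>n. qd T y (cen n y)) \<longlonglongrightarrow> 0"
      by (rule Lim_null_comparison[OF _ lim]) (use le in auto)
    then show "(\<lambda>n. u (cen n y)) \<longlonglongrightarrow> u y" by (rule cont)
  qed
qed

section \<open>Bessel's inequality for tensor products\<close>

lemma borel_measurable_cnj [measurable (raw)]:
  "f \<in> borel_measurable M \<Longrightarrow> (\<lambda>x. cnj (f x)) \<in> borel_measurable M"
  by (rule measurable_compose[OF _ borel_measurable_continuous_onI]) (auto intro: continuous_intros)

lemma square_integrable_mult_cnj: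
  assumes "square_integrable M f" "square_integrable M g"
  shows "integrable M (\<lambda>x. f x * cnj (g x))"
proof (rule Bochner_Integration.integrable_bound)
  show "integrable M (\<lambda>x. (norm (f x))\<^sup>2 + (norm (g x))\<^sup>2)"
    using assms unfolding square_integrable_def by auto
  show "(\<lambda>x. f x * cnj (g x)) \<in> borel_measurable M"
    using assms unfolding square_integrable_def by (auto intro!: borel_measurable_times borel_measurable_cnj)
  have "norm (f x * cnj (g x)) \<le> norm ((norm (f x))\<^sup>2 + (norm (g x))\<^sup>2)" for x
    using sum_squares_bound[of "norm (f x)" "norm (g x)"]
      mult_nonneg_nonneg[OF norm_ge_zero[of "f x"] norm_ge_zero[of "g x"]]
    unfolding norm_mult complex_mod_cnj real_norm_def by linarith
  then show "AE x in M. norm (f x * cnj (g x)) \<le> norm ((norm (f x))\<^sup>2 + (norm (g x))\<^sup>2)" by simp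
qed

lemma square_integrable_dominated:
  assumes "f \<in> borel_measurable M" "integrable M (\<lambda>x. (B x)\<^sup>2)" "\<And>x. norm (f x) \<le> K * B x"
  shows "square_integrable M f" "(\<integral>x. (norm (f x))\<^sup>2 \<partial>M) \<le> K\<^sup>2 * (\<integral>x. (B x)\<^sup>2 \<partial>M)"
proof -
  have le: "(norm (f x))\<^sup>2 \<le> K\<^sup>2 * (B x)\<^sup>2" for x
    using power_mono[OF assms(3)[of x] norm_ge_zero, of 2] by (simp add: power_mult_distrib)
  have int: "integrable M (\<lambda>x. K\<^sup>2 * (B x)\<^sup>2)" using assms(2) by (rule integrable_mult_right)
  have "integrable M (\<lambda>x. (norm (f x))\<^sup>2)"
    by (rule Bochner_Integration.integrable_bound[OF int]) (use assms(1) le in auto)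
  then show "square_integrable M f" using assms(1) unfolding square_integrable_def by auto
  have "(\<integral>x. (norm (f x))\<^sup>2 \<partial>M) \<le> (\<integral>x. K\<^sup>2 * (B x)\<^sup>2 \<partial>M)"
    by (rule integral_mono) (use le int \<open>integrable M (\<lambda>x. (norm (f x))\<^sup>2)\<close> in auto)
  then show "(\<integral>x. (norm (f x))\<^sup>2 \<partial>M) \<le> K\<^sup>2 * (\<integral>x. (B x)\<^sup>2 \<partial>M)" by simp
qed

text \<open>The integral of \<open>|h - s|\<^sup>2\<close>, with \<open>s\<close> the projection of \<open>h\<close> to the span of the family, equals the difference
  of the two sides.\<close>

lemma bessel_inequality:
  assumes F: "finite F" and e: "\<And>i. i \<in> F \<Longrightarrow> square_integrable M (e i)"
    and ortho: "\<And>i j. i \<in> F \<Longrightarrow> j \<in> F \<Longrightarrow> (\<integral>x. e i x * cnj (e j x) \<partial>M) = (if i = j then 1 else 0)"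
    and h: "square_integrable M h"
  shows "(\<Sum>i\<in>F. (norm (\<integral>x. h x * cnj (e i x) \<partial>M))\<^sup>2) \<le> (\<integral>x. (norm (h x))\<^sup>2 \<partial>M)"
proof -
  define d where "d i = (\<integral>x. h x * cnj (e i x) \<partial>M)" for i
  define s where "s x = (\<Sum>i\<in>F. d i * e i x)" for x
  have he: "integrable M (\<lambda>x. h x * cnj (e i x))" "integrable M (\<lambda>x. e i x * cnj (h x))"
    if "i \<in> F" for i using e[OF that] h by (auto intro: square_integrable_mult_cnj)
  have eh: "(\<integral>x. e i x * cnj (h x) \<partial>M) = cnj (d i)" for i
    unfolding d_def using Bochner_Integration.integral_cnj[of M "\<lambda>x. h x * cnj (e i x)"] by (simp add: mult.commute)
  have ee: "integrable M (\<lambda>x. e i x * cnj (e j x))" if "i \<in> F" "j \<in> F" for i j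
    using that e by (auto intro: square_integrable_mult_cnj)
  have hh: "integrable M (\<lambda>x. h x * cnj (h x))" using h by (auto intro: square_integrable_mult_cnj)
  have expand: "complex_of_real ((norm (h x - s x))\<^sup>2) = h x * cnj (h x)
      - (\<Sum>i\<in>F. cnj (d i) * (h x * cnj (e i x))) - (\<Sum>i\<in>F. d i * (e i x * cnj (h x)))
      + (\<Sum>i\<in>F. \<Sum>j\<in>F. d i * cnj (d j) * (e i x * cnj (e j x)))" for x
  proof -
    have "complex_of_real ((norm (h x - s x))\<^sup>2) = (h x - s x) * cnj (h x - s x)"
      by (rule complex_norm_square)
    also have "\<dots> = h x * cnj (h x) - h x * cnj (s x) - s x * cnj (h x) + s x * cnj (s x)"
      by (simp add: algebra_simps)
    also have "h x * cnj (s x) = (\<Sum>i\<in>F. cnj (d i) * (h x * cnj (e i x)))"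
      unfolding s_def cnj_sum sum_distrib_left by (intro sum.cong) auto
    also have "s x * cnj (h x) = (\<Sum>i\<in>F. d i * (e i x * cnj (h x)))"
      unfolding s_def sum_distrib_right by (intro sum.cong) auto
    also have "s x * cnj (s x) = (\<Sum>i\<in>F. \<Sum>j\<in>F. d i * cnj (d j) * (e i x * cnj (e j x)))"
      unfolding s_def cnj_sum sum_product by (intro sum.cong) auto
    finally show ?thesis .
  qed
  have "complex_of_real (\<integral>x. (norm (h x - s x))\<^sup>2 \<partial>M) = (\<integral>x. complex_of_real ((norm (h x - s x))\<^sup>2) \<partial>M)"
    by (rule integral_complex_of_real[symmetric])
  also have "\<dots> = (\<integral>x. h x * cnj (h x) \<partial>M)
      - (\<Sum>i\<in>F. cnj (d i) * (\<integral>x. h x * cnj (e i x) \<partial>M)) - (\<Sum>i\<in>F. d i * (\<integral>x. e i x * cnj (h x) \<partial>M))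
      + (\<Sum>i\<in>F. \<Sum>j\<in>F. d i * cnj (d j) * (\<integral>x. e i x * cnj (e j x) \<partial>M))"
    unfolding expand
    by (intro has_bochner_integral_integral_eq has_bochner_integral_add has_bochner_integral_diff
        has_bochner_integral_sum has_bochner_integral_mult_right has_bochner_integral_integrable hh he ee)
  also have "(\<Sum>i\<in>F. \<Sum>j\<in>F. d i * cnj (d j) * (\<integral>x. e i x * cnj (e j x) \<partial>M))
      = (\<Sum>i\<in>F. \<Sum>j\<in>F. if i = j then d i * cnj (d j) else 0)"
    using ortho by (intro sum.cong refl) auto
  also have "\<dots> = (\<Sum>i\<in>F. d i * cnj (d i))"
    using F by (intro sum.cong refl) (simp add: sum.delta)
  also have "(\<integral>x. h x * cnj (h x) \<partial>M) = complex_of_real (\<integral>x. (norm (h x))\<^sup>2 \<partial>M)"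
    by (simp only: complex_norm_square[symmetric] integral_complex_of_real)
  also have "complex_of_real (\<integral>x. (norm (h x))\<^sup>2 \<partial>M)
      - (\<Sum>i\<in>F. cnj (d i) * (\<integral>x. h x * cnj (e i x) \<partial>M)) - (\<Sum>i\<in>F. d i * (\<integral>x. e i x * cnj (h x) \<partial>M))
      + (\<Sum>i\<in>F. d i * cnj (d i))
      = complex_of_real ((\<integral>x. (norm (h x))\<^sup>2 \<partial>M) - (\<Sum>i\<in>F. (norm (d i))\<^sup>2))"
    unfolding eh d_def[symmetric] by (simp add: complex_norm_square[symmetric] mult.commute del: of_real_power)
  finally have "(\<integral>x. (norm (h x - s x))\<^sup>2 \<partial>M) = (\<integral>x. (norm (h x))\<^sup>2 \<partial>M) - (\<Sum>i\<in>F. (norm (d i))\<^sup>2)"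
    by (simp only: of_real_eq_iff)
  moreover have "0 \<le> (\<integral>x. (norm (h x - s x))\<^sup>2 \<partial>M)" by simp
  ultimately show ?thesis unfolding d_def by simp
qed

definition partial_coef :: "'a measure \<Rightarrow> ('a \<Rightarrow> complex) \<Rightarrow> ('a \<times> 'b \<Rightarrow> complex) \<Rightarrow> 'b \<Rightarrow> complex" where
  "partial_coef M e \<phi> y = (\<integral>x. \<phi> (x, y) * cnj (e x) \<partial>M)"

text \<open>The coefficient with respect to a tensor product as an iterated integral. This avoids the joint
  measurability of test functions, of which only the slices are known to be measurable.\<close>

definition tensor_coef ::
    "'a measure \<Rightarrow> 'b measure \<Rightarrow> ('a \<Rightarrow> complex) \<Rightarrow> ('b \<Rightarrow> complex) \<Rightarrow> ('a \<times> 'b \<Rightarrow> complex) \<Rightarrow> complex" where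
  "tensor_coef M1 M2 e1 e2 \<phi> = (\<integral>y. partial_coef M1 e1 \<phi> y * cnj (e2 y) \<partial>M2)"

lemma tensor_coef_mult: "tensor_coef M1 M2 e1 e2 (\<lambda>z. c * \<phi> z) = c * tensor_coef M1 M2 e1 e2 \<phi>"
  unfolding tensor_coef_def partial_coef_def by (simp add: mult.assoc)

lemma tensor_coef_product:
  "tensor_coef M1 M2 e1 e2 (\<lambda>(x, y). f1 x * f2 y) = (\<integral>x. f1 x * cnj (e1 x) \<partial>M1) * (\<integral>y. f2 y * cnj (e2 y) \<partial>M2)"
proof -
  have "partial_coef M1 e1 (\<lambda>(x, y). f1 x * f2 y) y = f2 y * (\<integral>x. f1 x * cnj (e1 x) \<partial>M1)" for y
    unfolding partial_coef_def integral_mult_right_zero[symmetric]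
    by (intro Bochner_Integration.integral_cong) auto
  then show ?thesis
    unfolding tensor_coef_def integral_mult_right_zero[symmetric]
    by (intro Bochner_Integration.integral_cong) auto
qed

text \<open>What is needed of a test function for the \<open>L\<^sup>2\<close> theory of its coefficients: a majorant of tensor form,
  and the measurability required by the two iterated integrals.\<close>

definition tensor_dominated ::
    "'a measure \<Rightarrow> 'b measure \<Rightarrow> ('a \<Rightarrow> real) \<Rightarrow> ('b \<Rightarrow> real) \<Rightarrow> real \<Rightarrow> ('a \<times> 'b \<Rightarrow> complex) \<Rightarrow> bool" where
  "tensor_dominated M1 M2 B1 B2 C \<phi> \<longleftrightarrow>
     (\<forall>y. (\<lambda>x. \<phi> (x, y)) \<in> borel_measurable M1) \<and>
     (\<forall>e. square_integrable M1 e \<longrightarrow> partial_coef M1 e \<phi> \<in> borel_measurable M2) \<and>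
     (\<forall>x y. norm (\<phi> (x, y)) \<le> C * B1 x * B2 y)"

locale square_integrable_majorants =
  fixes M1 :: "'a measure" and M2 :: "'b measure" and B1 :: "'a \<Rightarrow> real" and B2 :: "'b \<Rightarrow> real"
  assumes B1: "integrable M1 (\<lambda>x. (B1 x)\<^sup>2)" and B2: "integrable M2 (\<lambda>y. (B2 y)\<^sup>2)"
begin

abbreviation "N1 \<equiv> \<integral>x. (B1 x)\<^sup>2 \<partial>M1"
abbreviation "N2 \<equiv> \<integral>y. (B2 y)\<^sup>2 \<partial>M2"

lemma slice_square_integrable:
  assumes "tensor_dominated M1 M2 B1 B2 C \<phi>"
  shows "square_integrable M1 (\<lambda>x. \<phi> (x, y))"
    "(\<integral>x. (norm (\<phi> (x, y)))\<^sup>2 \<partial>M1) \<le> C\<^sup>2 * N1 * (B2 y)\<^sup>2"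
proof -
  have 1: "(\<lambda>x. \<phi> (x, y)) \<in> borel_measurable M1" "\<And>x. norm (\<phi> (x, y)) \<le> (C * B2 y) * B1 x"
    using assms unfolding tensor_dominated_def by (auto simp: ac_simps)
  show "square_integrable M1 (\<lambda>x. \<phi> (x, y))"
    by (rule square_integrable_dominated(1)[OF 1(1) B1 1(2)])
  show "(\<integral>x. (norm (\<phi> (x, y)))\<^sup>2 \<partial>M1) \<le> C\<^sup>2 * N1 * (B2 y)\<^sup>2"
    using square_integrable_dominated(2)[OF 1(1) B1 1(2)] by (simp add: power_mult_distrib ac_simps)
qed

lemma partial_coef_bessel:
  assumes \<phi>: "tensor_dominated M1 M2 B1 B2 C \<phi>"
    and F: "finite F" and e: "\<And>i. i \<in> F \<Longrightarrow> square_integrable M1 (e i)"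
    and ortho: "\<And>i j. i \<in> F \<Longrightarrow> j \<in> F \<Longrightarrow> (\<integral>x. e i x * cnj (e j x) \<partial>M1) = (if i = j then 1 else 0)"
  shows "(\<Sum>i\<in>F. (norm (partial_coef M1 (e i) \<phi> y))\<^sup>2) \<le> C\<^sup>2 * N1 * (B2 y)\<^sup>2"
  using bessel_inequality[OF F e ortho slice_square_integrable(1)[OF \<phi>, of y]]
    slice_square_integrable(2)[OF \<phi>, of y] unfolding partial_coef_def by simp

lemma partial_coef_square_integrable:
  assumes \<phi>: "tensor_dominated M1 M2 B1 B2 C \<phi>"
    and e: "square_integrable M1 e" "(\<integral>x. e x * cnj (e x) \<partial>M1) = 1"
  shows "square_integrable M2 (partial_coef M1 e \<phi>)"
  unfolding square_integrable_def
proof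
  show meas: "partial_coef M1 e \<phi> \<in> borel_measurable M2"
    using \<phi> e unfolding tensor_dominated_def by auto
  have le: "(norm (partial_coef M1 e \<phi> y))\<^sup>2 \<le> C\<^sup>2 * N1 * (B2 y)\<^sup>2" for y
    using partial_coef_bessel[OF \<phi>, of "{()}" "\<lambda>_. e" y] e by simp
  show "integrable M2 (\<lambda>y. (norm (partial_coef M1 e \<phi> y))\<^sup>2)"
    by (rule Bochner_Integration.integrable_bound[OF integrable_mult_right[OF B2, of "C\<^sup>2 * N1"]])
       (use meas le in \<open>auto intro!: order_trans[OF _ abs_ge_self]\<close>)
qed

text \<open>Bessel's inequality in the second variable, for the partial coefficients, and then in the first one
  for every slice.\<close>

lemma tensor_bessel:
  assumes \<phi>: "tensor_dominated M1 M2 B1 B2 C \<phi>"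
    and F1: "finite F1" and e1: "\<And>i. i \<in> F1 \<Longrightarrow> square_integrable M1 (e1 i)"
    and ortho1: "\<And>i j. i \<in> F1 \<Longrightarrow> j \<in> F1 \<Longrightarrow> (\<integral>x. e1 i x * cnj (e1 j x) \<partial>M1) = (if i = j then 1 else 0)"
    and F2: "finite F2" and e2: "\<And>i. i \<in> F2 \<Longrightarrow> square_integrable M2 (e2 i)"
    and ortho2: "\<And>i j. i \<in> F2 \<Longrightarrow> j \<in> F2 \<Longrightarrow> (\<integral>x. e2 i x * cnj (e2 j x) \<partial>M2) = (if i = j then 1 else 0)"
  shows "(\<Sum>i\<in>F1. \<Sum>j\<in>F2. (norm (tensor_coef M1 M2 (e1 i) (e2 j) \<phi>))\<^sup>2)
    \<le> C\<^sup>2 * N1 * N2"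
proof -
  let ?u = "\<lambda>i. partial_coef M1 (e1 i) \<phi>"
  have u: "square_integrable M2 (?u i)" if "i \<in> F1" for i
    using e1[OF that] ortho1[OF that that] by (intro partial_coef_square_integrable[OF \<phi>]) auto
  have "(\<Sum>i\<in>F1. \<Sum>j\<in>F2. (norm (\<integral>y. ?u i y * cnj (e2 j y) \<partial>M2))\<^sup>2)
      \<le> (\<Sum>i\<in>F1. \<integral>y. (norm (?u i y))\<^sup>2 \<partial>M2)"
    by (intro sum_mono bessel_inequality F2 e2 ortho2 u)
  also have "\<dots> = (\<integral>y. (\<Sum>i\<in>F1. (norm (?u i y))\<^sup>2) \<partial>M2)"
    using u unfolding square_integrable_def by (subst Bochner_Integration.integral_sum) auto
  also have "\<dots> \<le> (\<integral>y. C\<^sup>2 * N1 * (B2 y)\<^sup>2 \<partial>M2)"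
    using u B2 partial_coef_bessel[OF \<phi> F1 e1 ortho1] unfolding square_integrable_def
    by (intro integral_mono Bochner_Integration.integrable_sum integrable_mult_right) auto
  also have "\<dots> = C\<^sup>2 * N1 * N2" by simp
  finally show ?thesis unfolding tensor_coef_def .
qed

lemma tensor_coef_add:
  assumes \<phi>: "tensor_dominated M1 M2 B1 B2 C \<phi>" and \<phi>': "tensor_dominated M1 M2 B1 B2 C' \<phi>'"
    and e1: "square_integrable M1 e1" "(\<integral>x. e1 x * cnj (e1 x) \<partial>M1) = 1"
    and e2: "square_integrable M2 e2"
  shows "tensor_coef M1 M2 e1 e2 (\<lambda>z. \<phi> z + \<phi>' z) = tensor_coef M1 M2 e1 e2 \<phi> + tensor_coef M1 M2 e1 e2 \<phi>'"
proof -
  have "partial_coef M1 e1 (\<lambda>z. \<phi> z + \<phi>' z) y = partial_coef M1 e1 \<phi> y + partial_coef M1 e1 \<phi>' y" for y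
    unfolding partial_coef_def distrib_right
    by (intro Bochner_Integration.integral_add square_integrable_mult_cnj e1
        slice_square_integrable(1)[OF \<phi>] slice_square_integrable(1)[OF \<phi>'])
  then show ?thesis
    unfolding tensor_coef_def
    by (simp only: distrib_right)
       (intro Bochner_Integration.integral_add square_integrable_mult_cnj e2
        partial_coef_square_integrable[OF \<phi> e1] partial_coef_square_integrable[OF \<phi>' e1])
qed

end

text \<open>The infimum that defines the norm is attained in the size condition.\<close>

lemma test_function_bound:
  assumes S: "homogeneous_space S" and f: "f \<in> test_functions S x0 r \<beta> \<gamma>"
  shows "norm (f x) \<le> test_norm S x0 r \<beta> \<gamma> f * bump (vol S x0 r + vol2 S x x0) r \<gamma> (qd S x x0)"
proof -
  let ?b = "bump (vol S x0 r + vol2 S x x0) r \<gamma> (qd S x x0)"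
  obtain C0 where C0: "0 < C0" "test_bound S x0 r \<beta> \<gamma> f C0"
    using f unfolding test_functions_def by auto
  have b: "0 \<le> ?b" unfolding bump_def vol2_def vol_def by simp
  show ?thesis
  proof (cases "?b = 0")
    case True
    then show ?thesis using C0 unfolding test_bound_def by (auto dest: spec[of _ x])
  next
    case False
    have "norm (f x) / ?b \<le> test_norm S x0 r \<beta> \<gamma> f"
      unfolding test_norm_def
    proof (rule cInf_greatest)
      fix C assume "C \<in> {C. 0 < C \<and> test_bound S x0 r \<beta> \<gamma> f C}"
      then have "norm (f x) \<le> C * ?b" unfolding test_bound_def by auto
      then show "norm (f x) / ?b \<le> C" using b False by (simp add: divide_le_eq)
    qed (use C0 in auto)
    then show ?thesis using b False by (simp add: divide_le_eq)
  qed
qed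

lemma test_function_continuous:
  assumes S: "homogeneous_space S" and f: "f \<in> test_functions S x0 r \<beta> \<gamma>"
    and "0 < r" "0 < \<beta>" and lim: "(\<lambda>n. qd S x (s n)) \<longlonglongrightarrow> 0"
  shows "(\<lambda>n. f (s n)) \<longlonglongrightarrow> f x"
proof -
  let ?b = "bump (vol S x0 r + vol2 S x x0) r \<gamma> (qd S x x0)" and ?t = "r + qd S x x0"
  obtain C where C: "test_bound S x0 r \<beta> \<gamma> f C"
    using f unfolding test_functions_def by auto
  have t: "0 < ?t" using \<open>0 < r\<close> qd_homogeneous(2)[OF S, of x x0] by simp
  have "\<forall>\<^sub>F n in sequentially. qd S x (s n) < 1 / (2 * qconst S) * ?t"
    using order_tendstoD(2)[OF lim, of "1 / (2 * qconst S) * ?t"] t qd_homogeneous(1)[OF S] by auto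
  then have bound: "\<forall>\<^sub>F n in sequentially. norm (f (s n) - f x) \<le> C * (qd S x (s n) / ?t) powr \<beta> * ?b"
    using C unfolding test_bound_def by (auto simp: norm_minus_commute elim!: eventually_mono)
  have "(\<lambda>n. (qd S x (s n) / ?t) powr \<beta>) \<longlonglongrightarrow> 0"
    using tendsto_zero_powrI[OF _ tendsto_const[of \<beta>], of "\<lambda>n. qd S x (s n) / ?t"]
      tendsto_divide[OF lim tendsto_const[of ?t]] t \<open>0 < \<beta>\<close> qd_homogeneous(2)[OF S] by auto
  then have "(\<lambda>n. C * (qd S x (s n) / ?t) powr \<beta> * ?b) \<longlonglongrightarrow> 0"
    by (intro tendsto_mult_left_zero tendsto_mult_right_zero)
  with bound have "(\<lambda>n. f (s n) - f x) \<longlonglongrightarrow> 0" by (rule Lim_null_comparison)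
  then show ?thesis by (simp add: LIM_zero_iff)
qed

lemma prod_test_function_bound:
  assumes S1: "homogeneous_space S1"
    and \<phi>: "\<phi> \<in> prod_test_functions S1 S2 (x0, y0) r \<beta> \<gamma>"
    and C: "prod_test_bound S1 S2 (x0, y0) r \<beta> \<gamma> \<phi> C"
  shows "norm (\<phi> (x, y)) \<le> C * bump (vol S1 x0 (fst r) + vol2 S1 x x0) (fst r) (fst \<gamma>) (qd S1 x x0)
    * bump (vol S2 y0 (snd r) + vol2 S2 y y0) (snd r) (snd \<gamma>) (qd S2 y y0)"
    (is "_ \<le> C * ?b1 * ?b2")
proof -
  let ?n = "test_norm S1 x0 (fst r) (fst \<beta>) (fst \<gamma>) (\<lambda>x. \<phi> (x, y))"
  have b1: "0 \<le> ?b1" unfolding bump_def vol2_def vol_def by simp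
  have "(\<lambda>x. \<phi> (x, y)) \<in> test_functions S1 x0 (fst r) (fst \<beta>) (fst \<gamma>)"
    using \<phi> unfolding prod_test_functions_def by auto
  from test_function_bound[OF S1 this, of x] have "norm (\<phi> (x, y)) \<le> ?n * ?b1" .
  also have "?n \<le> C * ?b2" using C unfolding prod_test_bound_def slice_bound_def by auto
  then have "?n * ?b1 \<le> C * ?b2 * ?b1" using b1 by (rule mult_right_mono)
  finally show ?thesis by (simp add: ac_simps)
qed

text \<open>The point is the measurability in \<open>y\<close> of the partial coefficients. By the Hoelder condition on the
  slices \<open>\<phi> (x, \<cdot>)\<close> and dominated convergence they are sequentially continuous.\<close>

lemma prod_test_function_tensor_dominated:
  fixes X1 :: "('a, 'z) whomog_scheme" and X2 :: "('b, 'w) whomog_scheme"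
  assumes X1: "wavelet_space X1" and X2: "wavelet_space X2"
    and \<phi>: "\<phi> \<in> prod_test_functions X1 X2 (x0, y0) (1, 1) \<beta> \<gamma>" and \<beta>: "0 < snd \<beta>"
    and C: "prod_test_bound X1 X2 (x0, y0) (1, 1) \<beta> \<gamma> \<phi> C"
    and B1: "integrable (meas X1) (\<lambda>x. (B1 x)\<^sup>2)" "B1 \<in> borel_measurable (meas X1)" "\<And>x. 0 \<le> B1 x"
      "\<And>x. bump (vol X1 x0 1 + vol2 X1 x x0) 1 (fst \<gamma>) (qd X1 x x0) \<le> B1 x"
    and B2: "\<And>y. B2 y \<le> K"
      "\<And>y. bump (vol X2 y0 1 + vol2 X2 y y0) 1 (snd \<gamma>) (qd X2 y y0) \<le> B2 y"
  shows "0 \<le> C" "tensor_dominated (meas X1) (meas X2) B1 B2 C \<phi>"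
proof -
  note S1 = wavelet_space_homogeneous[OF X1] and S2 = wavelet_space_homogeneous[OF X2]
  let ?b1 = "\<lambda>x. bump (vol X1 x0 1 + vol2 X1 x x0) 1 (fst \<gamma>) (qd X1 x x0)"
  let ?b2 = "\<lambda>y. bump (vol X2 y0 1 + vol2 X2 y y0) 1 (snd \<gamma>) (qd X2 y y0)"
  have pt: "norm (\<phi> (x, y)) \<le> C * ?b1 x * ?b2 y" for x y
    using prod_test_function_bound[OF S1 \<phi> C, of x y] by simp
  have nonneg: "0 \<le> ?b1 x" "0 \<le> ?b2 y" for x y unfolding bump_def vol2_def vol_def by simp_all
  show C0: "0 \<le> C"
  proof -
    have d0: "qd X1 x0 x0 = 0" "qd X2 y0 y0 = 0" using qd_homogeneous(4)[OF S1] qd_homogeneous(4)[OF S2] by auto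
    have "0 < ?b1 x0" "0 < ?b2 y0"
      unfolding bump_def vol2_def d0 using vol_pos[OF S1, of 1 x0] vol_pos[OF S2, of 1 y0]
      by (auto intro!: divide_pos_pos add_pos_nonneg simp: vol_def)
    moreover have "0 \<le> C * ?b1 x0 * ?b2 y0" using pt[of x0 y0] norm_ge_zero by (rule order_trans[rotated])
    ultimately show ?thesis by (simp add: zero_le_mult_iff mult_less_0_iff)
  qed
  have dom: "norm (\<phi> (x, y)) \<le> C * B1 x * B2 y" for x y
    using pt[of x y] C0 B1(4)[of x] B2(2)[of y] nonneg B1(3)[of x]
    by (elim order_trans) (intro mult_mono mult_nonneg_nonneg, auto)
  have slice1: "(\<lambda>x. \<phi> (x, y)) \<in> test_functions X1 x0 1 (fst \<beta>) (fst \<gamma>)"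
    and slice2: "(\<lambda>y. \<phi> (x, y)) \<in> test_functions X2 y0 1 (snd \<beta>) (snd \<gamma>)" for x y
    using \<phi> unfolding prod_test_functions_def by auto
  have meas1: "(\<lambda>x. \<phi> (x, y)) \<in> borel_measurable (meas X1)" for y
    using slice1[of y] unfolding test_functions_def by (auto simp: has_bochner_integral_iff)
  have "partial_coef (meas X1) e \<phi> \<in> borel_measurable (meas X2)" if e: "square_integrable (meas X1) e" for e
  proof (rule borel_measurable_sequentially_continuous[OF X2])
    fix y s assume lim: "(\<lambda>n. qd X2 y (s n)) \<longlonglongrightarrow> 0"
    have e_meas: "e \<in> borel_measurable (meas X1)" using e unfolding square_integrable_def by auto
    show "(\<lambda>n. partial_coef (meas X1) e \<phi> (s n)) \<longlonglongrightarrow> partial_coef (meas X1) e \<phi> y"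
      unfolding partial_coef_def
    proof (rule integral_dominated_convergence)
      show "(\<lambda>x. \<phi> (x, y) * cnj (e x)) \<in> borel_measurable (meas X1)"
        "(\<lambda>x. \<phi> (x, s n) * cnj (e x)) \<in> borel_measurable (meas X1)" for n
        using meas1 e_meas by (auto intro!: borel_measurable_times borel_measurable_cnj)
      show "integrable (meas X1) (\<lambda>x. C * K * norm (complex_of_real (B1 x) * cnj (e x)))"
      proof (intro integrable_mult_right integrable_norm square_integrable_mult_cnj e)
        show "square_integrable (meas X1) (\<lambda>x. complex_of_real (B1 x))"
          using B1 unfolding square_integrable_def by auto
      qed
      show "AE x in meas X1. (\<lambda>n. \<phi> (x, s n) * cnj (e x)) \<longlonglongrightarrow> \<phi> (x, y) * cnj (e x)"
        using test_function_continuous[OF S2 slice2 _ \<beta> lim] by (auto intro!: tendsto_mult)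
      fix n
      have "norm (\<phi> (x, s n) * cnj (e x)) \<le> C * K * norm (complex_of_real (B1 x) * cnj (e x))" for x
      proof -
        have "norm (\<phi> (x, s n)) \<le> C * B1 x * B2 (s n)" by (rule dom)
        also have "\<dots> \<le> C * B1 x * K" using B2(1) C0 B1(3) by (intro mult_left_mono) auto
        finally have "norm (\<phi> (x, s n)) * norm (e x) \<le> C * B1 x * K * norm (e x)"
          by (rule mult_right_mono) simp
        then show ?thesis using B1(3)[of x] by (simp add: norm_mult ac_simps)
      qed
      then show "AE x in meas X1. norm (\<phi> (x, s n) * cnj (e x))
          \<le> C * K * norm (complex_of_real (B1 x) * cnj (e x))" by simp
    qed
  qed
  then show "tensor_dominated (meas X1) (meas X2) B1 B2 C \<phi>"
    unfolding tensor_dominated_def using meas1 dom by auto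
qed

section \<open>Wavelet series as distributions\<close>

definition rectangles :: "('a, 'z) whomog_scheme \<Rightarrow> ('b, 'w) whomog_scheme \<Rightarrow> (int \<times> 'a \<times> int \<times> 'b) set" where
  "rectangles X1 X2 = {(k1, y1, k2, y2). y1 \<in> wnodes X1 k1 \<and> y2 \<in> wnodes X2 k2}"

definition rectangle_wav ::
    "('a, 'z) whomog_scheme \<Rightarrow> ('b, 'w) whomog_scheme \<Rightarrow> int \<times> 'a \<times> int \<times> 'b \<Rightarrow> 'a \<times> 'b \<Rightarrow> complex" where
  "rectangle_wav X1 X2 = (\<lambda>(k1, y1, k2, y2). tensor_wav X1 X2 k1 y1 k2 y2)"

definition wavelet_coef ::
    "('a, 'z) whomog_scheme \<Rightarrow> ('b, 'w) whomog_scheme \<Rightarrow> int \<times> 'a \<times> int \<times> 'b \<Rightarrow>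
     ('a \<times> 'b \<Rightarrow> complex) \<Rightarrow> complex" where
  "wavelet_coef X1 X2 = (\<lambda>(k1, y1, k2, y2) \<phi>.
     tensor_coef (meas X1) (meas X2) (wav X1 k1 y1) (wav X2 k2 y2) \<phi>)"

lemma wavelet_orthonormal:
  assumes "wavelet_space T" "y \<in> wnodes T k"
  shows "square_integrable (meas T) (wav T k y)"
    "y' \<in> wnodes T k' \<Longrightarrow>
      (\<integral>x. wav T k y x * cnj (wav T k' y' x) \<partial>meas T) = (if (k, y) = (k', y') then 1 else 0)"
proof -
  have "orthonormal_basis_L2 (meas T) {(k, y). y \<in> wnodes T k} (\<lambda>(k, y). wav T k y)"
    using assms(1) unfolding wavelet_space_def wavelet_basis_def by auto
  note on = this[unfolded orthonormal_basis_L2_def]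
  show "square_integrable (meas T) (wav T k y)"
    using bspec[OF conjunct1[OF on], of "(k, y)"] assms(2) by auto
  show "(\<integral>x. wav T k y x * cnj (wav T k' y' x) \<partial>meas T) = (if (k, y) = (k', y') then 1 else 0)"
    if "y' \<in> wnodes T k'"
    using bspec[OF bspec[OF conjunct1[OF conjunct2[OF on]], of "(k, y)"], of "(k', y')"] assms(2) that by auto
qed

text \<open>Biorthogonality: it identifies the coefficients of a wavelet series.\<close>

lemma wavelet_coef_rectangle_wav:
  assumes X: "wavelet_space X1" "wavelet_space X2" and "i \<in> rectangles X1 X2" "j \<in> rectangles X1 X2"
  shows "wavelet_coef X1 X2 i (rectangle_wav X1 X2 j) = (if j = i then 1 else 0)"
proof -
  obtain k1 y1 k2 y2 l1 z1 l2 z2 where ij: "i = (k1, y1, k2, y2)" "j = (l1, z1, l2, z2)"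
    "y1 \<in> wnodes X1 k1" "y2 \<in> wnodes X2 k2" "z1 \<in> wnodes X1 l1" "z2 \<in> wnodes X2 l2"
    using assms(3,4) unfolding rectangles_def by auto
  show ?thesis
    unfolding ij(1,2) wavelet_coef_def rectangle_wav_def tensor_wav_def prod.case tensor_coef_product
      wavelet_orthonormal(2)[OF X(1) ij(5,3)] wavelet_orthonormal(2)[OF X(2) ij(6,4)]
    by auto
qed

lemma wavelet_coef_bessel:
  assumes X: "wavelet_space X1" "wavelet_space X2"
    and B: "square_integrable_majorants (meas X1) (meas X2) B1 B2"
    and \<phi>: "tensor_dominated (meas X1) (meas X2) B1 B2 C \<phi>"
    and F: "finite F" "F \<subseteq> rectangles X1 X2"
  shows "(\<Sum>i\<in>F. (norm (wavelet_coef X1 X2 i \<phi>))\<^sup>2)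
    \<le> C\<^sup>2 * (\<integral>x. (B1 x)\<^sup>2 \<partial>meas X1) * (\<integral>y. (B2 y)\<^sup>2 \<partial>meas X2)"
proof -
  interpret square_integrable_majorants "meas X1" "meas X2" B1 B2 by fact
  define F1 where "F1 = (\<lambda>(k1, y1, k2, y2). (k1, y1)) ` F"
  define F2 where "F2 = (\<lambda>(k1, y1, k2, y2). (k2, y2)) ` F"
  let ?g = "\<lambda>((k1, y1), (k2, y2)). (k1, y1, k2, y2)"
  have fin: "finite F1" "finite F2" unfolding F1_def F2_def using F(1) by auto
  have F1: "snd i \<in> wnodes X1 (fst i)" if "i \<in> F1" for i
    using that F(2) unfolding F1_def rectangles_def by auto
  have F2: "snd i \<in> wnodes X2 (fst i)" if "i \<in> F2" for i
    using that F(2) unfolding F2_def rectangles_def by auto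
  have sub: "F \<subseteq> ?g ` (F1 \<times> F2)"
    unfolding F1_def F2_def by (force simp: image_iff)
  have inj: "inj_on ?g (F1 \<times> F2)" by (auto simp: inj_on_def)
  have "(\<Sum>i\<in>F. (norm (wavelet_coef X1 X2 i \<phi>))\<^sup>2)
      \<le> (\<Sum>i\<in>?g ` (F1 \<times> F2). (norm (wavelet_coef X1 X2 i \<phi>))\<^sup>2)"
    using fin sub by (intro sum_mono2) auto
  also have "\<dots> = (\<Sum>(i, j)\<in>F1 \<times> F2. (norm (tensor_coef (meas X1) (meas X2)
      (wav X1 (fst i) (snd i)) (wav X2 (fst j) (snd j)) \<phi>))\<^sup>2)"
    unfolding sum.reindex[OF inj] by (intro sum.cong) (auto simp: wavelet_coef_def)
  also have "\<dots> = (\<Sum>i\<in>F1. \<Sum>j\<in>F2. (norm (tensor_coef (meas X1) (meas X2)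
      (wav X1 (fst i) (snd i)) (wav X2 (fst j) (snd j)) \<phi>))\<^sup>2)"
    by (rule sum.cartesian_product[symmetric])
  also have "\<dots> \<le> C\<^sup>2 * N1 * N2"
    by (rule tensor_bessel[OF \<phi> fin(1) _ _ fin(2)])
       (use F1 F2 in \<open>auto simp: wavelet_orthonormal[OF X(1)] wavelet_orthonormal[OF X(2)] prod_eq_iff\<close>)
  finally show ?thesis .
qed

definition wavelet_series ::
    "('a, 'z) whomog_scheme \<Rightarrow> ('b, 'w) whomog_scheme \<Rightarrow> (int \<times> 'a \<times> int \<times> 'b) set \<Rightarrow>
     (int \<times> 'a \<times> int \<times> 'b \<Rightarrow> complex) \<Rightarrow> ('a \<times> 'b \<Rightarrow> complex) \<Rightarrow> complex" where
  "wavelet_series X1 X2 A c \<phi> = (\<Sum>\<^sub>\<infinity>i\<in>A. c i * wavelet_coef X1 X2 i \<phi>)"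

lemma wavelet_series_rectangle_wav:
  assumes X: "wavelet_space X1" "wavelet_space X2" and "A \<subseteq> rectangles X1 X2" "j \<in> rectangles X1 X2"
  shows "wavelet_series X1 X2 A c (rectangle_wav X1 X2 j) = (if j \<in> A then c j else 0)"
proof -
  have "wavelet_series X1 X2 A c (rectangle_wav X1 X2 j) = (\<Sum>\<^sub>\<infinity>i\<in>A. if i = j then c j else 0)"
    unfolding wavelet_series_def
    using assms by (intro infsum_cong) (auto simp: wavelet_coef_rectangle_wav[OF X])
  also have "\<dots> = (\<Sum>\<^sub>\<infinity>i\<in>A \<inter> {j}. c j)"
    by (rule infsum_cong_neutral) auto
  also have "\<dots> = (if j \<in> A then c j else 0)" by auto
  finally show ?thesis .
qed

lemma l2_product_summable:
  fixes c d :: "'i \<Rightarrow> complex"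
  assumes c: "\<And>F. finite F \<Longrightarrow> F \<subseteq> A \<Longrightarrow> (\<Sum>i\<in>F. (norm (c i))\<^sup>2) \<le> N"
    and d: "\<And>F. finite F \<Longrightarrow> F \<subseteq> A \<Longrightarrow> (\<Sum>i\<in>F. (norm (d i))\<^sup>2) \<le> L"
  shows "(\<lambda>i. c i * d i) summable_on A" "norm (\<Sum>\<^sub>\<infinity>i\<in>A. c i * d i) \<le> sqrt N * sqrt L"
proof -
  have le: "(\<Sum>i\<in>F. norm (c i * d i)) \<le> sqrt N * sqrt L" if "finite F" "F \<subseteq> A" for F
  proof -
    have "(\<Sum>i\<in>F. norm (c i * d i)) = (\<Sum>i\<in>F. \<bar>norm (c i)\<bar> * \<bar>norm (d i)\<bar>)"
      by (simp add: norm_mult)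
    also have "\<dots> \<le> sqrt (\<Sum>i\<in>F. (norm (c i))\<^sup>2) * sqrt (\<Sum>i\<in>F. (norm (d i))\<^sup>2)"
      using L2_set_mult_ineq[of "\<lambda>i. norm (c i)" "\<lambda>i. norm (d i)" F] unfolding L2_set_def .
    also have "\<dots> \<le> sqrt N * sqrt L"
    proof (intro mult_mono)
      show "sqrt (\<Sum>i\<in>F. (norm (c i))\<^sup>2) \<le> sqrt N" using c[OF that] by (rule real_sqrt_le_mono)
      show "sqrt (\<Sum>i\<in>F. (norm (d i))\<^sup>2) \<le> sqrt L" using d[OF that] by (rule real_sqrt_le_mono)
      show "0 \<le> sqrt N" using c[of "{}"] by simp
    qed (simp add: sum_nonneg)
    finally show ?thesis .
  qed
  have abs: "(\<lambda>i. norm (c i * d i)) summable_on A"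
    by (rule nonneg_bdd_above_summable_on) (use le in \<open>auto intro!: bdd_aboveI2\<close>)
  then show "(\<lambda>i. c i * d i) summable_on A" by (rule abs_summable_summable)
  have "norm (\<Sum>\<^sub>\<infinity>i\<in>A. c i * d i) \<le> (\<Sum>\<^sub>\<infinity>i\<in>A. norm (c i * d i))"
    using abs by (rule norm_infsum_bound)
  also have "\<dots> \<le> sqrt N * sqrt L" using abs le by (rule infsum_le_finite_sums)
  finally show "norm (\<Sum>\<^sub>\<infinity>i\<in>A. c i * d i) \<le> sqrt N * sqrt L" .
qed

text \<open>For a test function \<open>\<phi>\<close> satisfying its defining estimates with the constant \<open>C\<close>, Bessel's inequality bounds
  the \<open>l\<^sup>2\<close> norm of its coefficients by a multiple of \<open>C\<close>. The Cauchy-Schwarz inequality gives the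
  convergence of the series and, on taking the infimum over \<open>C\<close>, its boundedness.\<close>

lemma wavelet_series_distribution:
  fixes X1 :: "('a, 'z) whomog_scheme" and X2 :: "('b, 'w) whomog_scheme"
  assumes X: "wavelet_space X1" "wavelet_space X2" and A: "A \<subseteq> rectangles X1 X2"
    and c: "\<And>F. finite F \<Longrightarrow> F \<subseteq> A \<Longrightarrow> (\<Sum>i\<in>F. (norm (c i))\<^sup>2) \<le> N"
    and \<beta>: "0 < snd \<beta>" and \<gamma>: "0 < fst \<gamma>" "0 < snd \<gamma>"
  shows "wavelet_series X1 X2 A c \<in> distributions X1 X2 (x0, y0) \<beta> \<gamma>"
proof -
  obtain B1 K1 where b1: "B1 \<in> borel_measurable (meas X1)" "integrable (meas X1) (\<lambda>x. (B1 x)\<^sup>2)"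
    "\<And>x. 0 \<le> B1 x" "\<And>x. B1 x \<le> K1"
    "\<And>x. bump (vol X1 x0 1 + vol2 X1 x x0) 1 (fst \<gamma>) (qd X1 x x0) \<le> B1 x"
    by (rule bump_majorant[OF wavelet_space_homogeneous[OF X(1)] \<gamma>(1), of x0]) (rule that)
  obtain B2 K2 where b2: "B2 \<in> borel_measurable (meas X2)" "integrable (meas X2) (\<lambda>y. (B2 y)\<^sup>2)"
    "\<And>y. 0 \<le> B2 y" "\<And>y. B2 y \<le> K2"
    "\<And>y. bump (vol X2 y0 1 + vol2 X2 y y0) 1 (snd \<gamma>) (qd X2 y y0) \<le> B2 y"
    by (rule bump_majorant[OF wavelet_space_homogeneous[OF X(2)] \<gamma>(2), of y0]) (rule that)
  interpret square_integrable_majorants "meas X1" "meas X2" B1 B2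
    using b1(2) b2(2) by unfold_locales
  let ?G = "test_completion X1 X2 (x0, y0) \<beta> \<gamma>" and ?S = "wavelet_series X1 X2 A c"
  let ?D = "tensor_dominated (meas X1) (meas X2) B1 B2"
  have dom: "0 \<le> C \<and> ?D C \<phi>"
    if "\<phi> \<in> ?G" "prod_test_bound X1 X2 (x0, y0) (1, 1) \<beta> \<gamma> \<phi> C" for \<phi> C
  proof -
    have "\<phi> \<in> prod_test_functions X1 X2 (x0, y0) (1, 1) \<beta> \<gamma>"
      using that(1) unfolding test_completion_def by auto
    from prod_test_function_tensor_dominated[OF X this \<beta> that(2) b1(2,1,3,5) b2(4,5)]
    show ?thesis by auto
  qed
  have ex: "\<exists>C. prod_test_bound X1 X2 (x0, y0) (1, 1) \<beta> \<gamma> \<phi> C" if "\<phi> \<in> ?G" for \<phi>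
    using that unfolding test_completion_def prod_test_functions_def by auto
  have summable: "(\<lambda>i. c i * wavelet_coef X1 X2 i \<phi>) summable_on A"
    and bound: "norm (?S \<phi>) \<le> sqrt N * sqrt (C\<^sup>2 * N1 * N2)" if "?D C \<phi>" for C \<phi>
    using l2_product_summable[of A c N "\<lambda>i. wavelet_coef X1 X2 i \<phi>" "C\<^sup>2 * N1 * N2", OF c]
      wavelet_coef_bessel[OF X square_integrable_majorants_axioms that] A
    unfolding wavelet_series_def by auto
  show ?thesis unfolding distributions_def
  proof (intro CollectI conjI ballI allI)
    fix \<phi> \<phi>' assume "\<phi> \<in> ?G" "\<phi>' \<in> ?G"
    then obtain C C' where "prod_test_bound X1 X2 (x0, y0) (1, 1) \<beta> \<gamma> \<phi> C"
      "prod_test_bound X1 X2 (x0, y0) (1, 1) \<beta> \<gamma> \<phi>' C'"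
      using ex[of \<phi>] ex[of \<phi>'] by auto
    then have C: "?D C \<phi>" "?D C' \<phi>'"
      using dom[OF \<open>\<phi> \<in> ?G\<close>] dom[OF \<open>\<phi>' \<in> ?G\<close>] by auto
    have "wavelet_coef X1 X2 i (\<lambda>z. \<phi> z + \<phi>' z) = wavelet_coef X1 X2 i \<phi> + wavelet_coef X1 X2 i \<phi>'"
      if "i \<in> A" for i
    proof -
      obtain k1 y1 k2 y2 where i: "i = (k1, y1, k2, y2)" "y1 \<in> wnodes X1 k1" "y2 \<in> wnodes X2 k2"
        using A \<open>i \<in> A\<close> unfolding rectangles_def by auto
      show ?thesis unfolding i(1) wavelet_coef_def prod.case
        by (rule tensor_coef_add[OF C])
           (use wavelet_orthonormal[OF X(1) i(2)] wavelet_orthonormal[OF X(2) i(3)] i in auto)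
    qed
    then have "?S (\<lambda>z. \<phi> z + \<phi>' z)
        = (\<Sum>\<^sub>\<infinity>i\<in>A. c i * wavelet_coef X1 X2 i \<phi> + c i * wavelet_coef X1 X2 i \<phi>')"
      unfolding wavelet_series_def by (intro infsum_cong) (simp add: distrib_left)
    also have "\<dots> = ?S \<phi> + ?S \<phi>'"
      unfolding wavelet_series_def using C by (intro infsum_add summable)
    finally show "?S (\<lambda>z. \<phi> z + \<phi>' z) = ?S \<phi> + ?S \<phi>'" .
  next
    fix a \<phi>
    have "wavelet_coef X1 X2 i (\<lambda>z. a * \<phi> z) = a * wavelet_coef X1 X2 i \<phi>" for i
      unfolding wavelet_coef_def by (auto simp: tensor_coef_mult split: prod.split)
    then show "?S (\<lambda>z. a * \<phi> z) = a * ?S \<phi>"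
      unfolding wavelet_series_def by (simp add: infsum_cmult_right'[symmetric] mult.left_commute)
  next
    \<comment> \<open>adding 1 makes the constant positive, so that one can divide by it\<close>
    let ?K = "sqrt N * sqrt (N1 * N2) + 1"
    have N: "0 \<le> N" using c[of "{}"] by simp
    have K: "0 < ?K"
      using N by (intro add_nonneg_pos mult_nonneg_nonneg real_sqrt_ge_zero integral_nonneg_AE) auto
    show "\<exists>K. \<forall>\<phi>\<in>?G. norm (?S \<phi>) \<le> K * prod_test_norm X1 X2 (x0, y0) (1, 1) \<beta> \<gamma> \<phi>"
    proof (intro exI[of _ ?K] ballI)
      fix \<phi> assume \<phi>: "\<phi> \<in> ?G"
      have "norm (?S \<phi>) / ?K \<le> prod_test_norm X1 X2 (x0, y0) (1, 1) \<beta> \<gamma> \<phi>"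
        unfolding prod_test_norm_def
      proof (rule cInf_greatest)
        show "{C. prod_test_bound X1 X2 (x0, y0) (1, 1) \<beta> \<gamma> \<phi> C} \<noteq> {}" using ex[OF \<phi>] by auto
        fix C assume "C \<in> {C. prod_test_bound X1 X2 (x0, y0) (1, 1) \<beta> \<gamma> \<phi> C}"
        then have C: "0 \<le> C" "?D C \<phi>" using dom[OF \<phi>] by auto
        have "norm (?S \<phi>) \<le> sqrt N * sqrt (C\<^sup>2 * N1 * N2)" by (rule bound[OF C(2)])
        also have "\<dots> = C * (sqrt N * sqrt (N1 * N2))"
          using C(1) by (simp add: real_sqrt_mult)
        also have "\<dots> \<le> C * ?K" using C(1) by (intro mult_left_mono) auto
        finally show "norm (?S \<phi>) / ?K \<le> C" using K by (simp add: divide_le_eq)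
      qed
      then show "norm (?S \<phi>) \<le> ?K * prod_test_norm X1 X2 (x0, y0) (1, 1) \<beta> \<gamma> \<phi>"
        using K by (simp add: divide_le_eq mult.commute)
    qed
  qed
qed

lemma distributions_diff:
  assumes f: "f \<in> distributions X1 X2 z0 \<beta> \<gamma>" and g: "g \<in> distributions X1 X2 z0 \<beta> \<gamma>"
  shows "(\<lambda>\<phi>. f \<phi> - g \<phi>) \<in> distributions X1 X2 z0 \<beta> \<gamma>"
proof -
  let ?G = "test_completion X1 X2 z0 \<beta> \<gamma>" and ?n = "prod_test_norm X1 X2 z0 (1, 1) \<beta> \<gamma>"
  obtain K where K: "\<forall>\<phi>\<in>?G. norm (f \<phi>) \<le> K * ?n \<phi>" using f unfolding distributions_def by blast
  obtain L where L: "\<forall>\<phi>\<in>?G. norm (g \<phi>) \<le> L * ?n \<phi>" using g unfolding distributions_def by blast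
  have "norm (f \<phi> - g \<phi>) \<le> (K + L) * ?n \<phi>" if "\<phi> \<in> ?G" for \<phi>
    using norm_triangle_ineq4[of "f \<phi>" "g \<phi>"] bspec[OF K that] bspec[OF L that]
    by (simp add: distrib_right)
  then have "\<exists>K. \<forall>\<phi>\<in>?G. norm (f \<phi> - g \<phi>) \<le> K * ?n \<phi>" by blast
  then show ?thesis using f g unfolding distributions_def by (auto simp: algebra_simps)
qed

section \<open>Square functions and the decomposition\<close>

definition first_cube :: "('a, 'z) whomog_scheme \<Rightarrow> int \<times> 'a \<times> int \<times> 'b \<Rightarrow> 'a set" where
  "first_cube X1 = (\<lambda>(k1, y1, k2, y2). cube X1 (k1 + 1) y1)"

definition second_cube :: "('b, 'w) whomog_scheme \<Rightarrow> int \<times> 'a \<times> int \<times> 'b \<Rightarrow> 'b set" where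
  "second_cube X2 = (\<lambda>(k1, y1, k2, y2). cube X2 (k2 + 1) y2)"

text \<open>The weight is \<open>|c\<^sub>R|\<^sup>2 / |R|\<close>, which turns the integral of the energy into \<open>\<Sum>\<^sub>R |c\<^sub>R|\<^sup>2\<close>.\<close>

definition energy_weight ::
    "('a, 'z) whomog_scheme \<Rightarrow> ('b, 'w) whomog_scheme \<Rightarrow> (int \<times> 'a \<times> int \<times> 'b \<Rightarrow> complex) \<Rightarrow>
     int \<times> 'a \<times> int \<times> 'b \<Rightarrow> ennreal" where
  "energy_weight X1 X2 c i = ennreal ((norm (c i))\<^sup>2 /
     (measure (meas X1) (first_cube X1 i) * measure (meas X2) (second_cube X2 i)))"

definition square_energy ::
    "('a, 'z) whomog_scheme \<Rightarrow> ('b, 'w) whomog_scheme \<Rightarrow> (int \<times> 'a \<times> int \<times> 'b \<Rightarrow> complex) \<Rightarrow>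
     (int \<times> 'a \<times> int \<times> 'b) set \<Rightarrow> 'a \<times> 'b \<Rightarrow> ennreal" where
  "square_energy X1 X2 c A z =
     (\<Sum>\<^sub>\<infinity>i\<in>A. energy_weight X1 X2 c i * indicator (first_cube X1 i \<times> second_cube X2 i) z)"

lemma wnodes_nodes: "y \<in> wnodes T k \<Longrightarrow> y \<in> nodes T (k + 1)"
  unfolding wnodes_def by auto

lemma first_cube_props:
  assumes "wavelet_space X1" "i \<in> rectangles X1 X2"
  shows "first_cube X1 i \<in> sets (meas X1)" "0 < emeasure (meas X1) (first_cube X1 i)"
    "emeasure (meas X1) (first_cube X1 i) < \<infinity>"
  using assms unfolding rectangles_def first_cube_def
  by (auto dest!: wnodes_nodes intro: cube_props[OF assms(1)] cube_props(4)[OF assms(1), unfolded infinity_ennreal_def])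

lemma second_cube_props:
  assumes "wavelet_space X2" "i \<in> rectangles X1 X2"
  shows "second_cube X2 i \<in> sets (meas X2)" "0 < emeasure (meas X2) (second_cube X2 i)"
    "emeasure (meas X2) (second_cube X2 i) < \<infinity>"
  using assms unfolding rectangles_def second_cube_def
  by (auto dest!: wnodes_nodes intro: cube_props[OF assms(1)] cube_props(4)[OF assms(1), unfolded infinity_ennreal_def])

lemma laminar_first_cube:
  assumes "wavelet_space X1"
  shows "laminar (rectangles X1 X2) (\<lambda>i. fst i + 1) (first_cube X1)"
proof -
  have "laminar (rectangles X1 X2) (\<lambda>i. fst i + 1) (\<lambda>i. cube X1 (fst i + 1) (fst (snd i)))"
    by (rule laminar_cubes[OF assms]) (auto simp: rectangles_def dest: wnodes_nodes)
  then show ?thesis unfolding first_cube_def by (simp add: case_prod_unfold)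
qed

lemma laminar_second_cube:
  assumes "wavelet_space X2"
  shows "laminar (rectangles X1 X2) (\<lambda>i. fst (snd (snd i)) + 1) (second_cube X2)"
proof -
  have "laminar (rectangles X1 X2) (\<lambda>i. fst (snd (snd i)) + 1)
      (\<lambda>i. cube X2 (fst (snd (snd i)) + 1) (snd (snd (snd i))))"
    by (rule laminar_cubes[OF assms]) (auto simp: rectangles_def dest: wnodes_nodes)
  then show ?thesis unfolding second_cube_def by (simp add: case_prod_unfold)
qed

lemma countable_rectangles:
  assumes "wavelet_space X1" "wavelet_space X2"
  shows "countable (rectangles X1 X2)"
proof -
  have "rectangles X1 X2 \<subseteq> UNIV \<times> (\<Union>k. nodes X1 k) \<times> UNIV \<times> (\<Union>k. nodes X2 k)"
    unfolding rectangles_def by (auto dest!: wnodes_nodes)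
  then show ?thesis
    by (rule countable_subset) (intro countable_SIGMA countable_UN countable_nodes assms countableI_type)
qed

lemma square_function_eq_square_energy:
  assumes X: "wavelet_space X1" "wavelet_space X2"
  shows "square_function X1 X2 f
    = (\<lambda>z. ennpowr (square_energy X1 X2 (\<lambda>i. f (rectangle_wav X1 X2 i)) (rectangles X1 X2) z) (1 / 2))"
proof -
  let ?c = "\<lambda>i. f (rectangle_wav X1 X2 i)"
  have nind: "(normalized_indicator M Q x)\<^sup>2 = indicator Q x / measure M Q"
    for M :: "'e measure" and Q x
  proof -
    have "(measure M Q powr (- 1 / 2))\<^sup>2 = 1 / measure M Q"
      by (cases "measure M Q = 0")
         (simp_all add: power2_eq_square powr_add[symmetric] powr_minus_divide)
    then show ?thesis unfolding normalized_indicator_def by (simp add: power_mult_distrib indicator_def)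
  qed
  have "ennreal ((norm (f (tensor_wav X1 X2 k1 y1 k2 y2)) *
            normalized_indicator (meas X1) (cube X1 (k1 + 1) y1) x1 *
            normalized_indicator (meas X2) (cube X2 (k2 + 1) y2) x2)\<^sup>2)
      = energy_weight X1 X2 ?c (k1, y1, k2, y2)
        * indicator (first_cube X1 (k1, y1, k2, y2) \<times> second_cube X2 (k1, y1, k2, y2)) (x1, x2)"
    for k1 y1 k2 y2 x1 x2
    unfolding power_mult_distrib nind energy_weight_def first_cube_def second_cube_def rectangle_wav_def
    by (auto simp: indicator_def)
  then show ?thesis
    unfolding square_function_def square_energy_def rectangles_def
    by (intro ext) (auto intro!: arg_cong[where f = "\<lambda>t. ennpowr t (1 / 2)"] infsum_cong)
qed

lemma square_energy_restrict:
  assumes "A \<subseteq> I" "\<And>i. i \<in> I \<Longrightarrow> c' i = (if i \<in> A then c i else 0)"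
  shows "square_energy X1 X2 c' I = square_energy X1 X2 c A"
  unfolding square_energy_def
  using assms by (intro ext infsum_cong_neutral) (auto simp: energy_weight_def)

lemma borel_measurable_square_energy:
  assumes X: "wavelet_space X1" "wavelet_space X2" and A: "A \<subseteq> rectangles X1 X2"
  shows "square_energy X1 X2 c A \<in> borel_measurable (meas X1 \<Otimes>\<^sub>M meas X2)"
proof -
  have "(\<lambda>z. energy_weight X1 X2 c i * indicator (first_cube X1 i \<times> second_cube X2 i) z)
      \<in> borel_measurable (meas X1 \<Otimes>\<^sub>M meas X2)" if "i \<in> A" for i
  proof -
    have i: "i \<in> rectangles X1 X2" using A that by auto
    have "first_cube X1 i \<times> second_cube X2 i \<in> sets (meas X1 \<Otimes>\<^sub>M meas X2)"
      by (intro pair_measureI first_cube_props(1)[OF X(1) i] second_cube_props(1)[OF X(2) i])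
    then show ?thesis by measurable
  qed
  then show ?thesis
    unfolding square_energy_def[abs_def]
    by (intro borel_measurable_infsum_ennreal countable_subset[OF A countable_rectangles[OF X]])
qed

lemma square_energy_mono: "A \<subseteq> B \<Longrightarrow> square_energy X1 X2 c A z \<le> square_energy X1 X2 c B z"
  unfolding square_energy_def by (rule ennreal_infsum_mono_set)

text \<open>Passes from square functions to energies, for which the estimates are proved.\<close>

lemma hardy_space_iff:
  assumes X: "wavelet_space X1" "wavelet_space X2" and q: "0 < q"
  defines "P \<equiv> \<lambda>f. \<integral>\<^sup>+z. ennpowr (square_energy X1 X2 (\<lambda>i. f (rectangle_wav X1 X2 i)) (rectangles X1 X2) z)
    (q / 2) \<partial>(meas X1 \<Otimes>\<^sub>M meas X2)"
  shows "f \<in> hardy_space X1 X2 z0 \<beta> \<gamma> q \<longleftrightarrow> f \<in> distributions X1 X2 z0 \<beta> \<gamma> \<and> P f < \<infinity>"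
    "P f < \<infinity> \<Longrightarrow> hardy_norm X1 X2 q f powr q = enn2real (P f)"
proof -
  let ?M = "meas X1 \<Otimes>\<^sub>M meas X2"
  have "Lq_norm ?M q (square_function X1 X2 f) = ennpowr (P f) (1 / q)"
    unfolding Lq_norm_def square_function_eq_square_energy[OF X] ennpowr_ennpowr P_def by simp
  note Lq = this
  have meas: "square_function X1 X2 f \<in> borel_measurable ?M"
    unfolding square_function_eq_square_energy[OF X]
    by (rule measurable_compose[OF borel_measurable_square_energy[OF X order_refl] measurable_ennpowr])
  have "ennpowr (P f) (1 / q) < \<infinity> \<longleftrightarrow> P f < \<infinity>" by (auto simp: ennpowr_def less_top)
  then show "f \<in> hardy_space X1 X2 z0 \<beta> \<gamma> q \<longleftrightarrow> f \<in> distributions X1 X2 z0 \<beta> \<gamma> \<and> P f < \<infinity>"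
    unfolding hardy_space_def using meas by (auto simp: Lq)
  assume "P f < \<infinity>"
  then have "enn2real (ennpowr (P f) (1 / q)) = enn2real (P f) powr (1 / q)" by (auto simp: ennpowr_def)
  then show "hardy_norm X1 X2 q f powr q = enn2real (P f)"
    unfolding hardy_norm_def Lq using q by (simp add: powr_powr)
qed

lemma sum_norm_square_le_square_energy:
  assumes X: "wavelet_space X1" "wavelet_space X2" and A: "A \<subseteq> rectangles X1 X2"
    and F: "finite F" "F \<subseteq> A"
  shows "ennreal (\<Sum>i\<in>F. (norm (c i))\<^sup>2) \<le> (\<integral>\<^sup>+z. square_energy X1 X2 c A z \<partial>(meas X1 \<Otimes>\<^sub>M meas X2))"
proof -
  interpret M2: sigma_finite_measure "meas X2"
    by (rule sigma_finite_homogeneous[OF wavelet_space_homogeneous[OF X(2)]])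
  let ?M = "meas X1 \<Otimes>\<^sub>M meas X2" and ?R = "\<lambda>i. first_cube X1 i \<times> second_cube X2 i"
  have weight: "energy_weight X1 X2 c i * emeasure ?M (?R i) = ennreal ((norm (c i))\<^sup>2)"
    and R: "?R i \<in> sets ?M" if "i \<in> F" for i
  proof -
    have i: "i \<in> rectangles X1 X2" using that F A by auto
    note Q1 = first_cube_props[OF X(1) i] and Q2 = second_cube_props[OF X(2) i]
    show "?R i \<in> sets ?M" using Q1 Q2 by auto
    have m: "emeasure (meas X1) (first_cube X1 i) = ennreal (measure (meas X1) (first_cube X1 i))"
      "emeasure (meas X2) (second_cube X2 i) = ennreal (measure (meas X2) (second_cube X2 i))"
      using Q1 Q2 by (auto intro: emeasure_eq_ennreal_measure)
    have pos: "0 < measure (meas X1) (first_cube X1 i)" "0 < measure (meas X2) (second_cube X2 i)"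
      using Q1(2) Q2(2) unfolding m by auto
    show "energy_weight X1 X2 c i * emeasure ?M (?R i) = ennreal ((norm (c i))\<^sup>2)"
      unfolding M2.emeasure_pair_measure_Times[OF Q1(1) Q2(1)] m energy_weight_def
      using pos by (simp add: ennreal_mult[symmetric])
  qed
  have "ennreal (\<Sum>i\<in>F. (norm (c i))\<^sup>2) = (\<Sum>i\<in>F. energy_weight X1 X2 c i * emeasure ?M (?R i))"
    using weight by (simp add: sum_ennreal[symmetric] del: sum_ennreal)
  also have "\<dots> = (\<integral>\<^sup>+z. (\<Sum>i\<in>F. energy_weight X1 X2 c i * indicator (?R i) z) \<partial>?M)"
    using R by (simp add: nn_integral_sum nn_integral_cmult_indicator)
  also have "\<dots> \<le> (\<integral>\<^sup>+z. square_energy X1 X2 c A z \<partial>?M)"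
    unfolding square_energy_def by (intro nn_integral_mono sum_le_ennreal_infsum F)
  finally show ?thesis .
qed

text \<open>The part \<open>h\<close> of \<open>f\<close> that belongs to \<open>A\<close> is the sum of a wavelet series with square summable coefficients.
  The complementary part is the difference, whether or not its own wavelet series converges.\<close>

lemma distribution_split:
  assumes X: "wavelet_space X1" "wavelet_space X2" and A: "A \<subseteq> rectangles X1 X2"
    and f: "f \<in> distributions X1 X2 (x0, y0) \<beta> \<gamma>"
    and \<beta>: "0 < snd \<beta>" and \<gamma>: "0 < fst \<gamma>" "0 < snd \<gamma>"
  defines "c \<equiv> \<lambda>i. f (rectangle_wav X1 X2 i)"
  assumes fin: "(\<integral>\<^sup>+z. square_energy X1 X2 c A z \<partial>(meas X1 \<Otimes>\<^sub>M meas X2)) < \<infinity>"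
  obtains h h' where "h \<in> distributions X1 X2 (x0, y0) \<beta> \<gamma>" "h' \<in> distributions X1 X2 (x0, y0) \<beta> \<gamma>"
    "\<And>\<phi>. f \<phi> = h \<phi> + h' \<phi>"
    "square_energy X1 X2 (\<lambda>i. h (rectangle_wav X1 X2 i)) (rectangles X1 X2) = square_energy X1 X2 c A"
    "square_energy X1 X2 (\<lambda>i. h' (rectangle_wav X1 X2 i)) (rectangles X1 X2)
      = square_energy X1 X2 c (rectangles X1 X2 - A)"
proof -
  let ?h = "wavelet_series X1 X2 A c" and ?I = "rectangles X1 X2"
  let ?N = "\<integral>\<^sup>+z. square_energy X1 X2 c A z \<partial>(meas X1 \<Otimes>\<^sub>M meas X2)"
  have h: "?h \<in> distributions X1 X2 (x0, y0) \<beta> \<gamma>"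
  proof (rule wavelet_series_distribution[OF X A _ \<beta> \<gamma>])
    fix F assume F: "finite F" "F \<subseteq> A"
    have "ennreal (\<Sum>i\<in>F. (norm (c i))\<^sup>2) \<le> ?N"
      by (rule sum_norm_square_le_square_energy[OF X A F])
    then have "enn2real (ennreal (\<Sum>i\<in>F. (norm (c i))\<^sup>2)) \<le> enn2real ?N"
      using fin by (intro enn2real_mono) auto
    then show "(\<Sum>i\<in>F. (norm (c i))\<^sup>2) \<le> enn2real ?N" by (simp add: sum_nonneg)
  qed
  have coef: "?h (rectangle_wav X1 X2 i) = (if i \<in> A then c i else 0)" if "i \<in> ?I" for i
    by (rule wavelet_series_rectangle_wav[OF X A that])
  show ?thesis
  proof (rule that[of ?h "\<lambda>\<phi>. f \<phi> - ?h \<phi>"])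
    show "square_energy X1 X2 (\<lambda>i. ?h (rectangle_wav X1 X2 i)) ?I = square_energy X1 X2 c A"
      by (rule square_energy_restrict[OF A coef])
    show "square_energy X1 X2 (\<lambda>i. f (rectangle_wav X1 X2 i) - ?h (rectangle_wav X1 X2 i)) ?I
        = square_energy X1 X2 c (?I - A)"
      by (rule square_energy_restrict) (use coef in \<open>auto simp: c_def\<close>)
  qed (use h f in \<open>auto intro: distributions_diff\<close>)
qed

lemma enn2real_le_of_le_mult:
  assumes "T \<le> ennreal a * (ennreal b * P)" "P < \<infinity>" "0 \<le> a" "0 \<le> b"
  shows "T < \<infinity>" "enn2real T \<le> a * b * enn2real P"
proof -
  have "T \<le> ennreal (a * b * enn2real P)"
    using assms by (cases P) (auto simp: ennreal_mult[symmetric] mult.assoc)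
  then show "T < \<infinity>" "enn2real T \<le> a * b * enn2real P"
    using assms by (auto simp: le_less_trans intro!: enn2real_leI)
qed

theorem theorem6p1:
  fixes X1 :: "'a whomog" and X2 :: "'b whomog"
    and x0 :: 'a and y0 :: 'b
    and \<omega>1 \<omega>2 \<beta>1 \<beta>2 \<gamma>1 \<gamma>2 p p1 p2 :: real
  assumes "wavelet_space X1" and "wavelet_space X2"
    and "upper_dimension X1 \<omega>1" and "upper_dimension X2 \<omega>2"
    and "0 < \<beta>1" and "\<beta>1 < hexp X1" and "0 < \<beta>2" and "\<beta>2 < hexp X2"
    and "0 < \<gamma>1" and "0 < \<gamma>2"
    and "max (\<omega>1 / (\<omega>1 + hexp X1)) (\<omega>2 / (\<omega>2 + hexp X2)) < p2" and "p2 \<le> 1"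
    and "p2 < p" and "p < p1"
  shows "\<exists>C>0. \<forall>\<alpha>>0. \<forall>f \<in> hardy_space X1 X2 (x0, y0) (\<beta>1, \<beta>2) (\<gamma>1, \<gamma>2) p.
    \<exists>g \<in> hardy_space X1 X2 (x0, y0) (\<beta>1, \<beta>2) (\<gamma>1, \<gamma>2) p1.
    \<exists>b \<in> hardy_space X1 X2 (x0, y0) (\<beta>1, \<beta>2) (\<gamma>1, \<gamma>2) p2.
      (\<forall>\<phi> \<in> test_completion X1 X2 (x0, y0) (\<beta>1, \<beta>2) (\<gamma>1, \<gamma>2). f \<phi> = g \<phi> + b \<phi>) \<and>
      hardy_norm X1 X2 p1 g powr p1 \<le> C * \<alpha> powr (p1 - p) * hardy_norm X1 X2 p f powr p \<and>
      hardy_norm X1 X2 p2 b powr p2 \<le> C * \<alpha> powr (p2 - p) * hardy_norm X1 X2 p f powr p"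
proof -
  note X = assms(1,2)
  interpret M1: sigma_finite_measure "meas X1"
    by (rule sigma_finite_homogeneous[OF wavelet_space_homogeneous[OF X(1)]])
  interpret M2: sigma_finite_measure "meas X2"
    by (rule sigma_finite_homogeneous[OF wavelet_space_homogeneous[OF X(2)]])
  interpret pair_sigma_finite "meas X1" "meas X2" ..
  let ?M = "meas X1 \<Otimes>\<^sub>M meas X2" and ?I = "rectangles X1 X2"
  let ?\<beta> = "(\<beta>1, \<beta>2)" and ?\<gamma> = "(\<gamma>1, \<gamma>2)"
  have p2: "0 < p2"
  proof -
    have "0 < \<omega>1 / (\<omega>1 + hexp X1)"
      using assms(3,5,6) unfolding upper_dimension_def by auto
    then show ?thesis using assms(11) by linarith
  qed
  \<comment> \<open>an exponent \<open>2 r\<close> above both \<open>p1\<close> and 2: the first is the target, the second gives \<open>L\<^sup>2\<close>\<close>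
  obtain m :: nat where "max p1 2 \<le> real m" using real_arch_simple by blast
  define r where "r = real (Suc m)"
  have r: "p1 / 2 \<le> r" "1 \<le> r" "p / 2 \<le> r"
    using \<open>max p1 2 \<le> real m\<close> assms(14) p2 assms(13) unfolding r_def by auto
  define C0 where "C0 = ((2 * r * 4) ^ Suc m) ^ 2"
  have C0: "0 \<le> C0" "((2 * of_nat (Suc m) * 4) ^ Suc m) ^ 2 = ennreal C0"
  proof -
    have "2 * of_nat (Suc m) * 4 = ennreal 2 * ennreal r * ennreal 4"
      unfolding r_def by (simp only: ennreal_numeral ennreal_of_nat_eq_real_of_nat)
    also have "\<dots> = ennreal (2 * r * 4)" using r(2) by (simp only: ennreal_mult)
    finally have "((2 * of_nat (Suc m) * 4) ^ Suc m) ^ 2 = (ennreal (2 * r * 4) ^ Suc m) ^ 2" by (rule arg_cong)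
    also have "(ennreal (2 * r * 4) ^ Suc m) ^ 2 = ennreal C0"
    proof -
      have "0 \<le> 2 * r * 4" using r(2) by simp
      then show ?thesis unfolding C0_def by (simp only: ennreal_power zero_le_power)
    qed
    finally show "((2 * of_nat (Suc m) * 4) ^ Suc m) ^ 2 = ennreal C0" .
  qed (simp add: C0_def)
  define C where "C = max 17 (1 + C0)"
  have C: "0 < C" "17 \<le> C" "1 + C0 \<le> C" unfolding C_def by auto
  have half_powr: "(\<alpha>\<^sup>2) powr (a / 2) = \<alpha> powr a" if "0 < \<alpha>" for \<alpha> a :: real
  proof -
    have "\<alpha>\<^sup>2 = \<alpha> powr 2" using that by simp
    then show ?thesis by (simp only: powr_powr) simp
  qed
  show ?thesis
  proof (intro exI[of _ C] conjI allI impI ballI C(1))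
    fix \<alpha> :: real and f
    assume \<alpha>: "0 < \<alpha>" and f: "f \<in> hardy_space X1 X2 (x0, y0) ?\<beta> ?\<gamma> p"
    define c where "c = (\<lambda>i. f (rectangle_wav X1 X2 i))"
    let ?T = "square_energy X1 X2 c"
    define P where "P = (\<integral>\<^sup>+z. ennpowr (?T ?I z) (p / 2) \<partial>?M)"
    have p: "0 < p" using p2 assms(13) by simp
    note hardy = hardy_space_iff[OF X]
    have f_dist: "f \<in> distributions X1 X2 (x0, y0) ?\<beta> ?\<gamma>" and P: "P < \<infinity>"
      using f unfolding hardy(1)[OF p] P_def c_def by auto
    have norm_f: "hardy_norm X1 X2 p f powr p = enn2real P"
      using hardy(2)[OF p, of f] P unfolding P_def c_def by auto
    have T [measurable]: "?T A \<in> borel_measurable ?M" if "A \<subseteq> ?I" for A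
      by (rule borel_measurable_square_energy[OF X that])
    obtain A where A: "A \<subseteq> ?I"
      and good: "(\<integral>\<^sup>+z. ?T A z ^ Suc m \<partial>?M) \<le> ennreal C0 * (ennreal ((\<alpha>\<^sup>2) powr (r - p / 2)) * P)"
      and bad: "(\<integral>\<^sup>+z. ennpowr (?T (?I - A) z) (p2 / 2) \<partial>?M) \<le> 17 * (ennreal ((\<alpha>\<^sup>2) powr (p2 / 2 - p / 2)) * P)"
    proof (rule rectangle_square_function_split[OF countable_rectangles[OF X]
          laminar_first_cube[OF X(1)] laminar_second_cube[OF X(2)],
          where a = "energy_weight X1 X2 c" and c = "\<alpha>\<^sup>2" and p = "p / 2" and q = "p2 / 2" and m = m])
      show "energy_weight X1 X2 c i < \<infinity>" for i unfolding energy_weight_def by simp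
      show "p / 2 \<le> real (Suc m)" using r(3) unfolding r_def .
      let ?S = "\<lambda>A z. \<Sum>\<^sub>\<infinity>i\<in>A. energy_weight X1 X2 c i * indicator (first_cube X1 i \<times> second_cube X2 i) z"
      fix A assume A: "A \<subseteq> ?I"
        "(\<integral>\<^sup>+z. ?S A z ^ Suc m \<partial>?M) \<le> ((2 * of_nat (Suc m) * 4) ^ Suc m) ^ 2 *
          (ennreal ((\<alpha>\<^sup>2) powr (real (Suc m) - p / 2)) * (\<integral>\<^sup>+z. ennpowr (?S ?I z) (p / 2) \<partial>?M))"
        "(\<integral>\<^sup>+z. ennpowr (?S (?I - A) z) (p2 / 2) \<partial>?M) \<le>
          17 * (ennreal ((\<alpha>\<^sup>2) powr (p2 / 2 - p / 2)) * (\<integral>\<^sup>+z. ennpowr (?S ?I z) (p / 2) \<partial>?M))"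
      show thesis
        by (rule that[OF A(1)]; unfold square_energy_def P_def r_def C0(2)[symmetric]) (rule A)+
    qed (use first_cube_props[OF X(1)] second_cube_props[OF X(2)] \<alpha> p2 assms(13) in auto)
    have T_le: "(\<integral>\<^sup>+z. ennpowr (?T B z) (p / 2) \<partial>?M) \<le> P" if "B \<subseteq> ?I" for B
      unfolding P_def using p that by (intro nn_integral_mono ennpowr_mono square_energy_mono) auto
    have interpolate: "(\<integral>\<^sup>+z. ennpowr (?T A z) q \<partial>?M)
        \<le> ennreal (1 + C0) * (ennreal ((\<alpha>\<^sup>2) powr (q - p / 2)) * P)" if q: "p / 2 \<le> q" "q \<le> r" for q
    proof -
      have "(\<integral>\<^sup>+z. ennpowr (?T A z) q \<partial>?M)
          \<le> ennreal ((\<alpha>\<^sup>2) powr (q - p / 2)) * (\<integral>\<^sup>+z. ennpowr (?T A z) (p / 2) \<partial>?M)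
            + ennreal ((\<alpha>\<^sup>2) powr (q - r)) * (\<integral>\<^sup>+z. ennpowr (?T A z) r \<partial>?M)"
        using \<alpha> q T[OF A] by (intro nn_integral_ennpowr_interpolate) auto
      also have "\<dots> \<le> ennreal ((\<alpha>\<^sup>2) powr (q - p / 2)) * P
            + ennreal ((\<alpha>\<^sup>2) powr (q - r)) * (ennreal C0 * (ennreal ((\<alpha>\<^sup>2) powr (r - p / 2)) * P))"
        using good unfolding r_def ennpowr_Suc
        by (intro add_mono mult_left_mono T_le A) auto
      also have "ennreal ((\<alpha>\<^sup>2) powr (q - r)) * (ennreal C0 * (ennreal ((\<alpha>\<^sup>2) powr (r - p / 2)) * P))
          = ennreal C0 * (ennreal ((\<alpha>\<^sup>2) powr (q - r)) * ennreal ((\<alpha>\<^sup>2) powr (r - p / 2)) * P)"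
        by (simp only: ac_simps)
      also have "ennreal ((\<alpha>\<^sup>2) powr (q - r)) * ennreal ((\<alpha>\<^sup>2) powr (r - p / 2)) = ennreal ((\<alpha>\<^sup>2) powr (q - p / 2))"
        by (simp add: ennreal_mult[symmetric] powr_add[symmetric])
      also have "ennreal ((\<alpha>\<^sup>2) powr (q - p / 2)) * P + ennreal C0 * (ennreal ((\<alpha>\<^sup>2) powr (q - p / 2)) * P)
          = ennreal (1 + C0) * (ennreal ((\<alpha>\<^sup>2) powr (q - p / 2)) * P)"
        using C0(1) by (simp add: distrib_right)
      finally show ?thesis .
    qed
    have good_p1: "(\<integral>\<^sup>+z. ennpowr (?T A z) (p1 / 2) \<partial>?M) \<le> ennreal C * (ennreal (\<alpha> powr (p1 - p)) * P)"
    proof -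
      have "(\<integral>\<^sup>+z. ennpowr (?T A z) (p1 / 2) \<partial>?M)
          \<le> ennreal (1 + C0) * (ennreal ((\<alpha>\<^sup>2) powr (p1 / 2 - p / 2)) * P)"
        using assms(14) r(1) by (intro interpolate) auto
      also have "(\<alpha>\<^sup>2) powr (p1 / 2 - p / 2) = \<alpha> powr (p1 - p)"
        using half_powr[OF \<alpha>, of "p1 - p"] by (simp add: diff_divide_distrib)
      also have "ennreal (1 + C0) * (ennreal (\<alpha> powr (p1 - p)) * P) \<le> ennreal C * (ennreal (\<alpha> powr (p1 - p)) * P)"
        using C by (intro mult_right_mono ennreal_leI) auto
      finally show ?thesis .
    qed
    have bad_p2: "(\<integral>\<^sup>+z. ennpowr (?T (?I - A) z) (p2 / 2) \<partial>?M) \<le> ennreal C * (ennreal (\<alpha> powr (p2 - p)) * P)"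
    proof -
      note bad
      also have "(\<alpha>\<^sup>2) powr (p2 / 2 - p / 2) = \<alpha> powr (p2 - p)"
        using half_powr[OF \<alpha>, of "p2 - p"] by (simp add: diff_divide_distrib)
      also have "17 * (ennreal (\<alpha> powr (p2 - p)) * P) \<le> ennreal C * (ennreal (\<alpha> powr (p2 - p)) * P)"
        using C(2) ennreal_leI[OF C(2)] by (intro mult_right_mono) auto
      finally show ?thesis .
    qed
    have \<beta>: "0 < snd ?\<beta>" and \<gamma>: "0 < fst ?\<gamma>" "0 < snd ?\<gamma>" using assms(7,9,10) by auto
    obtain g b where gb: "g \<in> distributions X1 X2 (x0, y0) ?\<beta> ?\<gamma>" "b \<in> distributions X1 X2 (x0, y0) ?\<beta> ?\<gamma>"
      "\<And>\<phi>. f \<phi> = g \<phi> + b \<phi>"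
      "square_energy X1 X2 (\<lambda>i. g (rectangle_wav X1 X2 i)) ?I = ?T A"
      "square_energy X1 X2 (\<lambda>i. b (rectangle_wav X1 X2 i)) ?I = ?T (?I - A)"
    \<comment> \<open>only one of the two parts has its square function in \<open>L\<^sup>2\<close> in general\<close>
    proof (cases "p \<le> 2")
      case True
      have fin: "(\<integral>\<^sup>+z. ?T A z \<partial>?M) < \<infinity>"
        using enn2real_le_of_le_mult(1)[OF interpolate[of 1]] True r P C0(1) by simp
      show ?thesis
        by (rule distribution_split[OF X A f_dist \<beta> \<gamma> fin[unfolded c_def]])
           (rule that[unfolded c_def])
    next
      case False
      have "(\<integral>\<^sup>+z. ?T (?I - A) z \<partial>?M)
          \<le> ennreal (1 powr (1 - p2 / 2)) * (\<integral>\<^sup>+z. ennpowr (?T (?I - A) z) (p2 / 2) \<partial>?M)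
            + ennreal (1 powr (1 - p / 2)) * (\<integral>\<^sup>+z. ennpowr (?T (?I - A) z) (p / 2) \<partial>?M)"
        using nn_integral_ennpowr_interpolate[of 1 "p2 / 2" 1 "p / 2" "?T (?I - A)" ?M] T[of "?I - A"] False assms(12)
        by simp
      also have "\<dots> < \<infinity>"
        using enn2real_le_of_le_mult(1)[OF bad_p2] P C(1) T_le[of "?I - A"] by (auto simp: le_less_trans)
      finally have fin: "(\<integral>\<^sup>+z. ?T (?I - A) z \<partial>?M) < \<infinity>" .
      have compl: "?I - (?I - A) = A" using A by auto
      show ?thesis
      proof (rule distribution_split[OF X Diff_subset f_dist \<beta> \<gamma> fin[unfolded c_def]])
        fix b g
        assume "b \<in> distributions X1 X2 (x0, y0) ?\<beta> ?\<gamma>" "g \<in> distributions X1 X2 (x0, y0) ?\<beta> ?\<gamma>"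
          and sum: "\<And>\<phi>. f \<phi> = b \<phi> + g \<phi>"
          and "square_energy X1 X2 (\<lambda>i. b (rectangle_wav X1 X2 i)) ?I
            = square_energy X1 X2 (\<lambda>i. f (rectangle_wav X1 X2 i)) (?I - A)"
            "square_energy X1 X2 (\<lambda>i. g (rectangle_wav X1 X2 i)) ?I
            = square_energy X1 X2 (\<lambda>i. f (rectangle_wav X1 X2 i)) (?I - (?I - A))"
        then show ?thesis
          by (intro that[of g b]) (simp_all only: c_def compl sum add.commute)
      qed
    qed
    have g: "(\<integral>\<^sup>+z. ennpowr (?T A z) (p1 / 2) \<partial>?M) < \<infinity>"
      "enn2real (\<integral>\<^sup>+z. ennpowr (?T A z) (p1 / 2) \<partial>?M) \<le> C * \<alpha> powr (p1 - p) * enn2real P"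
      using enn2real_le_of_le_mult[OF good_p1 P] C(1) by auto
    have b: "(\<integral>\<^sup>+z. ennpowr (?T (?I - A) z) (p2 / 2) \<partial>?M) < \<infinity>"
      "enn2real (\<integral>\<^sup>+z. ennpowr (?T (?I - A) z) (p2 / 2) \<partial>?M) \<le> C * \<alpha> powr (p2 - p) * enn2real P"
      using enn2real_le_of_le_mult[OF bad_p2 P] C(1) by auto
    have p1: "0 < p1" using p assms(14) by simp
    show "\<exists>g \<in> hardy_space X1 X2 (x0, y0) ?\<beta> ?\<gamma> p1. \<exists>b \<in> hardy_space X1 X2 (x0, y0) ?\<beta> ?\<gamma> p2.
      (\<forall>\<phi> \<in> test_completion X1 X2 (x0, y0) ?\<beta> ?\<gamma>. f \<phi> = g \<phi> + b \<phi>) \<and>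
      hardy_norm X1 X2 p1 g powr p1 \<le> C * \<alpha> powr (p1 - p) * hardy_norm X1 X2 p f powr p \<and>
      hardy_norm X1 X2 p2 b powr p2 \<le> C * \<alpha> powr (p2 - p) * hardy_norm X1 X2 p f powr p"
    proof (rule bexI[of _ g], rule bexI[of _ b], intro conjI ballI gb(3))
      show "g \<in> hardy_space X1 X2 (x0, y0) ?\<beta> ?\<gamma> p1" unfolding hardy(1)[OF p1] gb(4) using gb(1) g(1) by simp
      show "b \<in> hardy_space X1 X2 (x0, y0) ?\<beta> ?\<gamma> p2" unfolding hardy(1)[OF p2] gb(5) using gb(2) b(1) by simp
      show "hardy_norm X1 X2 p1 g powr p1 \<le> C * \<alpha> powr (p1 - p) * hardy_norm X1 X2 p f powr p"
        using hardy(2)[OF p1, of g] g unfolding gb(4) norm_f by simp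
      show "hardy_norm X1 X2 p2 b powr p2 \<le> C * \<alpha> powr (p2 - p) * hardy_norm X1 X2 p f powr p"
        using hardy(2)[OF p2, of b] b unfolding gb(5) norm_f by simp
    qed
  qed
qed

end
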